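(* Let $R$ be an algebra over a commutative ring $\mathbb K$, let $\mathcal B$ be a right $\times_R$-Hopf algebra over $R$, and let $S\subseteq T$ be a $\mathcal B$-Galois extension. Consider $\mathcal B$ as a right $\mathcal B$-module coring via right multiplication, and the stable anti Yetter-Drinfel'd $\mathcal B$-module $T_S=T/[S,T]$. Then the cyclic $\mathbb K$-module $Z_\ast(\mathcal B,T_S)$, with $Z_n(\mathcal B,T_S)=\mathcal B^{\otimes_R\,n+1}\otimes_{\mathcal B}T_S$, is isomorphic to the cyclic $\mathbb K$-module $Z_\ast(T/S)$, with $Z_n(T/S)=T^{\widehat\otimes_S\,n+1}$.
   Context: All algebras are associative and unital; implicit summation is used in index notations. An $R$-coring is a coalgebra in the monoidal category of $R$-bimodules. Right bialgebroid over $R$: data $\mathcal B=(B,\xi,\zeta,\Delta,\epsilon)$ with $B$ a $\mathbb K$-algebra, $\xi:R\to B$ and $\zeta:R^{op}\to B$ algebra maps with commuting ranges; $B$ is an $R$-bimodule by $r_1\cdot b\cdot r_2=b\,\zeta(r_1)\xi(r_2)$; $\Delta:B\to B\otimes_RB$, $b\mapsto b^{(1)}\otimes_Rb^{(2)}$, and $\epsilon:B\to R$ make this bimodule an $R$-coring; and (i) $\xi(r)b^{(1)}\otimes_Rb^{(2)}=b^{(1)}\otimes_R\zeta(r)b^{(2)}$; (ii) $\Delta(1_B)=1_B\otimes_R1_B$, $\Delta(bb')=b^{(1)}b'^{(1)}\otimes_Rb^{(2)}b'^{(2)}$; (iii) $\epsilon(1_B)=1_R$, $\epsilon(bb')=\epsilon(\xi(\epsilon(b))b')$.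 It is a right $\times_R$-Hopf algebra if $\vartheta:\mathcal B\otimes_{R^{op}}\mathcal B\to\mathcal B\otimes_R\mathcal B$, $b\otimes_{R^{op}}b'\mapsto bb'^{(1)}\otimes_Rb'^{(2)}$ is bijective; here in the domain $b\zeta(r)\otimes_{R^{op}}b'=b\otimes_{R^{op}}\zeta(r)b'$, and in the codomain $b\xi(r)\otimes_Rb'=b\otimes_Rb'\zeta(r)$. A right $\mathcal B$-comodule is a right $R$-module $X$ with a right $R$-linear, coassociative, counital coaction $X\to X\otimes_R\mathcal B$, $x\mapsto x^{[0]}\otimes_Rx^{[1]}$; it is an $R$-bimodule with left action $r\cdot x:=x^{[0]}\cdot\epsilon(\xi(r)x^{[1]})$. A right $\mathcal B$-comodule algebra is a $\mathbb K$-algebra and right $\mathcal B$-comodule $T$ whose multiplication is $R$-balanced and such that $1_T^{[0]}\otimes_R1_T^{[1]}=1_T\otimes_R1_B$ and $(tt')^{[0]}\otimes_R(tt')^{[1]}=t^{[0]}t'^{[0]}\otimes_Rt^{[1]}t'^{[1]}$. Its coinvariant subalgebra is $S=\{s\in T\mid s^{[0]}\otimes_Rs^{[1]}=s\otimes_R1_B\}$. It is a $\mathcal B$-Galois extension of $S$ if $\mathrm{can}:T\otimes_ST\to T\otimes_R\mathcal B$, $t'\otimes_St\mapsto t't^{[0]}\otimes_Rt^{[1]}$ is bijective. Write $b^{\{-\}}\otimes_Sb^{\{+\}}:=\mathrm{can}^{-1}(1_T\otimes_Rb)\in(T\otimes_ST)^S$. $T_S:=T/[S,T]$, where $[S,T]$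 is the $\mathbb K$-submodule generated by all $st-ts$ ($s\in S$, $t\in T$), with canonical epimorphism $p_T:T\to T_S$; right $\mathcal B$-coaction $p_T(t)\mapsto p_T(t^{[0]})\otimes_Rt^{[1]}$ and left $\mathcal B$-action $b\triangleright p_T(t)=p_T(b^{\{+\}}tb^{\{-\}})$. (With these structures $T_S$ is a stable anti Yetter-Drinfel'd $\mathcal B$-module.) $Z_n(\mathcal B,T_S)=\mathcal B^{\otimes_R\,n+1}\otimes_{\mathcal B}T_S$, where $\mathcal B^{\otimes_R\,n+1}$ is a right $\mathcal B$-module via the diagonal action $(b_0\otimes_R\dots\otimes_Rb_n)\triangleleft b=b_0b^{(1)}\otimes_R\dots\otimes_Rb_nb^{(n+1)}$; for $0\le k\le n$ the face $d_k$ applies $\epsilon$ to $b_k$ (absorbing the result via the $R$-actions; in degrees $n\geq 1$), the degeneracy $s_k$ applies $\Delta$ to $b_k$, and the cyclic map is $(b_0\otimes_R\dots\otimes_Rb_n)\otimes_{\mathcal B}x\mapsto(b_nx^{[1]}\otimes_Rb_0\otimes_R\dots\otimes_Rb_{n-1})\otimes_{\mathcal B}x^{[0]}$. $Z_n(T/S)=T^{\widehat\otimes_S\,n+1}$ is the cyclic tensor product: the quotient of $T^{\otimes_S\,n+1}$ by the $\mathbb K$-submodule generated by $s\cdot y-y\cdot s$ ($s\in S$, $y\in T^{\otimes_S\,n+1}$). Faces: $d_k(t_0\widehat\otimes_S\dots\widehat\otimes_St_n)=t_0\widehat\otimes_S\dots\widehat\otimes_St_kt_{k+1}\widehat\otimes_S\dots\widehat\otimes_St_n$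 for $0\le k<n$ and $d_n(t_0\widehat\otimes_S\dots\widehat\otimes_St_n)=t_nt_0\widehat\otimes_St_1\widehat\otimes_S\dots\widehat\otimes_St_{n-1}$; the degeneracy $s_k$ inserts $1_T$ right after $t_k$ ($0\le k\le n$); cyclic map $t_0\widehat\otimes_S\dots\widehat\otimes_St_n\mapsto t_n\widehat\otimes_St_0\widehat\otimes_S\dots\widehat\otimes_St_{n-1}$. An isomorphism of cyclic $\mathbb K$-modules is a family of $\mathbb K$-module isomorphisms in each degree commuting with faces, degeneracies and cyclic maps. *)

theory Defs
  imports HOL.Hull "HOL-Library.Poly_Mapping" "HOL-Library.Set_Algebras"
begin

text \<open>Algebras are types of sort \<open>{ring, monoid_mult}\<close> and the ground ring is a type of sort
  \<open>{comm_ring, comm_monoid_mult}\<close>; unlike \<open>ring_1\<close> and \<open>comm_ring_1\<close> these sorts include the zero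
  ring, which is why the library locale \<open>module\<close> is not used. Quotients and tensor products depend on
  the structure maps, so they are sets of cosets inside a type, and a module is a carrier in a
  type with \<open>+\<close>, together with a scalar multiplication. Cosets are added elementwise.\<close>

section \<open>Modules over the ground ring\<close>

record ('k, 'm) kmod =
  carr :: "'m set"
  sm :: "'k \<Rightarrow> 'm \<Rightarrow> 'm"

definition kmodule ::
  "('k::{comm_ring,comm_monoid_mult}, 'm::plus, 'z) kmod_scheme \<Rightarrow> bool" where
  "kmodule M \<longleftrightarrow>
     (\<forall>x\<in>carr M. \<forall>y\<in>carr M. x + y \<in> carr M \<and> x + y = y + x) \<and>
     (\<forall>x\<in>carr M. \<forall>y\<in>carr M. \<forall>z\<in>carr M. (x + y) + z = x + (y + z)) \<and>
     (\<exists>e\<in>carr M. (\<forall>x\<in>carr M. e + x = x) \<and> (\<forall>x\<in>carr M. \<exists>y\<in>carr M. x + y = e)) \<and>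
     (\<forall>c. \<forall>x\<in>carr M. sm M c x \<in> carr M) \<and>
     (\<forall>c. \<forall>x\<in>carr M. \<forall>y\<in>carr M. sm M c (x + y) = sm M c x + sm M c y) \<and>
     (\<forall>c d. \<forall>x\<in>carr M. sm M (c + d) x = sm M c x + sm M d x) \<and>
     (\<forall>c d. \<forall>x\<in>carr M. sm M (c * d) x = sm M c (sm M d x)) \<and>
     (\<forall>x\<in>carr M. sm M 1 x = x)"

definition kmod_hom ::
  "('k, 'm::plus, 'z) kmod_scheme \<Rightarrow> ('k, 'n::plus, 'y) kmod_scheme \<Rightarrow> ('m \<Rightarrow> 'n) \<Rightarrow> bool" where
  "kmod_hom M N f \<longleftrightarrow>
     (\<forall>x\<in>carr M. f x \<in> carr N) \<and>
     (\<forall>x\<in>carr M. \<forall>y\<in>carr M. f (x + y) = f x + f y) \<and>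
     (\<forall>c. \<forall>x\<in>carr M. f (sm M c x) = sm N c (f x))"

definition kmod_iso ::
  "('k, 'm::plus, 'z) kmod_scheme \<Rightarrow> ('k, 'n::plus, 'y) kmod_scheme \<Rightarrow> ('m \<Rightarrow> 'n) \<Rightarrow> bool" where
  "kmod_iso M N f \<longleftrightarrow> kmod_hom M N f \<and> bij_betw f (carr M) (carr N)"

abbreviation whole :: "('k \<Rightarrow> 'm \<Rightarrow> 'm) \<Rightarrow> ('k, 'm) kmod" where
  "whole sc \<equiv> \<lparr>carr = UNIV, sm = sc\<rparr>"

definition kalgebra ::
  "('k::{comm_ring,comm_monoid_mult} \<Rightarrow> 'a::{ring,monoid_mult} \<Rightarrow> 'a) \<Rightarrow> bool" where
  "kalgebra sc \<longleftrightarrow>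
     kmodule (whole sc) \<and>
     (\<forall>c x y. sc c (x * y) = sc c x * y \<and> sc c (x * y) = x * sc c y)"

definition ksubmodule :: "('k \<Rightarrow> 'v::ab_group_add \<Rightarrow> 'v) \<Rightarrow> 'v set \<Rightarrow> bool" where
  "ksubmodule sc N \<longleftrightarrow>
     0 \<in> N \<and> (\<forall>x\<in>N. \<forall>y\<in>N. x + y \<in> N) \<and> (\<forall>x\<in>N. - x \<in> N) \<and> (\<forall>c. \<forall>x\<in>N. sc c x \<in> N)"

definition rep :: "'v set \<Rightarrow> 'v" where
  "rep X = (SOME x. x \<in> X)"

definition quot :: "('k \<Rightarrow> 'v::ab_group_add \<Rightarrow> 'v) \<Rightarrow> 'v set \<Rightarrow> 'v set \<Rightarrow> ('k, 'v set) kmod" where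
  "quot sc F N = \<lparr>carr = {u +o N | u. u \<in> F}, sm = (\<lambda>c X. sc c (rep X) +o N)\<rparr>"


section \<open>Formal sums and tensor products\<close>

definition fscale :: "'k::{comm_ring,comm_monoid_mult} \<Rightarrow> ('x \<Rightarrow>\<^sub>0 'k) \<Rightarrow> ('x \<Rightarrow>\<^sub>0 'k)" where
  "fscale c = Poly_Mapping.map ((*) c)"

abbreviation gen :: "'x \<Rightarrow> ('x \<Rightarrow>\<^sub>0 'k::{comm_ring,comm_monoid_mult})" where
  "gen x \<equiv> Poly_Mapping.single x 1"

definition lin :: "('k \<Rightarrow> 'v \<Rightarrow> 'v) \<Rightarrow> ('x \<Rightarrow> 'v) \<Rightarrow> ('x \<Rightarrow>\<^sub>0 'k::zero) \<Rightarrow> 'v::comm_monoid_add" where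
  "lin sc g u = (\<Sum>x\<in>Poly_Mapping.keys u. sc (Poly_Mapping.lookup u x) (g x))"

abbreviation flin ::
  "('x \<Rightarrow> ('y \<Rightarrow>\<^sub>0 'k)) \<Rightarrow> ('x \<Rightarrow>\<^sub>0 'k::{comm_ring,comm_monoid_mult}) \<Rightarrow> ('y \<Rightarrow>\<^sub>0 'k)" where
  "flin \<equiv> lin fscale"

text \<open>The map into a quotient by \<open>N\<close> given on generators by \<open>g\<close>. It is independent of the
  representative chosen by \<^const>\<open>rep\<close> as soon as \<open>g\<close> respects the relations of the source.\<close>

definition induced ::
  "('y \<Rightarrow>\<^sub>0 'k) set \<Rightarrow> ('x \<Rightarrow> ('y \<Rightarrow>\<^sub>0 'k)) \<Rightarrow> ('x \<Rightarrow>\<^sub>0 'k::{comm_ring,comm_monoid_mult}) set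
    \<Rightarrow> ('y \<Rightarrow>\<^sub>0 'k) set" where
  "induced N g X = flin g (rep X) +o N"

text \<open>\<open>M \<otimes>\<^sub>A N\<close> for a right action \<open>ra\<close> of \<open>A\<close> on \<open>M\<close> and a left action \<open>la\<close> of \<open>A\<close> on \<open>N\<close>,
  as the free module on \<open>M \<times> N\<close> modulo the bilinear, \<open>A\<close>-balanced relations.\<close>

definition bal_rel ::
  "('k::{comm_ring,comm_monoid_mult}, 'm::plus, 'z) kmod_scheme \<Rightarrow> ('k, 'n::plus, 'y) kmod_scheme
    \<Rightarrow> 'a set \<Rightarrow> ('m \<Rightarrow> 'a \<Rightarrow> 'm) \<Rightarrow> ('a \<Rightarrow> 'n \<Rightarrow> 'n) \<Rightarrow> ('m \<times> 'n \<Rightarrow>\<^sub>0 'k) set" where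
  "bal_rel M N A ra la = ksubmodule fscale hull (
     {gen (m + m', n) - gen (m, n) - gen (m', n) | m m' n. m \<in> carr M \<and> m' \<in> carr M \<and> n \<in> carr N} \<union>
     {gen (m, n + n') - gen (m, n) - gen (m, n') | m n n'. m \<in> carr M \<and> n \<in> carr N \<and> n' \<in> carr N} \<union>
     {gen (sm M c m, n) - fscale c (gen (m, n)) | c m n. m \<in> carr M \<and> n \<in> carr N} \<union>
     {gen (m, sm N c n) - fscale c (gen (m, n)) | c m n. m \<in> carr M \<and> n \<in> carr N} \<union>
     {gen (ra m a, n) - gen (m, la a n) | m a n. m \<in> carr M \<and> a \<in> A \<and> n \<in> carr N})"

definition tensor ::
  "('k::{comm_ring,comm_monoid_mult}, 'm::plus, 'z) kmod_scheme \<Rightarrow> ('k, 'n::plus, 'y) kmod_scheme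
    \<Rightarrow> 'a set \<Rightarrow> ('m \<Rightarrow> 'a \<Rightarrow> 'm) \<Rightarrow> ('a \<Rightarrow> 'n \<Rightarrow> 'n) \<Rightarrow> ('k, ('m \<times> 'n \<Rightarrow>\<^sub>0 'k) set) kmod" where
  "tensor M N A ra la =
     quot fscale {u. Poly_Mapping.keys u \<subseteq> carr M \<times> carr N} (bal_rel M N A ra la)"

text \<open>The \<open>l\<close>-fold tensor power over \<open>A\<close> of an \<open>A\<close>-bimodule filling a whole type; a pure tensor is
  a list of length \<open>l\<close>.\<close>

definition pow_gens ::
  "('k::{comm_ring,comm_monoid_mult} \<Rightarrow> 'm::plus \<Rightarrow> 'm) \<Rightarrow> 'a set \<Rightarrow> ('m \<Rightarrow> 'a \<Rightarrow> 'm) \<Rightarrow> ('a \<Rightarrow> 'm \<Rightarrow> 'm)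
    \<Rightarrow> nat \<Rightarrow> ('m list \<Rightarrow>\<^sub>0 'k) set" where
  "pow_gens sc A ra la l =
     {gen (xs[i := x + y]) - gen (xs[i := x]) - gen (xs[i := y]) | xs i x y.
        length xs = l \<and> i < l} \<union>
     {gen (xs[i := sc c x]) - fscale c (gen (xs[i := x])) | xs i c x. length xs = l \<and> i < l} \<union>
     {gen (xs[i := ra (xs ! i) a]) - gen (xs[Suc i := la a (xs ! Suc i)]) | xs i a.
        length xs = l \<and> Suc i < l \<and> a \<in> A}"

abbreviation tuples :: "nat \<Rightarrow> ('m list \<Rightarrow>\<^sub>0 'k::zero) set" where
  "tuples l \<equiv> {u. Poly_Mapping.keys u \<subseteq> {xs. length xs = l}}"


section \<open>Right bialgebroids\<close>

record (overloaded) ('k, 'r, 'b) bialgebroid =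
  smR :: "'k \<Rightarrow> 'r \<Rightarrow> 'r"
  smB :: "'k \<Rightarrow> 'b \<Rightarrow> 'b"
  xi :: "'r \<Rightarrow> 'b"
  zeta :: "'r \<Rightarrow> 'b"
  cop :: "'b \<Rightarrow> ('b \<times> 'b \<Rightarrow>\<^sub>0 'k) set"
  eps :: "'b \<Rightarrow> 'r"

definition lR :: "('k, 'r, 'b::times) bialgebroid \<Rightarrow> 'r \<Rightarrow> 'b \<Rightarrow> 'b" where
  "lR \<B> r b = b * zeta \<B> r"

definition rR :: "('k, 'r, 'b::times) bialgebroid \<Rightarrow> 'b \<Rightarrow> 'r \<Rightarrow> 'b" where
  "rR \<B> b r = b * xi \<B> r"

definition BB_rel ::
  "('k::{comm_ring,comm_monoid_mult}, 'r, 'b::{ring,monoid_mult}) bialgebroid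
    \<Rightarrow> ('b \<times> 'b \<Rightarrow>\<^sub>0 'k) set" where
  "BB_rel \<B> = bal_rel (whole (smB \<B>)) (whole (smB \<B>)) UNIV (rR \<B>) (lR \<B>)"

definition BB ::
  "('k::{comm_ring,comm_monoid_mult}, 'r, 'b::{ring,monoid_mult}) bialgebroid
    \<Rightarrow> ('k, ('b \<times> 'b \<Rightarrow>\<^sub>0 'k) set) kmod" where
  "BB \<B> = tensor (whole (smB \<B>)) (whole (smB \<B>)) UNIV (rR \<B>) (lR \<B>)"

definition lR_BB ::
  "('k::{comm_ring,comm_monoid_mult}, 'r, 'b::{ring,monoid_mult}) bialgebroid
    \<Rightarrow> 'r \<Rightarrow> ('b \<times> 'b \<Rightarrow>\<^sub>0 'k) set \<Rightarrow> ('b \<times> 'b \<Rightarrow>\<^sub>0 'k) set" where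
  "lR_BB \<B> r = induced (BB_rel \<B>) (\<lambda>(b, b'). gen (lR \<B> r b, b'))"

text \<open>The relations of \<open>X \<otimes>\<^sub>R (B \<otimes>\<^sub>R B)\<close>, where coassociativity of \<open>B\<close> and of comodules is stated.\<close>

definition XBB_rel ::
  "('k::{comm_ring,comm_monoid_mult}, 'r, 'b::{ring,monoid_mult}) bialgebroid
    \<Rightarrow> ('k \<Rightarrow> 'x::plus \<Rightarrow> 'x) \<Rightarrow> ('x \<Rightarrow> 'r \<Rightarrow> 'x) \<Rightarrow> ('x \<times> ('b \<times> 'b \<Rightarrow>\<^sub>0 'k) set \<Rightarrow>\<^sub>0 'k) set" where
  "XBB_rel \<B> smX ra = bal_rel (whole smX) (BB \<B>) UNIV ra (lR_BB \<B>)"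

text \<open>Coassociativity of \<open>\<rho> : X \<rightarrow> X \<otimes>\<^sub>R B\<close>, read in \<open>X \<otimes>\<^sub>R (B \<otimes>\<^sub>R B)\<close>. For \<open>X = B\<close> and
  \<open>\<rho> = \<Delta>\<close> this is the coassociativity of \<open>\<Delta>\<close>.\<close>

definition coassociative ::
  "('k::{comm_ring,comm_monoid_mult}, 'r, 'b::{ring,monoid_mult}) bialgebroid
    \<Rightarrow> ('k \<Rightarrow> 'x::plus \<Rightarrow> 'x) \<Rightarrow> ('x \<Rightarrow> 'r \<Rightarrow> 'x) \<Rightarrow> ('x \<Rightarrow> ('x \<times> 'b \<Rightarrow>\<^sub>0 'k) set) \<Rightarrow> bool" where
  "coassociative \<B> smX ra \<rho> \<longleftrightarrow>
     (\<forall>x. \<forall>u\<in>\<rho> x.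
        flin (\<lambda>(x0, b). flin (\<lambda>(y0, y1). gen (y0, gen (y1, b) +o BB_rel \<B>)) (rep (\<rho> x0))) u
          +o XBB_rel \<B> smX ra =
        flin (\<lambda>(x0, b). gen (x0, cop \<B> b)) u +o XBB_rel \<B> smX ra)"

text \<open>An element of a tensor product is a coset of formal sums, so \<open>u \<in> cop \<B> b\<close> ranges over all
  expressions \<open>\<Sum> b1 \<otimes> b2\<close> of \<open>\<Delta> b\<close>. In the multiplicativity of \<open>\<Delta>\<close> below the
  right-hand side is independent of that expression by the preceding condition on \<open>\<xi>\<close>
  and \<open>\<zeta>\<close>.\<close>

definition R_coring ::
  "('k::{comm_ring,comm_monoid_mult}, 'r::{ring,monoid_mult}, 'b::{ring,monoid_mult}) bialgebroid
    \<Rightarrow> bool" where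
  "R_coring \<B> \<longleftrightarrow>
     kmod_hom (whole (smB \<B>)) (BB \<B>) (cop \<B>) \<and>
     (\<forall>r b r'. \<forall>u\<in>cop \<B> b.
        cop \<B> (lR \<B> r (rR \<B> b r')) = flin (\<lambda>(b1, b2). gen (lR \<B> r b1, rR \<B> b2 r')) u +o BB_rel \<B>) \<and>
     kmod_hom (whole (smB \<B>)) (whole (smR \<B>)) (eps \<B>) \<and>
     (\<forall>r b r'. eps \<B> (lR \<B> r (rR \<B> b r')) = r * eps \<B> b * r') \<and>
     coassociative \<B> (smB \<B>) (rR \<B>) (cop \<B>) \<and>
     (\<forall>b. \<forall>u\<in>cop \<B> b.
        lin (smB \<B>) (\<lambda>(b1, b2). rR \<B> b1 (eps \<B> b2)) u = b \<and>
        lin (smB \<B>) (\<lambda>(b1, b2). lR \<B> (eps \<B> b1) b2) u = b)"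

definition right_bialgebroid ::
  "('k::{comm_ring,comm_monoid_mult}, 'r::{ring,monoid_mult}, 'b::{ring,monoid_mult}) bialgebroid
    \<Rightarrow> bool" where
  "right_bialgebroid \<B> \<longleftrightarrow>
     kalgebra (smR \<B>) \<and> kalgebra (smB \<B>) \<and>
     kmod_hom (whole (smR \<B>)) (whole (smB \<B>)) (xi \<B>) \<and>
     (\<forall>r r'. xi \<B> (r * r') = xi \<B> r * xi \<B> r') \<and> xi \<B> 1 = 1 \<and>
     kmod_hom (whole (smR \<B>)) (whole (smB \<B>)) (zeta \<B>) \<and>
     (\<forall>r r'. zeta \<B> (r * r') = zeta \<B> r' * zeta \<B> r) \<and> zeta \<B> 1 = 1 \<and>
     (\<forall>r r'. xi \<B> r * zeta \<B> r' = zeta \<B> r' * xi \<B> r) \<and>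
     R_coring \<B> \<and>
     (\<forall>r b. \<forall>u\<in>cop \<B> b.
        flin (\<lambda>(b1, b2). gen (xi \<B> r * b1, b2)) u +o BB_rel \<B> =
        flin (\<lambda>(b1, b2). gen (b1, zeta \<B> r * b2)) u +o BB_rel \<B>) \<and>
     cop \<B> 1 = gen (1, 1) +o BB_rel \<B> \<and>
     (\<forall>b b'. \<forall>u\<in>cop \<B> b. \<forall>v\<in>cop \<B> b'.
        cop \<B> (b * b') =
        flin (\<lambda>(b1, b2). flin (\<lambda>(b1', b2'). gen (b1 * b1', b2 * b2')) v) u +o BB_rel \<B>) \<and>
     eps \<B> 1 = 1 \<and>
     (\<forall>b b'. eps \<B> (b * b') = eps \<B> (xi \<B> (eps \<B> b) * b'))"

text \<open>The domain of \<open>\<vartheta>\<close>, with \<open>b \<zeta>(r) \<otimes> b' = b \<otimes> \<zeta>(r) b'\<close>.\<close>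

definition BBop ::
  "('k::{comm_ring,comm_monoid_mult}, 'r, 'b::{ring,monoid_mult}) bialgebroid
    \<Rightarrow> ('k, ('b \<times> 'b \<Rightarrow>\<^sub>0 'k) set) kmod" where
  "BBop \<B> = tensor (whole (smB \<B>)) (whole (smB \<B>)) UNIV
     (\<lambda>b r. b * zeta \<B> r) (\<lambda>r b. zeta \<B> r * b)"

definition Hopf_map ::
  "('k::{comm_ring,comm_monoid_mult}, 'r, 'b::{ring,monoid_mult}) bialgebroid
    \<Rightarrow> ('b \<times> 'b \<Rightarrow>\<^sub>0 'k) set \<Rightarrow> ('b \<times> 'b \<Rightarrow>\<^sub>0 'k) set" where
  "Hopf_map \<B> = induced (BB_rel \<B>)
     (\<lambda>(b, b'). flin (\<lambda>(b1, b2). gen (b * b1, b2)) (rep (cop \<B> b')))"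

definition right_times_Hopf ::
  "('k::{comm_ring,comm_monoid_mult}, 'r::{ring,monoid_mult}, 'b::{ring,monoid_mult}) bialgebroid
    \<Rightarrow> bool" where
  "right_times_Hopf \<B> \<longleftrightarrow>
     right_bialgebroid \<B> \<and> bij_betw (Hopf_map \<B>) (carr (BBop \<B>)) (carr (BB \<B>))"


section \<open>Comodule algebras and Galois extensions\<close>

record (overloaded) ('k, 'r, 'b, 't) comodule_data =
  smT :: "'k \<Rightarrow> 't \<Rightarrow> 't"
  ract :: "'t \<Rightarrow> 'r \<Rightarrow> 't"
  coact :: "'t \<Rightarrow> ('t \<times> 'b \<Rightarrow>\<^sub>0 'k) set"

definition TB_rel ::
  "('k::{comm_ring,comm_monoid_mult}, 'r, 'b::{ring,monoid_mult}) bialgebroid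
    \<Rightarrow> ('k, 'r, 'b, 't::ab_group_add) comodule_data \<Rightarrow> ('t \<times> 'b \<Rightarrow>\<^sub>0 'k) set" where
  "TB_rel \<B> T = bal_rel (whole (smT T)) (whole (smB \<B>)) UNIV (ract T) (lR \<B>)"

definition TB ::
  "('k::{comm_ring,comm_monoid_mult}, 'r, 'b::{ring,monoid_mult}) bialgebroid
    \<Rightarrow> ('k, 'r, 'b, 't::ab_group_add) comodule_data \<Rightarrow> ('k, ('t \<times> 'b \<Rightarrow>\<^sub>0 'k) set) kmod" where
  "TB \<B> T = tensor (whole (smT T)) (whole (smB \<B>)) UNIV (ract T) (lR \<B>)"

definition right_comodule ::
  "('k::{comm_ring,comm_monoid_mult}, 'r::{ring,monoid_mult}, 'b::{ring,monoid_mult}) bialgebroid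
    \<Rightarrow> ('k, 'r, 'b, 't::ab_group_add) comodule_data \<Rightarrow> bool" where
  "right_comodule \<B> T \<longleftrightarrow>
     kmodule (whole (smT T)) \<and>
     (\<forall>t t' r. ract T (t + t') r = ract T t r + ract T t' r) \<and>
     (\<forall>t r r'. ract T t (r + r') = ract T t r + ract T t r') \<and>
     (\<forall>t r r'. ract T t (r * r') = ract T (ract T t r) r') \<and>
     (\<forall>t. ract T t 1 = t) \<and>
     (\<forall>c t r. ract T (smT T c t) r = smT T c (ract T t r) \<and>
              ract T t (smR \<B> c r) = smT T c (ract T t r)) \<and>
     kmod_hom (whole (smT T)) (TB \<B> T) (coact T) \<and>
     (\<forall>t r. \<forall>u\<in>coact T t.
        coact T (ract T t r) = flin (\<lambda>(t0, b). gen (t0, rR \<B> b r)) u +o TB_rel \<B> T) \<and>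
     coassociative \<B> (smT T) (ract T) (coact T) \<and>
     (\<forall>t. \<forall>u\<in>coact T t. lin (smT T) (\<lambda>(t0, b). ract T t0 (eps \<B> b)) u = t)"

definition lact_comod ::
  "('k::{comm_ring,comm_monoid_mult}, 'r, 'b::{ring,monoid_mult}) bialgebroid
    \<Rightarrow> ('k, 'r, 'b, 't::ab_group_add) comodule_data \<Rightarrow> 'r \<Rightarrow> 't \<Rightarrow> 't" where
  "lact_comod \<B> T r t = lin (smT T) (\<lambda>(t0, b). ract T t0 (eps \<B> (xi \<B> r * b))) (rep (coact T t))"

definition right_comodule_algebra ::
  "('k::{comm_ring,comm_monoid_mult}, 'r::{ring,monoid_mult}, 'b::{ring,monoid_mult}) bialgebroid
    \<Rightarrow> ('k, 'r, 'b, 't::{ring,monoid_mult}) comodule_data \<Rightarrow> bool" where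
  "right_comodule_algebra \<B> T \<longleftrightarrow>
     kalgebra (smT T) \<and> right_comodule \<B> T \<and>
     (\<forall>t r t'. ract T t r * t' = t * lact_comod \<B> T r t') \<and>
     coact T 1 = gen (1, 1) +o TB_rel \<B> T \<and>
     (\<forall>t t'. \<forall>u\<in>coact T t. \<forall>v\<in>coact T t'.
        coact T (t * t') =
        flin (\<lambda>(t0, b). flin (\<lambda>(t0', b'). gen (t0 * t0', b * b')) v) u +o TB_rel \<B> T)"

definition coinvariants ::
  "('k::{comm_ring,comm_monoid_mult}, 'r, 'b::{ring,monoid_mult}) bialgebroid
    \<Rightarrow> ('k, 'r, 'b, 't::ab_group_add) comodule_data \<Rightarrow> 't set" where
  "coinvariants \<B> T = {s. coact T s = gen (s, 1) +o TB_rel \<B> T}"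

definition TT ::
  "('k::{comm_ring,comm_monoid_mult}, 'r, 'b, 't::ring) comodule_data \<Rightarrow> 't set
    \<Rightarrow> ('k, ('t \<times> 't \<Rightarrow>\<^sub>0 'k) set) kmod" where
  "TT T S = tensor (whole (smT T)) (whole (smT T)) S (*) (*)"

definition can ::
  "('k::{comm_ring,comm_monoid_mult}, 'r, 'b::{ring,monoid_mult}) bialgebroid
    \<Rightarrow> ('k, 'r, 'b, 't::{ring,monoid_mult}) comodule_data
    \<Rightarrow> ('t \<times> 't \<Rightarrow>\<^sub>0 'k) set \<Rightarrow> ('t \<times> 'b \<Rightarrow>\<^sub>0 'k) set" where
  "can \<B> T = induced (TB_rel \<B> T)
     (\<lambda>(t', t). flin (\<lambda>(t0, b). gen (t' * t0, b)) (rep (coact T t)))"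

definition Galois_extension ::
  "('k::{comm_ring,comm_monoid_mult}, 'r::{ring,monoid_mult}, 'b::{ring,monoid_mult}) bialgebroid
    \<Rightarrow> ('k, 'r, 'b, 't::{ring,monoid_mult}) comodule_data \<Rightarrow> 't set \<Rightarrow> bool" where
  "Galois_extension \<B> T S \<longleftrightarrow>
     right_comodule_algebra \<B> T \<and> S = coinvariants \<B> T \<and>
     bij_betw (can \<B> T) (carr (TT T S)) (carr (TB \<B> T))"

definition translation ::
  "('k::{comm_ring,comm_monoid_mult}, 'r, 'b::{ring,monoid_mult}) bialgebroid
    \<Rightarrow> ('k, 'r, 'b, 't::{ring,monoid_mult}) comodule_data \<Rightarrow> 't set
    \<Rightarrow> 'b \<Rightarrow> ('t \<times> 't \<Rightarrow>\<^sub>0 'k) set" where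
  "translation \<B> T S b = inv_into (carr (TT T S)) (can \<B> T) (gen (1, b) +o TB_rel \<B> T)"


section \<open>The module-comodule \<open>T\<^sub>S\<close>\<close>

record (overloaded) ('k, 'b, 'x) mod_comod = "('k, 'x) kmod" +
  bact :: "'b \<Rightarrow> 'x \<Rightarrow> 'x"
  bcoact :: "'x \<Rightarrow> ('x \<times> 'b \<Rightarrow>\<^sub>0 'k) set"

definition commutators ::
  "('k, 'r, 'b, 't::ring) comodule_data \<Rightarrow> 't set \<Rightarrow> 't set" where
  "commutators T S = ksubmodule (smT T) hull {s * t - t * s | s t. s \<in> S}"

definition TS_mod ::
  "('k, 'r, 'b, 't::ring) comodule_data \<Rightarrow> 't set \<Rightarrow> ('k, 't set) kmod" where
  "TS_mod T S = quot (smT T) UNIV (commutators T S)"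

definition pT :: "('k, 'r, 'b, 't::ring) comodule_data \<Rightarrow> 't set \<Rightarrow> 't \<Rightarrow> 't set" where
  "pT T S t = t +o commutators T S"

definition TSB_rel ::
  "('k::{comm_ring,comm_monoid_mult}, 'r, 'b::{ring,monoid_mult}) bialgebroid
    \<Rightarrow> ('k, 'r, 'b, 't::ring) comodule_data \<Rightarrow> 't set \<Rightarrow> ('t set \<times> 'b \<Rightarrow>\<^sub>0 'k) set" where
  "TSB_rel \<B> T S =
     bal_rel (TS_mod T S) (whole (smB \<B>)) UNIV (\<lambda>x r. pT T S (ract T (rep x) r)) (lR \<B>)"

text \<open>In the action, \<open>tm\<close> and \<open>tp\<close> are the first and second legs of the translation map.\<close>

definition T_S ::
  "('k::{comm_ring,comm_monoid_mult}, 'r, 'b::{ring,monoid_mult}) bialgebroid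
    \<Rightarrow> ('k, 'r, 'b, 't::{ring,monoid_mult}) comodule_data \<Rightarrow> 't set \<Rightarrow> ('k, 'b, 't set) mod_comod"
  where
  "T_S \<B> T S =
     \<lparr>carr = carr (TS_mod T S),
      sm = sm (TS_mod T S),
      bact = (\<lambda>b x. pT T S
        (lin (smT T) (\<lambda>(tm, tp). tp * rep x * tm) (rep (translation \<B> T S b)))),
      bcoact = (\<lambda>x.
        flin (\<lambda>(t0, b). gen (pT T S t0, b)) (rep (coact T (rep x))) +o TSB_rel \<B> T S)\<rparr>"


section \<open>Cyclic modules\<close>

text \<open>The degree \<open>n\<close> is an argument of the structure maps: \<open>face Z n k\<close> and \<open>degen Z n k\<close> are the
  \<open>k\<close>-th face and degeneracy out of degree \<open>n\<close>, and \<open>face Z n\<close> is only meaningful for \<open>n \<ge> 1\<close>.\<close>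

record ('k, 'm) cyclic_data =
  deg :: "nat \<Rightarrow> ('k, 'm) kmod"
  face :: "nat \<Rightarrow> nat \<Rightarrow> 'm \<Rightarrow> 'm"
  degen :: "nat \<Rightarrow> nat \<Rightarrow> 'm \<Rightarrow> 'm"
  cyc :: "nat \<Rightarrow> 'm \<Rightarrow> 'm"

definition simplicial_identities :: "('k, 'm) cyclic_data \<Rightarrow> bool" where
  "simplicial_identities Z \<longleftrightarrow>
     (\<forall>n. \<forall>j\<le>Suc (Suc n). \<forall>i<j. \<forall>x\<in>carr (deg Z (Suc (Suc n))).
        face Z (Suc n) i (face Z (Suc (Suc n)) j x) =
        face Z (Suc n) (j - 1) (face Z (Suc (Suc n)) i x)) \<and>
     (\<forall>n. \<forall>j\<le>n. \<forall>i\<le>j. \<forall>x\<in>carr (deg Z n).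
        degen Z (Suc n) i (degen Z n j x) = degen Z (Suc n) (Suc j) (degen Z n i x)) \<and>
     (\<forall>n. \<forall>j\<le>n. \<forall>i<j. \<forall>x\<in>carr (deg Z n).
        face Z (Suc n) i (degen Z n j x) = degen Z (n - 1) (j - 1) (face Z n i x)) \<and>
     (\<forall>n. \<forall>j\<le>n. \<forall>i\<in>{j, Suc j}. \<forall>x\<in>carr (deg Z n).
        face Z (Suc n) i (degen Z n j x) = x) \<and>
     (\<forall>n. \<forall>j\<le>n. \<forall>i\<le>Suc n. Suc j < i \<longrightarrow> (\<forall>x\<in>carr (deg Z n).
        face Z (Suc n) i (degen Z n j x) = degen Z (n - 1) j (face Z n (i - 1) x)))"

definition cyclic_identities :: "('k, 'm) cyclic_data \<Rightarrow> bool" where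
  "cyclic_identities Z \<longleftrightarrow>
     (\<forall>n. \<forall>i\<in>{1..Suc n}. \<forall>x\<in>carr (deg Z (Suc n)).
        face Z (Suc n) i (cyc Z (Suc n) x) = cyc Z n (face Z (Suc n) (i - 1) x)) \<and>
     (\<forall>n. \<forall>x\<in>carr (deg Z (Suc n)).
        face Z (Suc n) 0 (cyc Z (Suc n) x) = face Z (Suc n) (Suc n) x) \<and>
     (\<forall>n. \<forall>i\<in>{1..n}. \<forall>x\<in>carr (deg Z n).
        degen Z n i (cyc Z n x) = cyc Z (Suc n) (degen Z n (i - 1) x)) \<and>
     (\<forall>n. \<forall>x\<in>carr (deg Z n).
        degen Z n 0 (cyc Z n x) = cyc Z (Suc n) (cyc Z (Suc n) (degen Z n n x))) \<and>
     (\<forall>n. \<forall>x\<in>carr (deg Z n). (cyc Z n ^^ Suc n) x = x)"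

definition cyclic_module ::
  "('k::{comm_ring,comm_monoid_mult}, 'm::plus) cyclic_data \<Rightarrow> bool" where
  "cyclic_module Z \<longleftrightarrow>
     (\<forall>n. kmodule (deg Z n)) \<and>
     (\<forall>n. \<forall>k\<le>Suc n. kmod_hom (deg Z (Suc n)) (deg Z n) (face Z (Suc n) k)) \<and>
     (\<forall>n. \<forall>k\<le>n. kmod_hom (deg Z n) (deg Z (Suc n)) (degen Z n k)) \<and>
     (\<forall>n. kmod_hom (deg Z n) (deg Z n) (cyc Z n)) \<and>
     simplicial_identities Z \<and> cyclic_identities Z"

definition cyclic_iso ::
  "('k::{comm_ring,comm_monoid_mult}, 'm::plus) cyclic_data \<Rightarrow> ('k, 'n::plus) cyclic_data
    \<Rightarrow> (nat \<Rightarrow> 'm \<Rightarrow> 'n) \<Rightarrow> bool" where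
  "cyclic_iso Z Z' \<phi> \<longleftrightarrow>
     (\<forall>n. kmod_iso (deg Z n) (deg Z' n) (\<phi> n)) \<and>
     (\<forall>n. \<forall>k\<le>Suc n. \<forall>x\<in>carr (deg Z (Suc n)).
        \<phi> n (face Z (Suc n) k x) = face Z' (Suc n) k (\<phi> (Suc n) x)) \<and>
     (\<forall>n. \<forall>k\<le>n. \<forall>x\<in>carr (deg Z n).
        \<phi> (Suc n) (degen Z n k x) = degen Z' n k (\<phi> n x)) \<and>
     (\<forall>n. \<forall>x\<in>carr (deg Z n). \<phi> n (cyc Z n x) = cyc Z' n (\<phi> n x))"


subsection \<open>The cyclic module \<open>Z(\<B>, X)\<close>\<close>

definition Bpow_rel ::
  "('k::{comm_ring,comm_monoid_mult}, 'r, 'b::{ring,monoid_mult}) bialgebroid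
    \<Rightarrow> nat \<Rightarrow> ('b list \<Rightarrow>\<^sub>0 'k) set" where
  "Bpow_rel \<B> l = ksubmodule fscale hull pow_gens (smB \<B>) UNIV (rR \<B>) (lR \<B>) l"

definition Bpow ::
  "('k::{comm_ring,comm_monoid_mult}, 'r, 'b::{ring,monoid_mult}) bialgebroid
    \<Rightarrow> nat \<Rightarrow> ('k, ('b list \<Rightarrow>\<^sub>0 'k) set) kmod" where
  "Bpow \<B> l = quot fscale (tuples l) (Bpow_rel \<B> l)"

text \<open>The iterated coproduct, with values in the \<open>(n+1)\<close>-fold tensor power.\<close>

fun cop_iter ::
  "('k::{comm_ring,comm_monoid_mult}, 'r, 'b::{ring,monoid_mult}) bialgebroid
    \<Rightarrow> nat \<Rightarrow> 'b \<Rightarrow> ('b list \<Rightarrow>\<^sub>0 'k) set" where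
  "cop_iter \<B> 0 b = gen [b] +o Bpow_rel \<B> 1"
| "cop_iter \<B> (Suc n) b =
     flin (\<lambda>(b1, b2). flin (\<lambda>bs. gen (b1 # bs)) (rep (cop_iter \<B> n b2))) (rep (cop \<B> b))
       +o Bpow_rel \<B> (n + 2)"

definition diag_act ::
  "('k::{comm_ring,comm_monoid_mult}, 'r, 'b::{ring,monoid_mult}) bialgebroid
    \<Rightarrow> nat \<Rightarrow> ('b list \<Rightarrow>\<^sub>0 'k) set \<Rightarrow> 'b \<Rightarrow> ('b list \<Rightarrow>\<^sub>0 'k) set" where
  "diag_act \<B> n \<beta> b =
     induced (Bpow_rel \<B> (n + 1))
       (\<lambda>bs. flin (\<lambda>cs. gen (map2 (*) bs cs)) (rep (cop_iter \<B> n b))) \<beta>"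

text \<open>For \<open>k < n\<close> the scalar \<open>\<epsilon>(bs ! k)\<close> acts from the left on the next factor, for \<open>k = n\<close> from the
  right on the previous one; over \<open>R\<close> these agree for \<open>0 < k < n\<close>.\<close>

definition eps_at ::
  "('k, 'r, 'b::times) bialgebroid \<Rightarrow> nat \<Rightarrow> nat \<Rightarrow> 'b list \<Rightarrow> 'b list" where
  "eps_at \<B> n k bs =
     (if k < n then take k bs @ lR \<B> (eps \<B> (bs ! k)) (bs ! Suc k) # drop (k + 2) bs
      else take (n - 1) bs @ [rR \<B> (bs ! (n - 1)) (eps \<B> (bs ! n))])"

definition cop_at ::
  "('k::{comm_ring,comm_monoid_mult}, 'r, 'b) bialgebroid
    \<Rightarrow> nat \<Rightarrow> 'b list \<Rightarrow> ('b list \<Rightarrow>\<^sub>0 'k)" where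
  "cop_at \<B> k bs =
     flin (\<lambda>(b1, b2). gen (take k bs @ b1 # b2 # drop (Suc k) bs)) (rep (cop \<B> (bs ! k)))"

definition ZB_rel ::
  "('k::{comm_ring,comm_monoid_mult}, 'r, 'b::{ring,monoid_mult}) bialgebroid
    \<Rightarrow> ('k, 'b, 'x::plus) mod_comod \<Rightarrow> nat \<Rightarrow> (('b list \<Rightarrow>\<^sub>0 'k) set \<times> 'x \<Rightarrow>\<^sub>0 'k) set" where
  "ZB_rel \<B> X n = bal_rel (Bpow \<B> (n + 1)) X UNIV (diag_act \<B> n) (bact X)"

definition Z_B ::
  "('k::{comm_ring,comm_monoid_mult}, 'r, 'b::{ring,monoid_mult}) bialgebroid
    \<Rightarrow> ('k, 'b, 'x::plus) mod_comod
    \<Rightarrow> ('k, (('b list \<Rightarrow>\<^sub>0 'k) set \<times> 'x \<Rightarrow>\<^sub>0 'k) set) cyclic_data" where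
  "Z_B \<B> X =
     \<lparr>deg = (\<lambda>n. tensor (Bpow \<B> (n + 1)) X UNIV (diag_act \<B> n) (bact X)),
      face = (\<lambda>n k. induced (ZB_rel \<B> X (n - 1))
        (\<lambda>(\<beta>, x). gen (induced (Bpow_rel \<B> n) (\<lambda>bs. gen (eps_at \<B> n k bs)) \<beta>, x))),
      degen = (\<lambda>n k. induced (ZB_rel \<B> X (n + 1))
        (\<lambda>(\<beta>, x). gen (induced (Bpow_rel \<B> (n + 2)) (cop_at \<B> k) \<beta>, x))),
      cyc = (\<lambda>n. induced (ZB_rel \<B> X n)
        (\<lambda>(\<beta>, x). flin (\<lambda>bs. flin (\<lambda>(x0, b).
            gen (gen ((last bs * b) # butlast bs) +o Bpow_rel \<B> (n + 1), x0))
          (rep (bcoact X x))) (rep \<beta>)))\<rparr>"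


subsection \<open>The cyclic module \<open>Z(T/S)\<close>\<close>

text \<open>The relations of the tensor power over \<open>S\<close> together with \<open>s \<cdot> y - y \<cdot> s\<close> for pure
  tensors \<open>y\<close>, so that the cyclic tensor product is a single quotient.\<close>

definition cyc_rel ::
  "('k::{comm_ring,comm_monoid_mult}, 'r, 'b, 't::{ring,monoid_mult}) comodule_data \<Rightarrow> 't set
    \<Rightarrow> nat \<Rightarrow> ('t list \<Rightarrow>\<^sub>0 'k) set" where
  "cyc_rel T S l = ksubmodule fscale hull (
     pow_gens (smT T) S (*) (*) l \<union>
     {gen (ts[0 := s * ts ! 0]) - gen (ts[l - 1 := ts ! (l - 1) * s]) | ts s.
        length ts = l \<and> s \<in> S})"

definition mult_at :: "nat \<Rightarrow> nat \<Rightarrow> 't::times list \<Rightarrow> 't list" where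
  "mult_at n k ts =
     (if k < n then take k ts @ (ts ! k * ts ! Suc k) # drop (k + 2) ts
      else (ts ! n * ts ! 0) # butlast (tl ts))"

definition Z_T ::
  "('k::{comm_ring,comm_monoid_mult}, 'r, 'b, 't::{ring,monoid_mult}) comodule_data \<Rightarrow> 't set
    \<Rightarrow> ('k, ('t list \<Rightarrow>\<^sub>0 'k) set) cyclic_data" where
  "Z_T T S =
     \<lparr>deg = (\<lambda>n. quot fscale (tuples (n + 1)) (cyc_rel T S (n + 1))),
      face = (\<lambda>n k. induced (cyc_rel T S n) (\<lambda>ts. gen (mult_at n k ts))),
      degen = (\<lambda>n k. induced (cyc_rel T S (n + 2))
        (\<lambda>ts. gen (take (Suc k) ts @ 1 # drop (Suc k) ts))),
      cyc = (\<lambda>n. induced (cyc_rel T S (n + 1)) (\<lambda>ts. gen (last ts # butlast ts)))\<rparr>"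

end

theory Submission
  imports Defs
begin

text \<open>The isomorphism sends \<open>(b\<^sub>0 \<otimes> \<dots> \<otimes> b\<^sub>n) \<otimes> p\<^sub>T(t)\<close> to
  \<open>b\<^sub>n\<^bsup>{+}\<^esup> t b\<^sub>0\<^bsup>{-}\<^esup> \<otimes> b\<^sub>0\<^bsup>{+}\<^esup> b\<^sub>1\<^bsup>{-}\<^esup> \<otimes> \<dots> \<otimes> b\<^sub>n\<^sub>-\<^sub>1\<^bsup>{+}\<^esup> b\<^sub>n\<^bsup>{-}\<^esup>\<close>. Compatibility with faces,
  degeneracies, the cyclic maps and the diagonal action follows from the identities
  \<open>b\<^bsup>{-}\<^esup> b\<^bsup>{+}\<^esup> = 1 \<cdot> \<epsilon>(b)\<close>, \<open>b\<^bsup>(1){-}\<^esup> \<otimes> b\<^bsup>(1){+}\<^esup> b\<^bsup>(2){-}\<^esup> \<otimes> b\<^bsup>(2){+}\<^esup> = b\<^bsup>{-}\<^esup> \<otimes> 1 \<otimes> b\<^bsup>{+}\<^esup>\<close>,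
  \<open>t\<^bsup>[0]\<^esup> t\<^bsup>[1]{-}\<^esup> \<otimes> t\<^bsup>[1]{+}\<^esup> = 1 \<otimes> t\<close> and \<open>(bb')\<^bsup>{-}\<^esup> \<otimes> (bb')\<^bsup>{+}\<^esup> = b'\<^bsup>{-}\<^esup> b\<^bsup>{-}\<^esup> \<otimes> b\<^bsup>{+}\<^esup> b'\<^bsup>{+}\<^esup>\<close> of the
  translation map. The inverse sends \<open>t\<^sub>0 \<otimes> \<dots> \<otimes> t\<^sub>n\<close> to
  \<open>(t\<^sub>1\<^bsup>[1]\<^esup> \<dots> t\<^sub>n\<^bsup>[1]\<^esup> \<otimes> \<dots> \<otimes> t\<^sub>n\<^bsup>[n]\<^esup> \<otimes> 1) \<otimes> p\<^sub>T(t\<^sub>0 t\<^sub>1\<^bsup>[0]\<^esup> \<dots> t\<^sub>n\<^bsup>[0]\<^esup>)\<close>; it is a two-sided inverse because, by the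
  \<open>\<times>\<^sub>R\<close>-Hopf property, tensors with last factor \<open>1\<close> generate the tensor powers of \<open>\<B>\<close> as
  \<open>\<B>\<close>-modules. That the left-hand side is a cyclic module is then transported from the
  cyclic tensor powers, where the identities hold for lists.\<close>

section \<open>Linear extension\<close>

text \<open>Sweedler notation has no direct meaning here: \<open>cop \<B> b\<close>,
  \<open>coact T t\<close> and \<open>translation \<B> T S b\<close> are cosets of formal sums, and
  a formula that picks representatives with \<open>rep\<close> is legitimate only below maps that
  respect the relations. The proof therefore works dually. Identities are stated for the values of
  arbitrary balanced maps into \<open>quo\<close>; the universal balanced map
  \<open>proj N (gen x)\<close> is one of these, so vanishing under all balanced maps means
  membership in the relations.

  A map between tensor products is then described by what it does to balanced maps:
  \<open>Phi_form\<close> pulls balanced maps back along the comparison map, \<open>Cochain\<close>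
  along its inverse. The inverse is never built on the quotients; that the two pullbacks undo each
  other yields injectivity and surjectivity. Likewise the operators of \<open>Z_B\<close> are not
  shown to be well defined on their own: the comparison map reflects relations
  (\<open>Phi_mem_iff\<close>), so well-definedness is inherited from the list operations of
  \<open>Z_T\<close>.\<close>

abbreviation scaling ::
  "('k::{comm_ring,comm_monoid_mult} \<Rightarrow> 'v::ab_group_add \<Rightarrow> 'v) \<Rightarrow> bool" where
  "scaling sc \<equiv> kmodule (whole sc)"

lemma scalingD:
  assumes "scaling sc"
  shows "sc c (x + y) = sc c x + sc c y" "sc (c + d) x = sc c x + sc d x"
    "sc (c * d) x = sc c (sc d x)" "sc 1 x = x" "sc c 0 = 0" "sc 0 x = 0"
    "sc c (- x) = - sc c x" "sc c (x - y) = sc c x - sc c y"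
proof -
  show add: "sc c (x + y) = sc c x + sc c y" for x y and c
    using assms by (simp add: kmodule_def)
  show add': "sc (c + d) x = sc c x + sc d x" for c
    using assms by (simp add: kmodule_def)
  show "sc (c * d) x = sc c (sc d x)" "sc 1 x = x"
    using assms by (simp_all add: kmodule_def)
  show z: "sc c 0 = 0" for c using add[of c 0 0] by simp
  have "sc 0 x + sc d x = sc d x" using add'[of 0] by simp
  then show "sc 0 x = 0" by simp
  show neg: "sc c (- x) = - sc c x" for x
    using add[of c x "- x"] z by (simp add: eq_neg_iff_add_eq_0 add.commute)
  show "sc c (x - y) = sc c x - sc c y" using add[of c x "- y"] neg by simp
qed

lemma scalingI:
  assumes "\<And>c x y. sc c (x + y) = sc c x + sc c y" "\<And>c d x. sc (c + d) x = sc c x + sc d x"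
    "\<And>c d x. sc (c * d) x = sc c (sc d x)" "\<And>x. sc 1 x = x"
  shows "scaling sc"
  unfolding kmodule_def using assms
  by (auto simp: add.assoc add.commute intro!: exI[of _ 0] exI[of _ "- x" for x])

lemma scaling_sum: "scaling sc \<Longrightarrow> sc c (sum f A) = (\<Sum>x\<in>A. sc c (f x))"
  by (induction A rule: infinite_finite_induct) (simp_all add: scalingD)

lemma lin_superset:
  assumes "scaling sc" "finite A" "Poly_Mapping.keys u \<subseteq> A"
  shows "lin sc g u = (\<Sum>x\<in>A. sc (Poly_Mapping.lookup u x) (g x))"
  unfolding lin_def using assms
  by (intro sum.mono_neutral_left) (auto simp: scalingD in_keys_iff)

lemma lin_add:
  assumes "scaling sc"
  shows "lin sc g (u + v) = lin sc g u + lin sc g v"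
proof -
  let ?A = "Poly_Mapping.keys u \<union> Poly_Mapping.keys v"
  have "lin sc g (u + v) = (\<Sum>x\<in>?A. sc (Poly_Mapping.lookup (u + v) x) (g x))"
    using assms by (intro lin_superset) (use Poly_Mapping.keys_add[of u v] in auto)
  also have "\<dots> = (\<Sum>x\<in>?A. sc (Poly_Mapping.lookup u x) (g x)) +
      (\<Sum>x\<in>?A. sc (Poly_Mapping.lookup v x) (g x))"
    using assms by (simp add: lookup_add scalingD sum.distrib)
  also have "\<dots> = lin sc g u + lin sc g v"
    using assms by (subst (1 2) lin_superset[where A = ?A]) auto
  finally show ?thesis .
qed

lemma lin_zero [simp]: "lin sc g 0 = 0"
  by (simp add: lin_def)

lemma lin_uminus: "scaling sc \<Longrightarrow> lin sc g (- u) = - lin sc g u"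
  using lin_add[of sc g u "- u"] by (simp add: eq_neg_iff_add_eq_0 add.commute)

lemma lin_diff: "scaling sc \<Longrightarrow> lin sc g (u - v) = lin sc g u - lin sc g v"
  using lin_add[of sc g u "- v"] by (simp add: lin_uminus)

lemma lookup_fscale: "Poly_Mapping.lookup (fscale c u) x = c * Poly_Mapping.lookup u x"
  by (simp add: fscale_def Poly_Mapping.map.rep_eq when_def)

lemma scaling_fscale [simp]: "scaling fscale"
  by (rule scalingI) (auto intro!: poly_mapping_eqI simp: lookup_fscale lookup_add algebra_simps)

lemma keys_fscale: "Poly_Mapping.keys (fscale c u) \<subseteq> Poly_Mapping.keys u"
  by (auto simp: in_keys_iff lookup_fscale)

lemma lin_fscale: "scaling sc \<Longrightarrow> lin sc g (fscale c u) = sc c (lin sc g u)"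
  by (subst lin_superset[where A = "Poly_Mapping.keys u"])
     (auto simp: keys_fscale lookup_fscale scalingD scaling_sum lin_def)

lemma lin_single: "scaling sc \<Longrightarrow> lin sc g (Poly_Mapping.single x c) = sc c (g x)"
  by (subst lin_superset[where A = "{x}"]) auto

lemma lin_gen: "scaling sc \<Longrightarrow> lin sc g (gen x) = g x"
  by (simp add: lin_single scalingD)

lemma lin_fun_add: "scaling sc \<Longrightarrow> lin sc (\<lambda>x. g x + h x) u = lin sc g u + lin sc h u"
  by (simp add: lin_def scalingD sum.distrib)

lemma lin_fun_zero: "scaling sc \<Longrightarrow> lin sc (\<lambda>x. 0) u = 0"
  by (simp add: lin_def scalingD)

lemma lin_fun_scale: "scaling sc \<Longrightarrow> lin sc (\<lambda>x. sc c (g x)) u = sc c (lin sc g u)"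
  by (simp add: lin_def scaling_sum scalingD(3)[symmetric] mult.commute)

lemma lin_cong: "(\<And>x. x \<in> Poly_Mapping.keys u \<Longrightarrow> g x = h x) \<Longrightarrow> lin sc g u = lin sc h u"
  by (simp add: lin_def)

definition klinear :: "('k \<Rightarrow> 'm::plus \<Rightarrow> 'm) \<Rightarrow> ('k \<Rightarrow> 'v \<Rightarrow> 'v::ab_group_add) \<Rightarrow> ('m \<Rightarrow> 'v) \<Rightarrow> bool" where
  "klinear sc sc' f \<longleftrightarrow> (\<forall>x y. f (x + y) = f x + f y) \<and> (\<forall>c x. f (sc c x) = sc' c (f x))"

lemma klinear_zero: "klinear sc sc' f \<Longrightarrow> f (0::'v::ab_group_add) = 0"
  unfolding klinear_def by (metis add_cancel_right_left)

lemma lin_apply: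
  fixes f :: "'m::ab_group_add \<Rightarrow> 'v::ab_group_add"
  assumes "klinear sc sc' f"
  shows "f (lin sc g u) = lin sc' (\<lambda>x. f (g x)) u"
proof -
  have "f (sum h A) = (\<Sum>x\<in>A. f (h x))" for h :: "'b \<Rightarrow> 'm" and A
    using assms klinear_zero[OF assms]
    by (induction A rule: infinite_finite_induct) (simp_all add: klinear_def)
  then show ?thesis using assms by (simp add: lin_def klinear_def)
qed

lemma klinear_lin: "scaling sc \<Longrightarrow> klinear fscale sc (lin sc g)"
  by (simp add: klinear_def lin_add lin_fscale)

lemma lin_flin: "scaling sc \<Longrightarrow> lin sc g (flin f u) = lin sc (\<lambda>x. lin sc g (f x)) u"
  by (rule lin_apply) (rule klinear_lin)

text \<open>Lets Sweedler sums over independent elements be exchanged. It rests on commutativity of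
  the ground ring.\<close>

lemma lin_swap:
  assumes "scaling sc"
  shows "lin sc (\<lambda>x. lin sc (\<lambda>y. g x y) v) u = lin sc (\<lambda>y. lin sc (\<lambda>x. g x y) u) v"
proof -
  have "lin sc (\<lambda>x. lin sc (\<lambda>y. g x y) v) u =
    (\<Sum>x\<in>Poly_Mapping.keys u. \<Sum>y\<in>Poly_Mapping.keys v.
       sc (Poly_Mapping.lookup u x * Poly_Mapping.lookup v y) (g x y))"
    using assms by (simp add: lin_def scaling_sum scalingD(3))
  also have "\<dots> = (\<Sum>y\<in>Poly_Mapping.keys v. \<Sum>x\<in>Poly_Mapping.keys u.
       sc (Poly_Mapping.lookup v y * Poly_Mapping.lookup u x) (g x y))"
    by (subst sum.swap) (simp add: mult.commute)
  finally show ?thesis using assms by (simp add: lin_def scaling_sum scalingD(3))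
qed

lemma flin_gen_id: "flin gen u = (u :: 'x \<Rightarrow>\<^sub>0 'k::{comm_ring,comm_monoid_mult})"
proof (rule poly_mapping_eqI)
  fix x :: 'x
  have "klinear fscale (*) (\<lambda>v :: 'x \<Rightarrow>\<^sub>0 'k. Poly_Mapping.lookup v x)"
    by (simp add: klinear_def lookup_add lookup_fscale)
  from lin_apply[OF this, of gen u]
  have "Poly_Mapping.lookup (flin gen u) x =
      (\<Sum>y\<in>Poly_Mapping.keys u. Poly_Mapping.lookup u y * (1 when y = x))"
    by (simp add: lin_def lookup_single)
  also have "\<dots> = (\<Sum>y\<in>Poly_Mapping.keys u. Poly_Mapping.lookup u y when y = x)"
    by (intro sum.cong) (auto simp: when_def)
  also have "\<dots> = Poly_Mapping.lookup u x"
    by (simp add: when_def in_keys_iff)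
  finally show "Poly_Mapping.lookup (flin gen u) x = Poly_Mapping.lookup u x" .
qed

lemma keys_lin:
  fixes f :: "'x \<Rightarrow> ('y \<Rightarrow>\<^sub>0 'k::{comm_ring,comm_monoid_mult})"
  shows "(\<And>x. x \<in> Poly_Mapping.keys u \<Longrightarrow> Poly_Mapping.keys (f x) \<subseteq> A) \<Longrightarrow> Poly_Mapping.keys (flin f u) \<subseteq> A"
  unfolding lin_def
  by (intro order_trans[OF keys_sum] UN_least order_trans[OF keys_fscale]) auto

text \<open>Only an inclusion, because \<open>gen x\<close> is \<open>0\<close> over the zero
  ring.\<close>

lemma keys_gen: "Poly_Mapping.keys (gen x) \<subseteq> {x}"
  by simp

section \<open>Submodules\<close>

lemma ksubmoduleD:
  assumes "ksubmodule sc N"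
  shows "0 \<in> N" "x \<in> N \<Longrightarrow> y \<in> N \<Longrightarrow> x + y \<in> N" "x \<in> N \<Longrightarrow> - x \<in> N" "x \<in> N \<Longrightarrow> sc c x \<in> N"
    "x \<in> N \<Longrightarrow> y \<in> N \<Longrightarrow> x - y \<in> N"
  using assms unfolding ksubmodule_def by (blast, blast, blast, blast) (metis assms diff_conv_add_uminus ksubmodule_def)

lemma ksubmodule_Inter: "(\<And>N. N \<in> A \<Longrightarrow> ksubmodule sc N) \<Longrightarrow> ksubmodule sc (\<Inter>A)"
  by (auto simp: ksubmodule_def)

lemma ksubmodule_hull [simp]: "ksubmodule sc (ksubmodule sc hull G)"
  by (rule hull_in) (auto intro: ksubmodule_Inter)

lemma ksubmodule_kernel:
  "scaling sc' \<Longrightarrow> klinear sc sc' (f :: 'v::ab_group_add \<Rightarrow> _) \<Longrightarrow> ksubmodule sc {x. f x = 0}"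
proof -
  assume sc': "scaling sc'" and f: "klinear sc sc' f"
  have add: "f (x + y) = f x + f y" and sc: "f (sc c x) = sc' c (f x)" for x y c
    using f by (auto simp: klinear_def)
  have "f (- x) = - f x" for x
    using add[of x "- x"] klinear_zero[OF f] by (simp add: eq_neg_iff_add_eq_0 add.commute)
  then show ?thesis
    using add sc klinear_zero[OF f] by (simp add: ksubmodule_def scalingD[OF sc'])
qed

text \<open>The kernel of a linear extension is a submodule, so a map into a module need only be
  tested on the generating relations.\<close>

lemma hull_lin_zero:
  fixes G :: "('x \<Rightarrow>\<^sub>0 'k::{comm_ring,comm_monoid_mult}) set"
  assumes "scaling sc" "\<And>u. u \<in> G \<Longrightarrow> lin sc f u = 0" "u \<in> ksubmodule fscale hull G"
  shows "lin sc f u = 0"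
proof -
  have "ksubmodule fscale hull G \<subseteq> {u. lin sc f u = 0}"
    using assms by (intro hull_minimal ksubmodule_kernel[OF assms(1)] klinear_lin) auto
  with assms show ?thesis by auto
qed

section \<open>A type containing all quotients of formal sums\<close>

text \<open>The quotients by the individual submodules are not types, so multilinear algebra in them would
  have to be done modulo a submodule. The product of all of them is an honest abelian group; the
  quotient by \<open>N\<close> is its factor at \<open>N\<close>.\<close>

definition quo_rel ::
  "(('y \<Rightarrow>\<^sub>0 'k::{comm_ring,comm_monoid_mult}) set \<Rightarrow> ('y \<Rightarrow>\<^sub>0 'k))
    \<Rightarrow> (('y \<Rightarrow>\<^sub>0 'k) set \<Rightarrow> ('y \<Rightarrow>\<^sub>0 'k)) \<Rightarrow> bool" where
  "quo_rel f g \<longleftrightarrow> (\<forall>N. ksubmodule fscale N \<longrightarrow> f N - g N \<in> N)"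

\<comment> \<open>Formal sums are to stay atomic when equations in \<open>quo\<close> are
  transferred to families of formal sums.\<close>
lifting_forget poly_mapping.lifting

quotient_type (overloaded) ('y, 'k) quo =
  "('y \<Rightarrow>\<^sub>0 'k::{comm_ring,comm_monoid_mult}) set \<Rightarrow> ('y \<Rightarrow>\<^sub>0 'k)" / quo_rel
proof (rule equivpI)
  show "reflp quo_rel" by (auto simp: reflp_def quo_rel_def ksubmodule_def)
  show "symp quo_rel"
    by (rule sympI) (metis minus_diff_eq ksubmoduleD(3) quo_rel_def)
  show "transp quo_rel"
  proof (rule transpI)
    fix f g h :: "('a \<Rightarrow>\<^sub>0 'b::{comm_ring,comm_monoid_mult}) set \<Rightarrow> ('a \<Rightarrow>\<^sub>0 'b)"
    assume *: "quo_rel f g" "quo_rel g h"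
    show "quo_rel f h"
      unfolding quo_rel_def
    proof (intro allI impI)
      fix N :: "('a \<Rightarrow>\<^sub>0 'b) set" assume N: "ksubmodule fscale N"
      have "(f N - g N) + (g N - h N) \<in> N"
        using * N by (intro ksubmoduleD(2)[OF N, of "f N - g N"]) (simp_all add: quo_rel_def)
      then show "f N - h N \<in> N" by simp
    qed
  qed
qed

instantiation quo :: (type, "{comm_ring,comm_monoid_mult}") ab_group_add
begin

lift_definition zero_quo :: "('a, 'b) quo" is "\<lambda>N. 0" .

lift_definition plus_quo :: "('a, 'b) quo \<Rightarrow> ('a, 'b) quo \<Rightarrow> ('a, 'b) quo" is "\<lambda>f g N. f N + g N"
  unfolding quo_rel_def by (metis (no_types, lifting) add_diff_eq diff_add_eq diff_diff_add ksubmoduleD(2) add.commute)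

lift_definition uminus_quo :: "('a, 'b) quo \<Rightarrow> ('a, 'b) quo" is "\<lambda>f N. - f N"
  unfolding quo_rel_def by (metis minus_diff_eq minus_diff_commute add.commute uminus_add_conv_diff diff_minus_eq_add ksubmoduleD(3))

lift_definition minus_quo :: "('a, 'b) quo \<Rightarrow> ('a, 'b) quo \<Rightarrow> ('a, 'b) quo" is "\<lambda>f g N. f N - g N"
proof (unfold quo_rel_def, intro allI impI)
  fix f f' g g' :: "('a \<Rightarrow>\<^sub>0 'b) set \<Rightarrow> ('a \<Rightarrow>\<^sub>0 'b)"
    and N :: "('a \<Rightarrow>\<^sub>0 'b) set"
  assume "\<forall>N. ksubmodule fscale N \<longrightarrow> f N - f' N \<in> N" "\<forall>N. ksubmodule fscale N \<longrightarrow> g N - g' N \<in> N"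
    and N: "ksubmodule fscale N"
  then have "(f N - f' N) - (g N - g' N) \<in> N" by (intro ksubmoduleD(5)[OF N, of "f N - f' N"]) simp_all
  then show "f N - g N - (f' N - g' N) \<in> N" by (simp add: algebra_simps)
qed

instance
  by intro_classes (transfer; simp add: quo_rel_def ksubmodule_def algebra_simps)+

end

lift_definition qscale :: "'k::{comm_ring,comm_monoid_mult} \<Rightarrow> ('y, 'k) quo \<Rightarrow> ('y, 'k) quo"
  is "\<lambda>c f N. fscale c (f N)"
  unfolding quo_rel_def by (metis ksubmoduleD(4) scalingD(8) scaling_fscale)

lemma scaling_qscale [simp]: "scaling qscale"
  by (rule scalingI; transfer; simp add: quo_rel_def ksubmodule_def scalingD)

text \<open>The quotient map of \<open>N\<close> followed by the inclusion of the factor at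
  \<open>N\<close> into the product of all quotients.\<close>

lift_definition proj :: "('y \<Rightarrow>\<^sub>0 'k::{comm_ring,comm_monoid_mult}) set \<Rightarrow> ('y \<Rightarrow>\<^sub>0 'k) \<Rightarrow> ('y, 'k) quo"
  is "\<lambda>N u M. if M = N then u else 0" .

lemma proj_eq_0_iff: "ksubmodule fscale N \<Longrightarrow> proj N u = 0 \<longleftrightarrow> u \<in> N"
  by transfer (auto simp: quo_rel_def ksubmodule_def)

lemma klinear_proj: "klinear fscale qscale (proj N)"
  unfolding klinear_def
  by (intro conjI allI; transfer; auto simp: quo_rel_def ksubmodule_def scalingD)

lemma proj_add: "proj N (u + v) = proj N u + proj N v"
  and proj_fscale: "proj N (fscale c u) = qscale c (proj N u)"
  using klinear_proj unfolding klinear_def by blast+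

lemma proj_diff: "proj N (u - v) = proj N u - proj N v"
  by (metis add_diff_cancel_right' diff_add_cancel proj_add)

lemma proj_eq_iff: "ksubmodule fscale N \<Longrightarrow> proj N u = proj N v \<longleftrightarrow> u - v \<in> N"
  using proj_eq_0_iff[of N "u - v"] by (simp add: proj_diff)

section \<open>Cosets\<close>

lemma mem_coset_iff: "x \<in> u +o N \<longleftrightarrow> x - u \<in> (N :: 'v::ab_group_add set)"
  by (force simp: elt_set_plus_def)

lemma coset_eqI: "ksubmodule sc N \<Longrightarrow> u - v \<in> N \<Longrightarrow> u +o N = v +o N"
proof -
  assume N: "ksubmodule sc N" and uv: "u - v \<in> N"
  have "x - u \<in> N \<longleftrightarrow> x - v \<in> N" for x
    using ksubmoduleD(2)[OF N, of "x - u" "u - v"] ksubmoduleD(5)[OF N, of "x - v" "u - v"] uv by auto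
  then show ?thesis by (auto simp: mem_coset_iff)
qed

lemma coset_eq_iff: "ksubmodule sc N \<Longrightarrow> u +o N = v +o N \<longleftrightarrow> u - v \<in> N"
  using mem_coset_iff[of u v N] mem_coset_iff[of u u N] coset_eqI[of sc N u v]
  by (metis cancel_comm_monoid_add_class.diff_cancel ksubmoduleD(1))

lemma rep_in: "ksubmodule sc N \<Longrightarrow> rep (u +o N) \<in> u +o N"
  unfolding rep_def by (rule someI[of _ u]) (simp add: mem_coset_iff ksubmoduleD)

lemma rep_diff: "ksubmodule sc N \<Longrightarrow> rep (u +o N) - u \<in> N"
  using rep_in mem_coset_iff by blast

lemma coset_rep: "ksubmodule sc N \<Longrightarrow> rep (u +o N) +o N = u +o N"
  by (rule coset_eqI) (auto simp: rep_diff)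

lemma coset_plus:
  assumes "ksubmodule sc N"
  shows "(u +o N) + (v +o N) = (u + v) +o (N :: 'v::ab_group_add set)"
proof -
  have "N + N = N"
    using ksubmoduleD[OF assms] by (force simp: set_plus_def)
  then show ?thesis by (metis add.commute set_plus_rearrange)
qed

lemma quot_sel: "carr (quot sc F N) = {u +o N | u. u \<in> F}" "sm (quot sc F N) c X = sc c (rep X) +o N"
  by (simp_all add: quot_def)

lemma quot_sm:
  assumes "scaling sc" "ksubmodule sc N"
  shows "sm (quot sc F N) c (u +o N) = sc c u +o N"
  unfolding quot_sel
  by (rule coset_eqI[OF assms(2)])
     (metis assms ksubmoduleD(4) rep_diff scalingD(8))

lemma ball_carr_quot: "(\<forall>X\<in>carr (quot sc F N). P X) \<longleftrightarrow> (\<forall>u\<in>F. P (u +o N))"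
  by (auto simp: quot_sel)

lemma coset_in_carr: "u \<in> F \<Longrightarrow> u +o N \<in> carr (quot sc F N)"
  by (auto simp: quot_sel)

lemma kmodule_quot:
  assumes sc: "scaling sc" and N: "ksubmodule sc N" and F: "ksubmodule sc F"
  shows "kmodule (quot sc F N)"
proof -
  note F' = ksubmoduleD[OF F]
  note simps = ball_carr_quot quot_sm[OF sc N] coset_plus[OF N] coset_in_carr F' scalingD[OF sc]
  have "\<exists>e\<in>carr (quot sc F N). (\<forall>x\<in>carr (quot sc F N). e + x = x) \<and>
      (\<forall>x\<in>carr (quot sc F N). \<exists>y\<in>carr (quot sc F N). x + y = e)"
  proof (rule bexI[of _ "0 +o N"], rule conjI)
    show "\<forall>x\<in>carr (quot sc F N). \<exists>y\<in>carr (quot sc F N). x + y = 0 +o N"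
      unfolding ball_carr_quot
    proof
      fix u assume "u \<in> F"
      then show "\<exists>y\<in>carr (quot sc F N). u +o N + y = 0 +o N"
        by (intro bexI[of _ "(- u) +o N"]) (simp_all add: simps del: set_zero_plus)
    qed
  qed (simp_all add: simps del: set_zero_plus)
  then show ?thesis
    unfolding kmodule_def by (simp add: simps add.commute add.left_commute add.assoc)
qed

lemma ksubmodule_keys: "ksubmodule fscale {u :: 'x \<Rightarrow>\<^sub>0 'k::{comm_ring,comm_monoid_mult}. Poly_Mapping.keys u \<subseteq> A}"
  unfolding ksubmodule_def
  by (auto dest: subsetD[OF Poly_Mapping.keys_add] subsetD[OF keys_fscale])

text \<open>The choice made by \<open>rep\<close> is invisible to a linear map that kills the
  relations. This is what justifies evaluating balanced maps on chosen representatives.\<close>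

lemma lin_rep_coset:
  fixes u :: "'x \<Rightarrow>\<^sub>0 'k::{comm_ring,comm_monoid_mult}"
  assumes "scaling sc" "ksubmodule fscale N" "\<And>n. n \<in> N \<Longrightarrow> lin sc f n = 0"
  shows "lin sc f (rep (u +o N)) = lin sc f u"
  using assms(3)[OF rep_diff[OF assms(2), of u]] by (simp add: lin_diff[OF assms(1)])

lemma lin_rep_induced:
  fixes X :: "('x \<Rightarrow>\<^sub>0 'k::{comm_ring,comm_monoid_mult}) set"
  assumes "scaling sc" "ksubmodule fscale N" "\<And>n. n \<in> N \<Longrightarrow> lin sc f n = 0"
  shows "lin sc f (rep (induced N g X)) = lin sc (\<lambda>x. lin sc f (g x)) (rep X)"
  unfolding induced_def by (subst lin_rep_coset[OF assms]) (simp_all add: lin_flin assms(1))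

lemma lin_coset_eq:
  fixes u :: "'x \<Rightarrow>\<^sub>0 'k::{comm_ring,comm_monoid_mult}"
  assumes "scaling sc" "ksubmodule fscale N" "\<And>n. n \<in> N \<Longrightarrow> lin sc f n = 0" "u +o N = v +o N"
  shows "lin sc f u = lin sc f v"
  using assms(3)[of "u - v"] assms(2,4) by (simp add: coset_eq_iff lin_diff[OF assms(1)])

section \<open>Balanced maps\<close>

definition balanced ::
  "('k \<Rightarrow> 'v \<Rightarrow> 'v::ab_group_add) \<Rightarrow> ('k, 'm::plus, 'z) kmod_scheme \<Rightarrow> ('k, 'n::plus, 'y) kmod_scheme
    \<Rightarrow> 'a set \<Rightarrow> ('m \<Rightarrow> 'a \<Rightarrow> 'm) \<Rightarrow> ('a \<Rightarrow> 'n \<Rightarrow> 'n) \<Rightarrow> ('m \<Rightarrow> 'n \<Rightarrow> 'v) \<Rightarrow> bool" where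
  "balanced sc M N A ra la g \<longleftrightarrow>
    (\<forall>m\<in>carr M. \<forall>m'\<in>carr M. \<forall>n\<in>carr N. g (m + m') n = g m n + g m' n) \<and>
    (\<forall>m\<in>carr M. \<forall>n\<in>carr N. \<forall>n'\<in>carr N. g m (n + n') = g m n + g m n') \<and>
    (\<forall>c. \<forall>m\<in>carr M. \<forall>n\<in>carr N. g (sm M c m) n = sc c (g m n)) \<and>
    (\<forall>c. \<forall>m\<in>carr M. \<forall>n\<in>carr N. g m (sm N c n) = sc c (g m n)) \<and>
    (\<forall>m\<in>carr M. \<forall>a\<in>A. \<forall>n\<in>carr N. g (ra m a) n = g m (la a n))"

lemma ksubmodule_bal_rel [simp]: "ksubmodule fscale (bal_rel M N A ra la)"
  by (simp add: bal_rel_def)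

lemma lin_bal_rel:
  assumes sc: "scaling sc" and g: "balanced sc M N A ra la g" and u: "u \<in> bal_rel M N A ra la"
  shows "lin sc (\<lambda>(x, y). g x y) u = 0"
  by (rule hull_lin_zero[OF sc _ u[unfolded bal_rel_def]])
     (use g in \<open>auto simp: balanced_def lin_diff[OF sc] lin_gen[OF sc] lin_fscale[OF sc]\<close>)

lemma bal_rel_middle:
  "m \<in> carr M \<Longrightarrow> a \<in> A \<Longrightarrow> n \<in> carr N \<Longrightarrow> gen (ra m a, n) - gen (m, la a n) \<in> bal_rel M N A ra la"
  unfolding bal_rel_def by (rule hull_inc) blast

text \<open>The universal balanced map. Inserting it into an identity valid for all balanced maps
  gives the identity in the tensor product itself.\<close>

lemma balanced_proj:
  fixes M :: "('k::{comm_ring,comm_monoid_mult}, 'm::plus, 'z) kmod_scheme"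
  assumes "g = (\<lambda>m n. proj (bal_rel M N A ra la) (gen (m, n)))"
  shows "balanced qscale M N A ra la g"
proof -
  let ?P = "proj (bal_rel M N A ra la)"
  have *: "?P u = 0" if "u \<in> (
     {gen (m + m', n) - gen (m, n) - gen (m', n) | m m' n. m \<in> carr M \<and> m' \<in> carr M \<and> n \<in> carr N} \<union>
     {gen (m, n + n') - gen (m, n) - gen (m, n') | m n n'. m \<in> carr M \<and> n \<in> carr N \<and> n' \<in> carr N} \<union>
     {gen (sm M c m, n) - fscale c (gen (m, n)) | c m n. m \<in> carr M \<and> n \<in> carr N} \<union>
     {gen (m, sm N c n) - fscale c (gen (m, n)) | c m n. m \<in> carr M \<and> n \<in> carr N} \<union>
     {gen (ra m a, n) - gen (m, la a n) | m a n. m \<in> carr M \<and> a \<in> A \<and> n \<in> carr N})" for u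
  proof -
    have "u \<in> bal_rel M N A ra la" unfolding bal_rel_def by (rule hull_inc) (rule that)
    then show ?thesis by (simp add: proj_eq_0_iff)
  qed
  show ?thesis
    unfolding balanced_def assms
  proof (intro conjI ballI allI)
    fix m m' n assume m: "m \<in> carr M" "m' \<in> carr M" "n \<in> carr N"
    have "?P (gen (m + m', n) - gen (m, n) - gen (m', n)) = 0" by (rule *) (use m in blast)
    then show "?P (gen (m + m', n)) = ?P (gen (m, n)) + ?P (gen (m', n))"
      by (simp add: proj_diff diff_eq_eq add.commute)
  next
    fix m n n' assume m: "m \<in> carr M" "n \<in> carr N" "n' \<in> carr N"
    have "?P (gen (m, n + n') - gen (m, n) - gen (m, n')) = 0" by (rule *) (use m in blast)
    then show "?P (gen (m, n + n')) = ?P (gen (m, n)) + ?P (gen (m, n'))"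
      by (simp add: proj_diff diff_eq_eq add.commute)
  next
    fix c m n assume m: "m \<in> carr M" "n \<in> carr N"
    have "?P (gen (sm M c m, n) - fscale c (gen (m, n))) = 0" by (rule *) (use m in blast)
    then show "?P (gen (sm M c m, n)) = qscale c (?P (gen (m, n)))" by (simp add: proj_diff proj_fscale)
  next
    fix c m n assume m: "m \<in> carr M" "n \<in> carr N"
    have "?P (gen (m, sm N c n) - fscale c (gen (m, n))) = 0" by (rule *) (use m in blast)
    then show "?P (gen (m, sm N c n)) = qscale c (?P (gen (m, n)))" by (simp add: proj_diff proj_fscale)
  next
    fix m a n assume m: "m \<in> carr M" "a \<in> A" "n \<in> carr N"
    have "?P (gen (ra m a, n) - gen (m, la a n)) = 0" by (rule *) (use m in blast)
    then show "?P (gen (ra m a, n)) = ?P (gen (m, la a n))" by (simp add: proj_diff)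
  qed
qed

lemma proj_eq_lin: "proj N u = lin qscale (\<lambda>x. proj N (gen x)) u"
  using lin_apply[OF klinear_proj, of N gen u] by (simp add: flin_gen_id)

lemma proj_flin: "proj N (flin g u) = lin qscale (\<lambda>x. proj N (g x)) u"
  by (rule lin_apply[OF klinear_proj])

abbreviation qlin :: "('x \<Rightarrow> ('y, 'k) quo) \<Rightarrow> ('x \<Rightarrow>\<^sub>0 'k::{comm_ring,comm_monoid_mult}) \<Rightarrow> ('y, 'k) quo" where
  "qlin \<equiv> lin qscale"

lemmas qlin_flin = lin_flin[OF scaling_qscale]
  and qlin_gen = lin_gen[OF scaling_qscale]
  and qlin_add = lin_add[OF scaling_qscale]
  and qlin_diff = lin_diff[OF scaling_qscale]
  and qlin_fscale = lin_fscale[OF scaling_qscale]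
  and qlin_fun_add = lin_fun_add[OF scaling_qscale]
  and qlin_fun_scale = lin_fun_scale[OF scaling_qscale]
  and qlin_rep_coset = lin_rep_coset[OF scaling_qscale]
  and qlin_rep_induced = lin_rep_induced[OF scaling_qscale]
  and qlin_coset_eq = lin_coset_eq[OF scaling_qscale]
  and qlin_swap = lin_swap[OF scaling_qscale]

definition multilinear ::
  "('k::{comm_ring,comm_monoid_mult} \<Rightarrow> 'm::plus \<Rightarrow> 'm) \<Rightarrow> nat \<Rightarrow> ('m list \<Rightarrow> ('y, 'k) quo) \<Rightarrow> bool" where
  "multilinear sc l f \<longleftrightarrow>
     (\<forall>xs i. length xs = l \<and> i < l \<longrightarrow> klinear sc qscale (\<lambda>x. f (xs[i := x])))"

definition pow_balanced ::
  "('k::{comm_ring,comm_monoid_mult} \<Rightarrow> 'm::plus \<Rightarrow> 'm) \<Rightarrow> 'a set \<Rightarrow> ('m \<Rightarrow> 'a \<Rightarrow> 'm) \<Rightarrow> ('a \<Rightarrow> 'm \<Rightarrow> 'm)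
    \<Rightarrow> nat \<Rightarrow> ('m list \<Rightarrow> ('y, 'k) quo) \<Rightarrow> bool" where
  "pow_balanced sc A ra la l f \<longleftrightarrow> multilinear sc l f \<and>
     (\<forall>xs i a. length xs = l \<and> Suc i < l \<and> a \<in> A \<longrightarrow>
        f (xs[i := ra (xs ! i) a]) = f (xs[Suc i := la a (xs ! Suc i)]))"

lemma qlin_pow_gens:
  "pow_balanced sc A ra la l f \<Longrightarrow> u \<in> pow_gens sc A ra la l \<Longrightarrow> qlin f u = 0"
  by (auto simp: pow_gens_def pow_balanced_def multilinear_def klinear_def qlin_diff qlin_gen qlin_fscale)

text \<open>Converse of \<open>qlin_pow_gens\<close>; it supplies the universal balanced maps on
  tensor powers, which kill the generators by construction.\<close>

lemma pow_balanced_if_zero: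
  fixes f :: "'m::plus list \<Rightarrow> ('y, 'k::{comm_ring,comm_monoid_mult}) quo"
  assumes 0: "\<And>u. u \<in> pow_gens sc A ra la l \<Longrightarrow> qlin f u = 0"
  shows "pow_balanced sc A ra la l f"
  unfolding pow_balanced_def multilinear_def klinear_def
proof (intro conjI allI impI)
  fix xs :: "'m list" and i x y assume a: "length xs = l \<and> i < l"
  have "qlin f (gen (xs[i := x + y]) - gen (xs[i := x]) - gen (xs[i := y])) = 0"
    by (rule 0) (use a in \<open>unfold pow_gens_def, blast\<close>)
  then show "f (xs[i := x + y]) = f (xs[i := x]) + f (xs[i := y])"
    by (simp add: qlin_diff qlin_gen diff_eq_eq add.commute)
next
  fix xs :: "'m list" and i c x assume a: "length xs = l \<and> i < l"
  have "qlin f (gen (xs[i := sc c x]) - fscale c (gen (xs[i := x]))) = 0"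
    by (rule 0) (use a in \<open>unfold pow_gens_def, blast\<close>)
  then show "f (xs[i := sc c x]) = qscale c (f (xs[i := x]))"
    by (simp add: qlin_diff qlin_gen qlin_fscale)
next
  fix xs :: "'m list" and i a assume a: "length xs = l \<and> Suc i < l \<and> a \<in> A"
  have "qlin f (gen (xs[i := ra (xs ! i) a]) - gen (xs[Suc i := la a (xs ! Suc i)])) = 0"
    by (rule 0) (use a in \<open>unfold pow_gens_def, blast\<close>)
  then show "f (xs[i := ra (xs ! i) a]) = f (xs[Suc i := la a (xs ! Suc i)])"
    by (simp add: qlin_diff qlin_gen)
qed

definition bilinear ::
  "('k::{comm_ring,comm_monoid_mult} \<Rightarrow> 'm::plus \<Rightarrow> 'm) \<Rightarrow> ('k \<Rightarrow> 'n::plus \<Rightarrow> 'n)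
    \<Rightarrow> ('m \<Rightarrow> 'n \<Rightarrow> ('y, 'k) quo) \<Rightarrow> bool" where
  "bilinear sc sc' g \<longleftrightarrow>
    (\<forall>x x' y. g (x + x') y = g x y + g x' y) \<and> (\<forall>x y y'. g x (y + y') = g x y + g x y') \<and>
    (\<forall>c x y. g (sc c x) y = qscale c (g x y)) \<and> (\<forall>c x y. g x (sc' c y) = qscale c (g x y))"

text \<open>Equations between functions, so that they also rewrite under an eta-contracted argument.\<close>

lemma bilinear_ext:
  "bilinear sc sc' g \<longleftrightarrow>
    (\<forall>x x'. g (x + x') = (\<lambda>y. g x y + g x' y)) \<and> (\<forall>x y y'. g x (y + y') = g x y + g x y') \<and>
    (\<forall>c x. g (sc c x) = (\<lambda>y. qscale c (g x y))) \<and> (\<forall>c x y. g x (sc' c y) = qscale c (g x y))"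
  by (simp add: bilinear_def fun_eq_iff)

section \<open>Structure maps tested against balanced maps\<close>

locale hopf_galois =
  fixes \<B> :: "('k::{comm_ring,comm_monoid_mult}, 'r::{ring,monoid_mult}, 'b::{ring,monoid_mult}) bialgebroid"
    and T :: "('k, 'r, 'b, 't::{ring,monoid_mult}) comodule_data"
    and S :: "'t set"
  assumes hopf: "right_times_Hopf \<B>"
    and galois: "Galois_extension \<B> T S"
begin

text \<open>The algebra map from \<open>R\<close> to \<open>T\<close> through which the right
  \<open>R\<close>-action is multiplication, by \<open>ract_eq\<close> and
  \<open>j_mult\<close>.\<close>

definition j :: "'r \<Rightarrow> 't" where
  "j r = ract T 1 r"

abbreviation "Tlinear \<equiv> klinear (smT T) qscale"
abbreviation "Blinear \<equiv> klinear (smB \<B>) qscale"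

definition BBbal :: "('b \<Rightarrow> 'b \<Rightarrow> ('y, 'k) quo) \<Rightarrow> bool" where
  "BBbal g \<longleftrightarrow> bilinear (smB \<B>) (smB \<B>) g \<and> (\<forall>x r y. g (x * xi \<B> r) y = g x (y * zeta \<B> r))"

definition TBbal :: "('t \<Rightarrow> 'b \<Rightarrow> ('y, 'k) quo) \<Rightarrow> bool" where
  "TBbal g \<longleftrightarrow> bilinear (smT T) (smB \<B>) g \<and> (\<forall>x r y. g (x * j r) y = g x (y * zeta \<B> r))"

definition TTbal :: "('t \<Rightarrow> 't \<Rightarrow> ('y, 'k) quo) \<Rightarrow> bool" where
  "TTbal g \<longleftrightarrow> bilinear (smT T) (smT T) g \<and> (\<forall>x. \<forall>s\<in>S. \<forall>y. g (x * s) y = g x (s * y))"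

text \<open>In Sweedler notation \<open>D g b\<close>, \<open>Rho g t\<close> and \<open>Tau g b\<close> are the values of \<open>g\<close> on \<open>\<Delta> b\<close>, on the
  coaction of \<open>t\<close> and on \<open>b\<^bsup>{-}\<^esup> \<otimes> b\<^bsup>{+}\<^esup>\<close>; for balanced \<open>g\<close> they do not depend on representatives.\<close>

definition D :: "('b \<Rightarrow> 'b \<Rightarrow> ('y, 'k) quo) \<Rightarrow> 'b \<Rightarrow> ('y, 'k) quo" where
  "D g b = qlin (\<lambda>(x, y). g x y) (rep (cop \<B> b))"

definition Rho :: "('t \<Rightarrow> 'b \<Rightarrow> ('y, 'k) quo) \<Rightarrow> 't \<Rightarrow> ('y, 'k) quo" where
  "Rho g t = qlin (\<lambda>(x, y). g x y) (rep (coact T t))"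

definition Tau :: "('t \<Rightarrow> 't \<Rightarrow> ('y, 'k) quo) \<Rightarrow> 'b \<Rightarrow> ('y, 'k) quo" where
  "Tau g b = qlin (\<lambda>(x, y). g x y) (rep (translation \<B> T S b))"

lemma sum_fun_add:
  "D (\<lambda>x y. g x y + h x y) b = D g b + D h b"
  "Rho (\<lambda>x y. g' x y + h' x y) t = Rho g' t + Rho h' t"
  "Tau (\<lambda>x y. g'' x y + h'' x y) b = Tau g'' b + Tau h'' b"
  by (simp_all add: D_def Rho_def Tau_def case_prod_unfold qlin_fun_add)

lemma sum_fun_scale:
  "D (\<lambda>x y. qscale c (g x y)) b = qscale c (D g b)"
  "Rho (\<lambda>x y. qscale c (g' x y)) t = qscale c (Rho g' t)"
  "Tau (\<lambda>x y. qscale c (g'' x y)) b = qscale c (Tau g'' b)"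
  by (simp_all add: D_def Rho_def Tau_def case_prod_unfold qlin_fun_scale)

lemma Tau_D: "Tau (\<lambda>m p. D (\<lambda>x y. g m p x y) b') b = D (\<lambda>x y. Tau (\<lambda>m p. g m p x y) b) b'"
  and Tau_Tau: "Tau (\<lambda>m p. Tau (\<lambda>x y. g'' m p x y) b') b = Tau (\<lambda>x y. Tau (\<lambda>m p. g'' m p x y) b) b'"
  by (simp_all add: D_def Rho_def Tau_def case_prod_unfold, (rule qlin_swap)+)

lemmas bialgebroid = hopf[unfolded right_times_Hopf_def right_bialgebroid_def, THEN conjunct1]
lemmas comodule_algebra = galois[unfolded Galois_extension_def, THEN conjunct1,
    unfolded right_comodule_algebra_def]
lemmas comodule = comodule_algebra[THEN conjunct2, THEN conjunct1, unfolded right_comodule_def]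

lemma R_coring: "R_coring \<B>"
  using bialgebroid by simp

lemmas coring = R_coring[unfolded R_coring_def]

lemma scaling_smT: "scaling (smT T)"
  using comodule_algebra by (auto simp: kalgebra_def)

lemma smB_mult: "smB \<B> c x * y = smB \<B> c (x * y)" "x * smB \<B> c y = smB \<B> c (x * y)"
  and smT_mult: "smT T c x' * y' = smT T c (x' * y')" "x' * smT T c y' = smT T c (x' * y')"
  using bialgebroid comodule_algebra unfolding kalgebra_def by metis+

lemma xi_one [simp]: "xi \<B> 1 = 1" and zeta_one [simp]: "zeta \<B> 1 = 1"
  and xi_zeta: "xi \<B> r * zeta \<B> r' = zeta \<B> r' * xi \<B> r"
  using bialgebroid by auto

lemma eps_add: "eps \<B> (b + b') = eps \<B> b + eps \<B> b'" and eps_sm: "eps \<B> (smB \<B> c b) = smR \<B> c (eps \<B> b)"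
  and eps_one [simp]: "eps \<B> 1 = 1"
  and eps_bimod: "eps \<B> (b * xi \<B> r' * zeta \<B> r) = r * eps \<B> b * r'"
  using bialgebroid coring by (auto simp: kmod_hom_def lR_def rR_def)

lemma eps_zeta: "eps \<B> (b * zeta \<B> r) = r * eps \<B> b" and eps_xi: "eps \<B> (b * xi \<B> r) = eps \<B> b * r"
  using eps_bimod[of b 1 r] eps_bimod[of b r 1] by simp_all

lemma ract_add: "ract T t (r + r') = ract T t r + ract T t r'"
  and ract_sm: "ract T t (smR \<B> c r) = smT T c (ract T t r)"
  and ract_mult: "ract T t (r * r') = ract T (ract T t r) r'"
  and ract_one [simp]: "ract T t 1 = t"
  and ract_add_left: "ract T (t + t') r = ract T t r + ract T t' r"
  and ract_sm_left: "ract T (smT T c t) r = smT T c (ract T t r)"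
  using comodule by auto

lemma BB_rel_sub [simp]: "ksubmodule fscale (BB_rel \<B>)" and TB_rel_sub [simp]: "ksubmodule fscale (TB_rel \<B> T)"
  by (simp_all add: BB_rel_def TB_rel_def)

lemma cop_carr: "cop \<B> b \<in> carr (BB \<B>)" and coact_carr: "coact T t \<in> carr (TB \<B> T)"
  using coring comodule by (auto simp: kmod_hom_def)

lemma cop_coset: "\<exists>u. cop \<B> b = u +o BB_rel \<B>" and coact_coset: "\<exists>u. coact T t = u +o TB_rel \<B> T"
  using cop_carr[of b] coact_carr[of t] by (auto simp: BB_def TB_def tensor_def quot_sel BB_rel_def TB_rel_def)

lemma rep_cop: "rep (cop \<B> b) \<in> cop \<B> b" "rep (cop \<B> b) +o BB_rel \<B> = cop \<B> b"
  and rep_coact: "rep (coact T t) \<in> coact T t" "rep (coact T t) +o TB_rel \<B> T = coact T t"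
  using cop_coset[of b] coact_coset[of t]
  by (metis rep_in BB_rel_sub, metis coset_rep BB_rel_sub, metis rep_in TB_rel_sub, metis coset_rep TB_rel_sub)

lemma BBbal_zero: "BBbal g \<Longrightarrow> u \<in> BB_rel \<B> \<Longrightarrow> qlin (\<lambda>(x, y). g x y) u = 0"
  unfolding BB_rel_def
  by (rule lin_bal_rel) (auto simp: balanced_def BBbal_def bilinear_def lR_def rR_def)

lemma D_coset: "BBbal g \<Longrightarrow> cop \<B> b = u +o BB_rel \<B> \<Longrightarrow> D g b = qlin (\<lambda>(x, y). g x y) u"
  unfolding D_def by (simp add: qlin_rep_coset BBbal_zero)

text \<open>The bialgebroid axioms are equations of cosets. Since \<open>g\<close> is balanced, each
  coset may be evaluated on the representative that the axiom provides.\<close>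

lemma
  assumes g: "BBbal g"
  shows D_add: "D g (b + b') = D g b + D g b'"
    and D_sm: "D g (smB \<B> c b) = qscale c (D g b)"
    and D_bimod: "D g (b * xi \<B> r' * zeta \<B> r) = D (\<lambda>x y. g (x * zeta \<B> r) (y * xi \<B> r')) b"
    and D_one: "D g 1 = g 1 1"
    and D_mult: "D g (b * b') = D (\<lambda>x y. D (\<lambda>x' y'. g (x * x') (y * y')) b') b"
    and D_takeuchi: "D (\<lambda>x y. g (xi \<B> r * x) y) b = D (\<lambda>x y. g x (zeta \<B> r * y)) b"
proof -
  have "cop \<B> (b + b') = (rep (cop \<B> b) + rep (cop \<B> b')) +o BB_rel \<B>"
    using coring by (simp add: kmod_hom_def coset_plus[OF BB_rel_sub, symmetric] rep_cop)
  then show "D g (b + b') = D g b + D g b'"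
    by (subst D_coset[OF g]) (auto simp: qlin_add D_def)
  have "cop \<B> (smB \<B> c b) = fscale c (rep (cop \<B> b)) +o BB_rel \<B>"
    using coring by (simp add: kmod_hom_def BB_def tensor_def quot_sel BB_rel_def)
  then show "D g (smB \<B> c b) = qscale c (D g b)"
    by (subst D_coset[OF g]) (auto simp: qlin_fscale D_def)
  have "cop \<B> (b * xi \<B> r' * zeta \<B> r) =
      flin (\<lambda>(b1, b2). gen (b1 * zeta \<B> r, b2 * xi \<B> r')) (rep (cop \<B> b)) +o BB_rel \<B>"
    using coring rep_cop(1)[of b] by (simp add: lR_def rR_def)
  then show "D g (b * xi \<B> r' * zeta \<B> r) = D (\<lambda>x y. g (x * zeta \<B> r) (y * xi \<B> r')) b"
    by (subst D_coset[OF g]) (auto simp: qlin_flin qlin_gen D_def case_prod_unfold)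
  show "D g 1 = g 1 1"
    using bialgebroid by (subst D_coset[OF g]) (auto simp: qlin_gen)
  have "cop \<B> (b * b') = flin (\<lambda>(b1, b2). flin (\<lambda>(b1', b2'). gen (b1 * b1', b2 * b2'))
     (rep (cop \<B> b'))) (rep (cop \<B> b)) +o BB_rel \<B>"
    using bialgebroid rep_cop(1)[of b] rep_cop(1)[of b'] by simp
  then show "D g (b * b') = D (\<lambda>x y. D (\<lambda>x' y'. g (x * x') (y * y')) b') b"
    by (subst D_coset[OF g]) (auto simp: qlin_flin qlin_gen D_def case_prod_unfold)
  have "flin (\<lambda>(b1, b2). gen (xi \<B> r * b1, b2)) (rep (cop \<B> b)) +o BB_rel \<B> =
        flin (\<lambda>(b1, b2). gen (b1, zeta \<B> r * b2)) (rep (cop \<B> b)) +o BB_rel \<B>"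
    using bialgebroid rep_cop(1)[of b] by simp
  from qlin_coset_eq[OF BB_rel_sub BBbal_zero[OF g] this]
  show "D (\<lambda>x y. g (xi \<B> r * x) y) b = D (\<lambda>x y. g x (zeta \<B> r * y)) b"
    by (simp add: qlin_flin qlin_gen D_def case_prod_unfold)
qed

lemma D_zeta: "BBbal g \<Longrightarrow> D g (b * zeta \<B> r) = D (\<lambda>x y. g (x * zeta \<B> r) y) b"
  using D_bimod[of g b 1 r] by simp


text \<open>The coaction of \<open>1\<close> is \<open>1 \<otimes> 1\<close>, so the left action
  yields \<open>1\<close> acted on by \<open>eps (xi r) = r\<close>. Together with the
  \<open>R\<close>-balanced product of \<open>T\<close> at \<open>t' = 1\<close> this gives
  \<open>ract_eq\<close>.\<close>

lemma lact_one: "lact_comod \<B> T r 1 = j r"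
proof -
  have bal: "balanced (smT T) (whole (smT T)) (whole (smB \<B>)) UNIV (ract T) (lR \<B>)
      (\<lambda>t b. ract T t (eps \<B> (xi \<B> r * b)))"
    using eps_zeta by (simp add: balanced_def ract_add_left distrib_left eps_add ract_add ract_sm_left smB_mult
        eps_sm ract_sm lR_def mult.assoc[symmetric] ract_mult)
  have "coact T 1 = gen (1, 1) +o TB_rel \<B> T" using comodule_algebra by simp
  then have "lact_comod \<B> T r 1 = lin (smT T) (\<lambda>(t, b). ract T t (eps \<B> (xi \<B> r * b))) (gen (1, 1))"
    unfolding lact_comod_def
    by (simp only:) (rule lin_rep_coset[OF scaling_smT TB_rel_sub], unfold TB_rel_def,
        rule lin_bal_rel[OF scaling_smT bal])
  also have "\<dots> = j r"
    using eps_xi[of 1 r] by (simp add: j_def lin_gen[OF scaling_smT])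
  finally show ?thesis .
qed

lemma ract_eq: "ract T t r = t * j r"
proof -
  have "ract T t r * 1 = t * lact_comod \<B> T r 1" using comodule_algebra by blast
  then show ?thesis by (simp add: lact_one)
qed

lemma j_add: "j (r + r') = j r + j r'" and j_sm: "j (smR \<B> c r) = smT T c (j r)" and j_one [simp]: "j 1 = 1"
  by (simp_all add: j_def ract_add ract_sm)

lemma j_mult: "j (r * r') = j r * j r'"
  using ract_mult[of 1 r r'] by (simp add: ract_eq)

lemma TBbal_zero: "TBbal g \<Longrightarrow> u \<in> TB_rel \<B> T \<Longrightarrow> qlin (\<lambda>(x, y). g x y) u = 0"
  unfolding TB_rel_def
  by (rule lin_bal_rel) (auto simp: balanced_def TBbal_def bilinear_def lR_def ract_eq)

lemma Rho_coset: "TBbal g \<Longrightarrow> coact T t = u +o TB_rel \<B> T \<Longrightarrow> Rho g t = qlin (\<lambda>(x, y). g x y) u"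
  unfolding Rho_def by (simp add: qlin_rep_coset TBbal_zero)

lemma S_coact: "s \<in> S \<Longrightarrow> coact T s = gen (s, 1) +o TB_rel \<B> T"
  using galois by (auto simp: Galois_extension_def coinvariants_def)

lemma coact_mult:
  "u \<in> coact T t \<Longrightarrow> v \<in> coact T t' \<Longrightarrow> coact T (t * t') =
    flin (\<lambda>(t0, b). flin (\<lambda>(t0', b'). gen (t0 * t0', b * b')) v) u +o TB_rel \<B> T"
  using comodule_algebra by blast

lemma gen_in_coset: "gen x \<in> gen x +o TB_rel \<B> T"
  by (simp add: mem_coset_iff ksubmoduleD(1)[OF TB_rel_sub])

lemma
  assumes g: "TBbal g"
  shows Rho_add: "Rho g (t + t') = Rho g t + Rho g t'"
    and Rho_sm: "Rho g (smT T c t) = qscale c (Rho g t)"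
    and Rho_j: "Rho g (t * j r) = Rho (\<lambda>x y. g x (y * xi \<B> r)) t"
    and Rho_one: "Rho g 1 = g 1 1"
    and Rho_mult: "Rho g (t * t') = Rho (\<lambda>x y. Rho (\<lambda>x' y'. g (x * x') (y * y')) t') t"
    and Rho_S_mult: "s \<in> S \<Longrightarrow> Rho g (s * t) = Rho (\<lambda>x y. g (s * x) y) t"
    and Rho_mult_S: "s \<in> S \<Longrightarrow> Rho g (t * s) = Rho (\<lambda>x y. g (x * s) y) t"
    and Rho_takeuchi: "Rho (\<lambda>x y. g (j r * x) y) t = Rho (\<lambda>x y. g x (zeta \<B> r * y)) t"
proof -
  have "coact T (t + t') = (rep (coact T t) + rep (coact T t')) +o TB_rel \<B> T"
    using comodule by (simp add: kmod_hom_def coset_plus[OF TB_rel_sub, symmetric] rep_coact)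
  then show "Rho g (t + t') = Rho g t + Rho g t'"
    by (subst Rho_coset[OF g]) (auto simp: qlin_add Rho_def)
  have "coact T (smT T c t) = fscale c (rep (coact T t)) +o TB_rel \<B> T"
    using comodule by (simp add: kmod_hom_def TB_def tensor_def quot_sel TB_rel_def)
  then show "Rho g (smT T c t) = qscale c (Rho g t)"
    by (subst Rho_coset[OF g]) (auto simp: qlin_fscale Rho_def)
  have "coact T (t * j r) = flin (\<lambda>(t0, b). gen (t0, b * xi \<B> r)) (rep (coact T t)) +o TB_rel \<B> T"
    using comodule rep_coact(1)[of t] by (simp add: rR_def ract_eq[symmetric])
  then show "Rho g (t * j r) = Rho (\<lambda>x y. g x (y * xi \<B> r)) t"
    by (subst Rho_coset[OF g]) (auto simp: qlin_flin qlin_gen Rho_def case_prod_unfold)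
  have one: "coact T 1 = gen (1, 1) +o TB_rel \<B> T" using comodule_algebra by simp
  then show "Rho g 1 = g 1 1"
    by (subst Rho_coset[OF g]) (auto simp: qlin_gen)
  show "Rho g (t * t') = Rho (\<lambda>x y. Rho (\<lambda>x' y'. g (x * x') (y * y')) t') t"
    by (subst Rho_coset[OF g coact_mult[OF rep_coact(1) rep_coact(1)]])
       (auto simp: qlin_flin qlin_gen Rho_def case_prod_unfold)
  show "s \<in> S \<Longrightarrow> Rho g (s * t) = Rho (\<lambda>x y. g (s * x) y) t"
    by (subst Rho_coset[OF g coact_mult[OF _ rep_coact(1), of "gen (s, 1)"]])
       (auto simp: qlin_flin qlin_gen Rho_def case_prod_unfold S_coact gen_in_coset)
  show "s \<in> S \<Longrightarrow> Rho g (t * s) = Rho (\<lambda>x y. g (x * s) y) t"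
    by (subst Rho_coset[OF g coact_mult[OF rep_coact(1), of "gen (s, 1)"]])
       (auto simp: qlin_flin qlin_gen Rho_def case_prod_unfold S_coact gen_in_coset)
  text \<open>Multiplicativity of the coaction is required for every representative of \<open>1 \<otimes> 1\<close>, in
    particular for one that contains a balancing relation.\<close>
  let ?u = "gen (j r, 1) - gen (1, zeta \<B> r) + gen (1, 1)"
  have "gen (ract T 1 r, 1) - gen (1, lR \<B> r 1) \<in> TB_rel \<B> T"
    unfolding TB_rel_def by (rule bal_rel_middle) auto
  then have "?u \<in> coact T 1"
    unfolding one mem_coset_iff by (simp add: lR_def j_def)
  from Rho_coset[OF g coact_mult[OF this rep_coact(1)]]
  have "Rho g t = Rho (\<lambda>x y. g (j r * x) y) t - Rho (\<lambda>x y. g x (zeta \<B> r * y)) t + Rho g t"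
    by (simp add: qlin_flin qlin_gen Rho_def case_prod_unfold qlin_add qlin_diff)
  then show "Rho (\<lambda>x y. g (j r * x) y) t = Rho (\<lambda>x y. g x (zeta \<B> r * y)) t" by simp
qed

lemma Rho_counit:
  assumes f: "Tlinear f"
  shows "Rho (\<lambda>x y. f (x * j (eps \<B> y))) t = f t"
proof -
  have "lin (smT T) (\<lambda>(t0, b). t0 * j (eps \<B> b)) (rep (coact T t)) = t"
    using comodule rep_coact(1)[of t] by (simp add: ract_eq)
  with lin_apply[OF f, of "\<lambda>(t0, b). t0 * j (eps \<B> b)" "rep (coact T t)"] show ?thesis
    by (simp add: Rho_def case_prod_unfold)
qed

text \<open>The two sides are the images of \<open>j r * s \<otimes> 1\<close> and \<open>s \<otimes> zeta r\<close> under the counit.\<close>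

lemma j_S_commute:
  assumes s: "s \<in> S"
  shows "j r * s = s * j r"
proof -
  let ?f = "\<lambda>t b. t * j (eps \<B> b)"
  have bal: "balanced (smT T) (whole (smT T)) (whole (smB \<B>)) UNIV (ract T) (lR \<B>) ?f"
    by (simp add: balanced_def distrib_left distrib_right eps_add j_add smT_mult eps_sm j_sm lR_def
        eps_zeta j_mult mult.assoc ract_eq)
  have one: "coact T 1 = gen (1, 1) +o TB_rel \<B> T" using comodule_algebra by simp
  let ?u = "gen (j r, 1) - gen (1, zeta \<B> r) + gen (1, 1)"
  have "gen (ract T 1 r, 1) - gen (1, lR \<B> r 1) \<in> TB_rel \<B> T"
    unfolding TB_rel_def by (rule bal_rel_middle) auto
  then have "?u \<in> coact T 1"
    unfolding one mem_coset_iff by (simp add: lR_def j_def)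
  from coact_mult[OF this, of "gen (s, 1)" s] s
  have *: "flin (\<lambda>(t0, b). flin (\<lambda>(t0', b'). gen (t0 * t0', b * b')) (gen (s, 1))) ?u +o TB_rel \<B> T
     = gen (s, 1) +o TB_rel \<B> T"
    by (simp add: S_coact gen_in_coset)
  have "lin (smT T) (\<lambda>(t, b). ?f t b) (flin (\<lambda>(t0, b). flin (\<lambda>(t0', b'). gen (t0 * t0', b * b')) (gen (s, 1))) ?u)
    = lin (smT T) (\<lambda>(t, b). ?f t b) (gen (s, 1))"
    by (rule lin_coset_eq[OF scaling_smT TB_rel_sub _ *], unfold TB_rel_def, rule lin_bal_rel[OF scaling_smT bal])
  then show ?thesis
    using eps_zeta[of 1 r]
    by (simp add: lin_gen[OF scaling_smT] lin_gen[OF scaling_fscale] lin_flin[OF scaling_smT]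
        lin_add[OF scaling_smT] lin_diff[OF scaling_smT])
qed

text \<open>The axiom lives in a tensor product whose second factor consists of cosets. The map
  \<open>?G\<close> evaluates \<open>g\<close> on a representative of that coset; balancedness of
  \<open>g\<close> in its last two arguments makes this independent of the choice, and balancedness
  in the first two makes \<open>?G\<close> respect the outer relations.\<close>

lemma coassoc:
  assumes TB: "\<And>z. TBbal (\<lambda>x y. g x y z)" and BB: "\<And>x. BBbal (g x)"
  shows "Rho (\<lambda>x y. D (\<lambda>y1 y2. g x y1 y2) y) t = Rho (\<lambda>x y. Rho (\<lambda>x0 x1. g x0 x1 y) x) t"
proof -
  let ?G = "\<lambda>x \<beta>. qlin (\<lambda>(y1, y2). g x y1 y2) (rep \<beta>)"
  have coset: "?G x (u +o BB_rel \<B>) = qlin (\<lambda>(y1, y2). g x y1 y2) u" for x u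
    by (simp add: qlin_rep_coset BBbal_zero[OF BB])
  have "balanced qscale (whole (smT T)) (BB \<B>) UNIV (ract T) (lR_BB \<B>) ?G"
    unfolding balanced_def BB_def tensor_def ball_carr_quot
    unfolding BB_rel_def[symmetric]
    using TB
    by (simp add: quot_sm coset coset_plus[OF BB_rel_sub] qlin_add qlin_fscale TBbal_def bilinear_def qlin_fun_add qlin_fun_scale
       case_prod_unfold lR_BB_def qlin_rep_induced[OF BB_rel_sub BBbal_zero[OF BB], unfolded case_prod_unfold]
      qlin_gen lR_def ract_eq coset[unfolded case_prod_unfold])
  from lin_bal_rel[OF scaling_qscale this]
  have z: "qlin (\<lambda>(x, \<beta>). ?G x \<beta>) n = 0" if "n \<in> XBB_rel \<B> (smT T) (ract T)" for n
    using that by (simp add: XBB_rel_def)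
  have "coassociative \<B> (smT T) (ract T) (coact T)" using comodule by simp
  then have *: "flin (\<lambda>(x0, b). flin (\<lambda>(y0, y1). gen (y0, gen (y1, b) +o BB_rel \<B>)) (rep (coact T x0))) (rep (coact T t))
          +o XBB_rel \<B> (smT T) (ract T) =
        flin (\<lambda>(x0, b). gen (x0, cop \<B> b)) (rep (coact T t)) +o XBB_rel \<B> (smT T) (ract T)"
    using rep_coact(1)[of t] by (simp add: coassociative_def)
  from qlin_coset_eq[OF _ z this]
  show ?thesis
    by (simp add: XBB_rel_def qlin_flin qlin_gen Rho_def D_def case_prod_unfold coset[unfolded case_prod_unfold])
qed

section \<open>The translation map\<close>

abbreviation TT_rel :: "('t \<times> 't \<Rightarrow>\<^sub>0 'k) set" where
  "TT_rel \<equiv> bal_rel (whole (smT T)) (whole (smT T)) S (*) (*)"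

lemma TTbal_zero: "TTbal g \<Longrightarrow> u \<in> TT_rel \<Longrightarrow> qlin (\<lambda>(x, y). g x y) u = 0"
  by (rule lin_bal_rel) (auto simp: balanced_def TTbal_def bilinear_def)

lemma TBbal_proj: "TBbal (\<lambda>x y. proj (TB_rel \<B> T) (gen (x, y)))"
  using balanced_proj[of _ "whole (smT T)" "whole (smB \<B>)" "UNIV :: 'r set" "ract T" "lR \<B>"]
  by (simp add: TB_rel_def balanced_def TBbal_def bilinear_def ract_eq lR_def)

text \<open>This is the pullback of \<open>k\<close> along the Galois map; it is balanced over
  \<open>S\<close> because the coaction is left \<open>S\<close>-linear.\<close>

lemma TTbal_can: "TBbal k \<Longrightarrow> TTbal (\<lambda>x y. Rho (\<lambda>a b. k (x * a) b) y)"
proof -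
  assume k: "TBbal k"
  have "TBbal (\<lambda>a b. k (x * a) b)" for x
    using k by (simp add: TBbal_def bilinear_def distrib_left smT_mult flip: mult.assoc)
  note this[simp]
  show ?thesis
    using k[unfolded TBbal_def bilinear_ext] unfolding TTbal_def bilinear_def
    by (simp add: Rho_add Rho_sm Rho_S_mult sum_fun_add sum_fun_scale distrib_right smT_mult mult.assoc)
qed

lemma can_coset:
  assumes k: "TBbal k"
  shows "qlin (\<lambda>(x, y). k x y) (rep (can \<B> T (w +o TT_rel))) =
    qlin (\<lambda>(x, y). Rho (\<lambda>a b. k (x * a) b) y) w"
proof -
  have "qlin (\<lambda>(x, y). k x y) (rep (can \<B> T (w +o TT_rel))) =
    qlin (\<lambda>(x, y). Rho (\<lambda>a b. k (x * a) b) y) (rep (w +o TT_rel))"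
    unfolding can_def
    by (subst qlin_rep_induced) (simp_all add: TBbal_zero[OF k], simp add: case_prod_unfold qlin_flin qlin_gen Rho_def)
  then show ?thesis
    by (simp add: qlin_rep_coset TTbal_zero[OF TTbal_can[OF k]])
qed

lemma can_carr: "can \<B> T X \<in> carr (TB \<B> T)"
  by (auto simp: can_def induced_def TB_def tensor_def TB_rel_def intro!: coset_in_carr)

text \<open>Balanced maps into the single type \<open>('t \<times> 'b, 'k) quo\<close> already
  separate points, because that type receives the universal one. This is why the type of values is
  fixed in the hypothesis, and in \<open>can_inj\<close> and \<open>Tau_eqI\<close>.\<close>

lemma TB_carr_eqI:
  assumes "X \<in> carr (TB \<B> T)" "Y \<in> carr (TB \<B> T)"
    and *: "\<And>k :: 't \<Rightarrow> 'b \<Rightarrow> ('t \<times> 'b, 'k) quo. TBbal k \<Longrightarrow>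
      qlin (\<lambda>(x, y). k x y) (rep X) = qlin (\<lambda>(x, y). k x y) (rep Y)"
  shows "X = Y"
proof -
  from assms(1,2) obtain u v where X: "X = u +o TB_rel \<B> T" and Y: "Y = v +o TB_rel \<B> T"
    by (auto simp: TB_def tensor_def TB_rel_def quot_sel)
  have "proj (TB_rel \<B> T) (rep X) = proj (TB_rel \<B> T) (rep Y)"
    using *[OF TBbal_proj] by (simp add: proj_eq_lin[of _ "rep _"] case_prod_unfold)
  then have "rep X +o TB_rel \<B> T = rep Y +o TB_rel \<B> T"
    by (simp add: proj_eq_iff coset_eq_iff[OF TB_rel_sub])
  then show ?thesis by (simp add: X Y coset_rep[OF TB_rel_sub])
qed

text \<open>The dual reading of injectivity of the Galois map: agreement under all maps pulled back
  along \<open>can\<close> forces agreement under all \<open>S\<close>-balanced maps.\<close>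

lemma can_inj:
  assumes w: "\<And>k :: 't \<Rightarrow> 'b \<Rightarrow> ('t \<times> 'b, 'k) quo. TBbal k \<Longrightarrow>
      qlin (\<lambda>(x, y). Rho (\<lambda>a b. k (x * a) b) y) w = qlin (\<lambda>(x, y). Rho (\<lambda>a b. k (x * a) b) y) w'"
    and g: "TTbal g"
  shows "qlin (\<lambda>(x, y). g x y) w = qlin (\<lambda>(x, y). g x y) w'"
proof -
  have "can \<B> T (w +o TT_rel) = can \<B> T (w' +o TT_rel)"
    by (rule TB_carr_eqI[OF can_carr can_carr]) (simp only: can_coset w)
  moreover have "v +o TT_rel \<in> carr (TT T S)" for v
    by (auto simp: TT_def tensor_def intro!: coset_in_carr)
  ultimately have "w +o TT_rel = w' +o TT_rel"
    using galois by (auto simp: Galois_extension_def bij_betw_def dest: inj_onD)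
  with g show ?thesis by (intro qlin_coset_eq[of TT_rel]) (auto intro: TTbal_zero)
qed

lemma translation: "translation \<B> T S b \<in> carr (TT T S)"
    "can \<B> T (translation \<B> T S b) = gen (1, b) +o TB_rel \<B> T"
proof -
  have "gen (1, b) +o TB_rel \<B> T \<in> can \<B> T ` carr (TT T S)"
    using galois
    by (auto simp: Galois_extension_def bij_betw_def TB_def tensor_def TB_rel_def intro!: coset_in_carr)
  then show "translation \<B> T S b \<in> carr (TT T S)"
    "can \<B> T (translation \<B> T S b) = gen (1, b) +o TB_rel \<B> T"
    unfolding translation_def by (rule inv_into_into, rule f_inv_into_f)
qed

text \<open>The defining equation \<open>b{-} b{+}[0] \<otimes> b{+}[1] = 1 \<otimes> b\<close> of
  the translation map, from which its other properties are derived.\<close>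

lemma Tau_Rho_one:
  assumes k: "TBbal k"
  shows "Tau (\<lambda>m p. Rho (\<lambda>a c. k (m * a) c) p) b = k 1 b"
proof -
  obtain u where u: "translation \<B> T S b = u +o TT_rel"
    using translation(1)[of b] by (auto simp: TT_def tensor_def quot_sel)
  have "Tau (\<lambda>m p. Rho (\<lambda>a c. k (m * a) c) p) b = qlin (\<lambda>(x, y). k x y) (rep (can \<B> T (u +o TT_rel)))"
    unfolding can_coset[OF k] Tau_def u
    by (simp add: qlin_rep_coset TTbal_zero[OF TTbal_can[OF k]])
  also have "\<dots> = k 1 b"
    using translation(2)[of b] by (simp add: u qlin_rep_coset TBbal_zero[OF k] qlin_gen)
  finally show ?thesis .
qed

lemma Tau_eqI:
  assumes "\<And>k :: 't \<Rightarrow> 'b \<Rightarrow> ('t \<times> 'b, 'k) quo. TBbal k \<Longrightarrow>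
      qlin (\<lambda>(x, y). Rho (\<lambda>a b. k (x * a) b) y) w = k 1 b"
    and "TTbal g"
  shows "Tau g b = qlin (\<lambda>(x, y). g x y) w"
  unfolding Tau_def
  by (rule can_inj[OF _ assms(2)]) (simp add: assms(1) Tau_Rho_one[unfolded Tau_def])

lemma TBbal_left_mult: "TBbal k \<Longrightarrow> TBbal (\<lambda>x y. k (t * x) y)"
  by (simp add: TBbal_def bilinear_def distrib_left smT_mult flip: mult.assoc)

text \<open>Right multiplication by \<open>s\<close> has to pass the factor \<open>j r\<close> of
  the \<open>R\<close>-action, which \<open>j_S_commute\<close> permits.\<close>

lemma TBbal_right_S: "TBbal k \<Longrightarrow> s \<in> S \<Longrightarrow> TBbal (\<lambda>x y. k (x * s) y)"
  by (simp add: TBbal_def bilinear_def distrib_right smT_mult mult.assoc j_S_commute)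
     (simp flip: mult.assoc)

lemma TBbal_xi: "TBbal k \<Longrightarrow> TBbal (\<lambda>x y. k x (y * xi \<B> r))"
  by (simp add: TBbal_def bilinear_def distrib_right smB_mult mult.assoc flip: xi_zeta)

lemma TBbal_left_multB: "TBbal k \<Longrightarrow> TBbal (\<lambda>x y. k x (b * y))"
  by (simp add: TBbal_def bilinear_def distrib_left smB_mult flip: mult.assoc)

text \<open>Multiplying two elements of the tensor product legwise is not \<open>R\<close>-balanced
  in general; it is here because the second one is a coaction, to which \<open>Rho_takeuchi\<close>
  applies.\<close>

lemma TBbal_prod:
  assumes k: "TBbal k"
  shows "TBbal (\<lambda>x y. Rho (\<lambda>a c. k (x * a) (y * c)) t)"
proof -
  have "Rho (\<lambda>a c. k (x * j r * a) (y * c)) t = Rho (\<lambda>a c. k (x * a) (y * zeta \<B> r * c)) t" for x y r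
    using Rho_takeuchi[of "\<lambda>a c. k (x * a) (y * c)" r t] TBbal_left_mult[OF TBbal_left_multB[OF k]]
    by (simp add: mult.assoc)
  with k show ?thesis
    by (simp add: TBbal_def bilinear_def sum_fun_add sum_fun_scale distrib_right smT_mult smB_mult)
qed

lemma TTbal_left_mult: "TTbal g \<Longrightarrow> TTbal (\<lambda>x y. g (t * x) y)"
  by (simp add: TTbal_def bilinear_def distrib_left smT_mult flip: mult.assoc)

lemma TTbal_right_mult: "TTbal g \<Longrightarrow> TTbal (\<lambda>x y. g x (y * t))"
  by (simp add: TTbal_def bilinear_def distrib_right smT_mult mult.assoc)

text \<open>Each identity is verified after applying the Galois map, where it reduces to
  \<open>Tau_Rho_one\<close> and the rules for the coaction, and is pulled back by injectivity. In
  \<open>Tau_S\<close> this says that \<open>b{-} \<otimes> b{+}\<close> commutes with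
  \<open>S\<close>.\<close>

lemma
  assumes g: "TTbal g"
  shows Tau_add: "Tau g (b + b') = Tau g b + Tau g b'"
    and Tau_sm: "Tau g (smB \<B> c b) = qscale c (Tau g b)"
    and Tau_one: "Tau g 1 = g 1 1"
    and Tau_xi: "Tau g (b * xi \<B> r) = Tau (\<lambda>m p. g m (p * j r)) b"
    and Tau_zeta: "Tau g (b * zeta \<B> r) = Tau (\<lambda>m p. g (j r * m) p) b"
    and Tau_S: "s \<in> S \<Longrightarrow> Tau (\<lambda>m p. g (s * m) p) b = Tau (\<lambda>m p. g m (p * s)) b"
    and Rho_Tau: "Rho (\<lambda>x y. Tau (\<lambda>m p. g (x * m) p) y) t = g 1 t"
    and Tau_prod: "Tau g (b * b') = Tau (\<lambda>m p. Tau (\<lambda>m' p'. g (m' * m) (p * p')) b') b"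
proof -
  let ?tr = "\<lambda>b. rep (translation \<B> T S b)"
  note Tau1 = Tau_Rho_one[unfolded Tau_def case_prod_unfold]
  show "Tau g (b + b') = Tau g b + Tau g b'"
    by (subst Tau_eqI[OF _ g, where w = "?tr b + ?tr b'"])
       (auto simp: qlin_add Tau_def Tau1 case_prod_unfold TBbal_def bilinear_def)
  show "Tau g (smB \<B> c b) = qscale c (Tau g b)"
    by (subst Tau_eqI[OF _ g, where w = "fscale c (?tr b)"])
       (auto simp: qlin_fscale Tau_def Tau1 case_prod_unfold TBbal_def bilinear_def)
  show "Tau g 1 = g 1 1"
    by (subst Tau_eqI[OF _ g, where w = "gen (1, 1)"])
       (auto simp: qlin_gen Rho_one)
  have "Tau (\<lambda>m p. Rho (\<lambda>a c. k (m * a) c) (p * j r)) b = k 1 (b * xi \<B> r)"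
    if k: "TBbal k" for k :: "'t \<Rightarrow> 'b \<Rightarrow> ('t \<times> 'b, 'k) quo"
    by (simp add: Rho_j TBbal_left_mult k Tau_Rho_one[OF TBbal_xi[OF k]])
  then show "Tau g (b * xi \<B> r) = Tau (\<lambda>m p. g m (p * j r)) b"
    by (subst Tau_eqI[OF _ g, where w = "flin (\<lambda>(m, p). gen (m, p * j r)) (?tr b)"])
       (auto simp: qlin_gen qlin_flin Tau_def case_prod_unfold)
  have "Tau (\<lambda>m p. Rho (\<lambda>a c. k (j r * m * a) c) p) b = k 1 (b * zeta \<B> r)"
    if k: "TBbal k" for k :: "'t \<Rightarrow> 'b \<Rightarrow> ('t \<times> 'b, 'k) quo"
  proof -
    have "k (j r) b = k 1 (b * zeta \<B> r)" using k by (metis TBbal_def mult_1)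
    then show ?thesis using Tau_Rho_one[OF TBbal_left_mult[OF k], of "j r" b] by (simp add: mult.assoc)
  qed
  then show "Tau g (b * zeta \<B> r) = Tau (\<lambda>m p. g (j r * m) p) b"
    by (subst Tau_eqI[OF _ g, where w = "flin (\<lambda>(m, p). gen (j r * m, p)) (?tr b)"])
       (auto simp: qlin_gen qlin_flin Tau_def case_prod_unfold)
  show "Tau (\<lambda>m p. g (s * m) p) b = Tau (\<lambda>m p. g m (p * s)) b" if s: "s \<in> S"
  proof -
    have "Tau (\<lambda>m p. Rho (\<lambda>a c. k (s * m * a) c) p) b = Tau (\<lambda>m p. Rho (\<lambda>a c. k (m * a) c) (p * s)) b"
      if k: "TBbal k" for k :: "'t \<Rightarrow> 'b \<Rightarrow> ('t \<times> 'b, 'k) quo"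
      using Tau_Rho_one[OF TBbal_left_mult[OF k], of s b] Tau_Rho_one[OF TBbal_right_S[OF k s], of b]
      by (simp add: mult.assoc Rho_mult_S[OF TBbal_left_mult[OF k] s])
    then show ?thesis
      using can_inj[OF _ g, where w = "flin (\<lambda>(m, p). gen (s * m, p)) (?tr b)"
          and w' = "flin (\<lambda>(m, p). gen (m, p * s)) (?tr b)"]
      by (simp add: qlin_gen qlin_flin Tau_def case_prod_unfold)
  qed
  have "Rho (\<lambda>x y. Tau (\<lambda>m p. Rho (\<lambda>a b. k (x * m * a) b) p) y) t = Rho (\<lambda>a b. k (1 * a) b) t"
    if k: "TBbal k" for k :: "'t \<Rightarrow> 'b \<Rightarrow> ('t \<times> 'b, 'k) quo"
    using Tau_Rho_one[OF TBbal_left_mult[OF k]] by (simp add: mult.assoc)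
  then show "Rho (\<lambda>x y. Tau (\<lambda>m p. g (x * m) p) y) t = g 1 t"
    using can_inj[OF _ g, where w = "flin (\<lambda>(x, y). flin (\<lambda>(m, p). gen (x * m, p)) (?tr y)) (rep (coact T t))"
        and w' = "gen (1, t)"]
    by (simp add: qlin_gen qlin_flin Tau_def Rho_def case_prod_unfold)
  have "Tau (\<lambda>m p. Tau (\<lambda>m' p'. Rho (\<lambda>a c. k (m' * m * a) c) (p * p')) b') b = k 1 (b * b')"
    if k: "TBbal k" for k :: "'t \<Rightarrow> 'b \<Rightarrow> ('t \<times> 'b, 'k) quo"
  proof -
    \<comment> \<open>The coaction of \<open>p * p'\<close> splits by \<open>Rho_mult\<close>. With
      the sum over \<open>b\<close> moved inside, \<open>m\<close> meets the coaction of
      \<open>p\<close> and cancels by \<open>Tau_Rho_one\<close>; the sum over \<open>b'\<close>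
      then cancels in the same way.\<close>
    have "Tau (\<lambda>m p. Tau (\<lambda>m' p'. Rho (\<lambda>a c. k (m' * m * a) c) (p * p')) b') b =
       Tau (\<lambda>m' p'. Tau (\<lambda>m p. Rho (\<lambda>a c. Rho (\<lambda>a' c'. k (m' * (m * a * a')) (c * c')) p') p) b) b'"
    proof -
      have "Rho (\<lambda>a c. k (m' * m * a) c) (p * p') =
          Rho (\<lambda>a c. Rho (\<lambda>a' c'. k (m' * (m * a * a')) (c * c')) p') p" for m m' p p'
        using Rho_mult[OF TBbal_left_mult[OF k], of "m' * m" p p'] by (simp add: mult.assoc)
      then show ?thesis by (subst Tau_Tau) (simp only:)
    qed
    also have "\<dots> = Tau (\<lambda>m' p'. Rho (\<lambda>a' c'. k (m' * a') (b * c')) p') b'"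
      by (simp add: Tau_Rho_one[OF TBbal_prod[OF TBbal_left_mult[OF k]]])
    also have "\<dots> = k 1 (b * b')"
      by (rule Tau_Rho_one[OF TBbal_left_multB[OF k]])
    finally show ?thesis .
  qed
  then show "Tau g (b * b') = Tau (\<lambda>m p. Tau (\<lambda>m' p'. g (m' * m) (p * p')) b') b"
    by (subst Tau_eqI[OF _ g, where w = "flin (\<lambda>(m, p). flin (\<lambda>(m', p'). gen (m' * m, p * p')) (?tr b')) (?tr b)"])
       (auto simp: qlin_gen qlin_flin Tau_def case_prod_unfold)
qed

text \<open>Write \<open>p = p[0] j (eps p[1])\<close>; then \<open>Tau_Rho_one\<close> replaces
  \<open>m p[0] \<otimes> p[1]\<close> by \<open>1 \<otimes> b\<close>.\<close>

lemma Tau_mult: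
  assumes f: "Tlinear f"
  shows "Tau (\<lambda>m p. f (m * p)) b = f (j (eps \<B> b))"
proof -
  have "Tlinear (\<lambda>x. f (m * x))" for m
    using f by (simp add: klinear_def distrib_left smT_mult)
  from Rho_counit[OF this]
  have "Tau (\<lambda>m p. f (m * p)) b = Tau (\<lambda>m p. Rho (\<lambda>a c. f (m * a * j (eps \<B> c))) p) b"
    by (simp add: mult.assoc)
  also have "\<dots> = f (1 * j (eps \<B> b))"
    by (rule Tau_Rho_one)
       (use f in \<open>simp add: TBbal_def bilinear_def klinear_def distrib_left distrib_right smT_mult
         eps_add eps_sm j_add j_sm eps_zeta j_mult mult.assoc\<close>)
  finally show ?thesis by simp
qed

text \<open>The pullback of \<open>g\<close> along the inverse
  \<open>t \<otimes> b -> t b{-} \<otimes> b{+}\<close> of the Galois map.\<close>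

lemma TBbal_Tau:
  assumes g: "TTbal g"
  shows "TBbal (\<lambda>x y. Tau (\<lambda>m p. g (x * m) p) y)"
proof -
  note g' = TTbal_left_mult[OF g]
  show ?thesis
    using g[unfolded TTbal_def bilinear_ext]
    by (simp add: TBbal_def bilinear_def Tau_add[OF g'] Tau_sm[OF g'] Tau_zeta[OF g'] mult.assoc sum_fun_add sum_fun_scale distrib_right smT_mult)
qed

text \<open>Replace \<open>1 \<otimes> b\<close> by \<open>m p[0] \<otimes> p[1]\<close> using
  \<open>Tau_Rho_one\<close>. Coassociativity turns the coproduct of \<open>p[1]\<close> into a
  second coaction, and then \<open>Rho_Tau\<close> cancels each of the two translation maps against
  a coaction.\<close>

lemma D_Tau_Tau:
  assumes g1: "\<And>z. TTbal (\<lambda>x y. g x y z)" and g2: "\<And>x. TTbal (g x)"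
  shows "D (\<lambda>b1 b2. Tau (\<lambda>m p. Tau (\<lambda>m' p'. g m (p * m') p') b2) b1) b = Tau (\<lambda>m p. g m 1 p) b"
proof -
  let ?L = "\<lambda>x y z. Tau (\<lambda>m p. Tau (\<lambda>m' p'. g (x * m) (p * m') p') z) y"
  have *: "g (x + x') y = (\<lambda>z. g x y z + g x' y z)" "g x (y + y') = (\<lambda>z. g x y z + g x y' z)"
    "g (smT T c x) y = (\<lambda>z. qscale c (g x y z))" "g x (smT T c y) = (\<lambda>z. qscale c (g x y z))"
    "s \<in> S \<Longrightarrow> g (x * s) y = g x (s * y)" for x x' y y' c s
    using g1 by (auto simp: fun_eq_iff TTbal_def bilinear_def)
  have G1: "TTbal (\<lambda>x y. Tau (\<lambda>m' p'. g x (y * m') p') z)" for z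
    using * by (simp add: TTbal_def bilinear_def sum_fun_add sum_fun_scale distrib_right smT_mult mult.assoc)
  have TB: "TBbal (\<lambda>x y. ?L x y z)" for z
    by (rule TBbal_Tau[OF G1])
  have G2: "TTbal (\<lambda>m' p'. g x (p * m') p')" for x p
    by (rule TTbal_left_mult[OF g2])
  have BB: "BBbal (?L x)" for x
    using Tau_add[OF TTbal_left_mult[OF G1]] Tau_sm[OF TTbal_left_mult[OF G1]]
      Tau_xi[OF TTbal_left_mult[OF G1]]
    by (simp add: BBbal_def bilinear_def Tau_add[OF G2] Tau_sm[OF G2] Tau_zeta[OF G2] sum_fun_add sum_fun_scale
        mult.assoc)
  have DL: "TBbal (\<lambda>x y. D (\<lambda>b1 b2. ?L x b1 b2) y)"
    using TB D_add[OF BB] D_sm[OF BB] D_zeta[OF BB]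
    by (simp add: TBbal_def bilinear_def sum_fun_add sum_fun_scale)
  have "D (\<lambda>b1 b2. Tau (\<lambda>m p. Tau (\<lambda>m' p'. g m (p * m') p') b2) b1) b = D (\<lambda>b1 b2. ?L 1 b1 b2) b"
    by simp
  also have "\<dots> = Tau (\<lambda>m p. Rho (\<lambda>a c. D (\<lambda>b1 b2. ?L (m * a) b1 b2) c) p) b"
    by (rule Tau_Rho_one[OF DL, symmetric])
  also have "\<dots> = Tau (\<lambda>m p. Rho (\<lambda>a c. Rho (\<lambda>x y. ?L (m * x) y c) a) p) b"
    by (subst coassoc[where g = "\<lambda>x. ?L (_ * x)"])
       (auto intro: TBbal_left_mult[OF TB] BB)
  also have "\<dots> = Tau (\<lambda>m p. Rho (\<lambda>a c. Tau (\<lambda>m' p'. g m (a * m') p') c) p) b"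
    using Rho_Tau[OF TTbal_left_mult[OF G1]] by (simp add: mult.assoc)
  also have "\<dots> = Tau (\<lambda>m p. g m 1 p) b"
    by (simp add: Rho_Tau[OF g2])
  finally show ?thesis .
qed

end

section \<open>Faces, degeneracies and rotations of lists\<close>

definition insert_one :: "nat \<Rightarrow> 't::one list \<Rightarrow> 't list" where
  "insert_one k ts = take (Suc k) ts @ 1 # drop (Suc k) ts"

definition rot :: "'t list \<Rightarrow> 't list" where
  "rot ts = last ts # butlast ts"

lemma length_mult_at: "length ts = Suc n \<Longrightarrow> 0 < n \<Longrightarrow> k \<le> n \<Longrightarrow> length (mult_at n k ts) = n"
  by (auto simp: mult_at_def)

lemma nth_mult_at:
  assumes "length ts = Suc n" "0 < n" "p < n"
  shows "k < n \<Longrightarrow> mult_at n k ts ! p =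
      (if p < k then ts ! p else if p = k then ts ! k * ts ! Suc k else ts ! Suc p)"
    and "mult_at n n ts ! p = (if p = 0 then ts ! n * ts ! 0 else ts ! p)"
proof -
  consider "p < k" | "p = k" | q where "p = Suc (k + q)" by (metis less_imp_Suc_add nat_neq_iff)
  then show "k < n \<Longrightarrow> mult_at n k ts ! p =
      (if p < k then ts ! p else if p = k then ts ! k * ts ! Suc k else ts ! Suc p)"
    using assms by cases (auto simp: mult_at_def nth_append)
  show "mult_at n n ts ! p = (if p = 0 then ts ! n * ts ! 0 else ts ! p)"
    using assms by (cases p) (auto simp: mult_at_def nth_butlast nth_tl)
qed

lemma length_insert_one: "length ts = l \<Longrightarrow> k < l \<Longrightarrow> length (insert_one k ts) = Suc l"
  by (simp add: insert_one_def)

lemma nth_insert_one: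
  assumes "length ts = l" "k < l" "p \<le> l"
  shows "insert_one k ts ! p = (if p \<le> k then ts ! p else if p = Suc k then 1 else ts ! (p - 1))"
proof -
  consider "p \<le> k" | "p = Suc k" | q where "p = Suc (Suc (k + q))"
    by (metis add_Suc less_imp_Suc_add not_less_eq_eq Suc_leI le_eq_less_or_eq)
  then show ?thesis using assms by cases (auto simp: insert_one_def nth_append)
qed

lemma length_rot: "length ts = Suc n \<Longrightarrow> length (rot ts) = Suc n"
  by (simp add: rot_def)

lemma nth_rot: "length ts = Suc n \<Longrightarrow> p \<le> n \<Longrightarrow> rot ts ! p = (if p = 0 then ts ! n else ts ! (p - 1))"
  by (cases p) (auto simp: rot_def nth_butlast last_conv_nth simp flip: length_0_conv)

lemma mult_at_update:
  assumes "length ts = Suc n" "0 < n" "i \<le> n"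
  shows "k < n \<Longrightarrow> mult_at n k (ts[i := x]) = (mult_at n k ts)[(if i \<le> k then i else i - 1) :=
       (if i = k then x * ts ! Suc k else if i = Suc k then ts ! k * x else x)]"
    and "mult_at n n (ts[i := x]) = (mult_at n n ts)[(if i = n then 0 else i) :=
       (if i = n then x * ts ! 0 else if i = 0 then ts ! n * x else x)]"
  by (rule nth_equalityI;
      use assms in \<open>auto simp: length_mult_at nth_mult_at nth_list_update split: if_splits\<close>)+

lemma insert_one_update:
  assumes "length ts = l" "k < l" "i < l"
  shows "insert_one k (ts[i := x]) = (insert_one k ts)[(if i \<le> k then i else Suc i) := x]"
proof -
  consider "i \<le> k" | q where "i = Suc (k + q)" by (metis less_imp_Suc_add not_le)
  then show ?thesis
    using assms by cases (auto simp: insert_one_def list_update_append list_update_beyond take_update_swap drop_update_swap)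
qed

lemma rot_update:
  assumes "length ts = Suc n" "i \<le> n"
  shows "rot (ts[i := x]) = (rot ts)[Suc i mod Suc n := x]"
proof (cases "i = n")
  case True
  then show ?thesis using assms by (simp add: rot_def last_list_update butlast_list_update flip: length_0_conv)
next
  case False
  then show ?thesis using assms by (simp add: rot_def last_list_update butlast_list_update flip: length_0_conv)
qed

lemma mult_at_mult_at:
  fixes ts :: "'a::monoid_mult list"
  assumes ts: "length ts = Suc (Suc (Suc n))" "j \<le> Suc (Suc n)" "i < j"
  shows "mult_at (Suc n) i (mult_at (Suc (Suc n)) j ts) = mult_at (Suc n) (j - 1) (mult_at (Suc (Suc n)) i ts)"
proof (rule nth_equalityI)
  fix p assume "p < length (mult_at (Suc n) i (mult_at (Suc (Suc n)) j ts))"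
  then have p: "p < Suc n" using ts by (simp add: length_mult_at)
  have len: "length (mult_at (Suc (Suc n)) k ts) = Suc (Suc n)" if "k \<le> Suc (Suc n)" for k
    using ts that by (simp add: length_mult_at)
  have inner: "mult_at (Suc (Suc n)) k ts ! q =
      (if q < k then ts ! q else if q = k then ts ! k * ts ! Suc k else ts ! Suc q)"
    if "k < Suc (Suc n)" "q < Suc (Suc n)" for k q
    using nth_mult_at(1)[OF ts(1) _ that(2,1)] by simp
  have last: "mult_at (Suc (Suc n)) (Suc (Suc n)) ts ! q =
      (if q = 0 then ts ! Suc (Suc n) * ts ! 0 else ts ! q)" if "q < Suc (Suc n)" for q
    using nth_mult_at(2)[OF ts(1) _ that] by simp
  obtain j' where j: "j = Suc j'" "i \<le> j'" "j' \<le> Suc n" using ts by (cases j) auto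
  \<comment> \<open>The face with top index multiplies around the end of the list. So the cases
    record which of the outer faces \<open>i\<close> and \<open>j'\<close> is the top one; the inner
    face \<open>j\<close> is the top one exactly when \<open>j'\<close> is.\<close>
  consider "j' = Suc n" "i = Suc n" | "j' = Suc n" "i < Suc n" | "j' < Suc n" by (use j in linarith)
  then show "mult_at (Suc n) i (mult_at (Suc (Suc n)) j ts) ! p =
      mult_at (Suc n) (j - 1) (mult_at (Suc (Suc n)) i ts) ! p"
  proof cases
    case 1
    show ?thesis unfolding j(1) 1 diff_Suc_1
      using p by (simp add: nth_mult_at(2)[OF len _ p] inner last mult.assoc)
  next
    case 2
    show ?thesis unfolding j(1) 2(1) diff_Suc_1
      using p 2(2) by (simp add: nth_mult_at(1)[OF len _ p] nth_mult_at(2)[OF len _ p] inner last mult.assoc)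
  next
    case 3
    consider "p < i" | "p = i" "p = j'" | "p = i" "p < j'" | "i < p" "p < j'" | "i < p" "p = j'" | "j' < p"
      using j(2) by linarith
    then show ?thesis
      unfolding j(1) diff_Suc_1
      by cases (use p 3 j(2) in \<open>simp_all add: nth_mult_at(1)[OF len] inner mult.assoc\<close>)
  qed
qed (use ts in \<open>simp add: length_mult_at\<close>)

lemma insert_one_insert_one:
  assumes ts: "length ts = Suc n" "j \<le> n" "i \<le> j"
  shows "insert_one i (insert_one j ts) = insert_one (Suc j) (insert_one i ts)"
  using ts by (auto simp: insert_one_def min_def drop_take Suc_diff_le)

lemma mult_at_insert_one:
  fixes ts :: "'a::monoid_mult list"
  assumes ts: "length ts = Suc n" "j \<le> n"
  shows "i = j \<or> i = Suc j \<Longrightarrow> mult_at (Suc n) i (insert_one j ts) = ts"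
    and "i < j \<Longrightarrow> mult_at (Suc n) i (insert_one j ts) = insert_one (j - 1) (mult_at n i ts)"
    and "Suc j < i \<Longrightarrow> i \<le> Suc n \<Longrightarrow> mult_at (Suc n) i (insert_one j ts) = insert_one j (mult_at n (i - 1) ts)"
proof -
  have len: "length (insert_one j ts) = Suc (Suc n)" using ts by (simp add: length_insert_one)
  have ins: "insert_one j ts ! q = (if q \<le> j then ts ! q else if q = Suc j then 1 else ts ! (q - 1))"
    if "q \<le> Suc n" for q
    by (rule nth_insert_one[of _ "Suc n"]) (use ts that in auto)
  show "mult_at (Suc n) i (insert_one j ts) = ts" if i: "i = j \<or> i = Suc j"
  proof (rule nth_equalityI)
    fix p assume "p < length (mult_at (Suc n) i (insert_one j ts))"
    then have p: "p < Suc n" using ts i by (subst (asm) length_mult_at[OF len]) auto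
    consider "i = j" | "i = Suc j" "i < Suc n" | "i = Suc n" "j = n" using i ts by linarith
    then show "mult_at (Suc n) i (insert_one j ts) ! p = ts ! p"
    proof cases
      case 3
      show ?thesis unfolding 3(1) using ts p by (subst nth_mult_at(2)[OF len]) (auto simp: ins[unfolded 3(2)] 3(2))
    qed (use ts p in \<open>auto simp: nth_mult_at[OF len] ins\<close>)
  qed (use ts i in \<open>subst length_mult_at[OF len], auto\<close>)
  show "mult_at (Suc n) i (insert_one j ts) = insert_one (j - 1) (mult_at n i ts)" if i: "i < j"
  proof (rule nth_equalityI)
    fix p assume "p < length (mult_at (Suc n) i (insert_one j ts))"
    then have p: "p < Suc n" using ts i by (subst (asm) length_mult_at[OF len]) auto
    have "insert_one (j - 1) (mult_at n i ts) ! p = (if p \<le> j - 1 then mult_at n i ts ! p else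
        if p = Suc (j - 1) then 1 else mult_at n i ts ! (p - 1))"
      by (rule nth_insert_one[of _ n]) (use ts p i length_mult_at[of ts n i] in auto)
    then show "mult_at (Suc n) i (insert_one j ts) ! p = insert_one (j - 1) (mult_at n i ts) ! p"
      using ts p i by (auto simp: nth_mult_at[OF len] ins nth_mult_at)
  qed (use ts i length_mult_at[of ts n i] in \<open>subst length_mult_at[OF len], auto simp: length_insert_one\<close>)
  show "mult_at (Suc n) i (insert_one j ts) = insert_one j (mult_at n (i - 1) ts)" if i: "Suc j < i" "i \<le> Suc n"
  proof (rule nth_equalityI)
    fix p assume "p < length (mult_at (Suc n) i (insert_one j ts))"
    then have p: "p < Suc n" using ts i by (subst (asm) length_mult_at[OF len]) auto
    have *: "insert_one j (mult_at n (i - 1) ts) ! p = (if p \<le> j then mult_at n (i - 1) ts ! p else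
        if p = Suc j then 1 else mult_at n (i - 1) ts ! (p - 1))"
      by (rule nth_insert_one[of _ n]) (use ts p i length_mult_at[of ts n "i - 1"] in auto)
    consider "i = Suc n" | k where "i = Suc k" "k < n" using i by (cases i) (auto simp: le_less)
    then show "mult_at (Suc n) i (insert_one j ts) ! p = insert_one j (mult_at n (i - 1) ts) ! p"
      unfolding * by cases (use ts p i in \<open>auto simp: nth_mult_at[OF len] ins nth_mult_at\<close>)
  qed (use ts i length_mult_at[of ts n "i - 1"] in \<open>subst length_mult_at[OF len], auto simp: length_insert_one\<close>)
qed

lemma mult_at_rot:
  assumes ts: "length ts = Suc (Suc n)"
  shows "mult_at (Suc n) 0 (rot ts) = mult_at (Suc n) (Suc n) ts"
    and "i \<in> {1..Suc n} \<Longrightarrow> mult_at (Suc n) i (rot ts) = rot (mult_at (Suc n) (i - 1) ts)"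
proof -
  have len: "length (rot ts) = Suc (Suc n)" using ts by (rule length_rot)
  have r: "rot ts ! q = (if q = 0 then ts ! Suc n else ts ! (q - 1))" if "q \<le> Suc n" for q
    by (rule nth_rot) (use ts that in auto)
  show "mult_at (Suc n) 0 (rot ts) = mult_at (Suc n) (Suc n) ts"
  proof (rule nth_equalityI)
    fix p assume "p < length (mult_at (Suc n) 0 (rot ts))"
    then have "p < Suc n" using length_mult_at[OF len, of 0] by simp
    then show "mult_at (Suc n) 0 (rot ts) ! p = mult_at (Suc n) (Suc n) ts ! p"
      using ts by (auto simp: nth_mult_at[OF len] nth_mult_at r)
  qed (use ts length_mult_at[OF len, of 0] length_mult_at[OF ts] in simp)
  show "mult_at (Suc n) i (rot ts) = rot (mult_at (Suc n) (i - 1) ts)" if i: "i \<in> {1..Suc n}"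
  proof (rule nth_equalityI)
    obtain k where k: "i = Suc k" "k \<le> n" using i by (cases i) auto
    have len': "length (mult_at (Suc n) k ts) = Suc n" using length_mult_at[OF ts] k by simp
    fix p assume "p < length (mult_at (Suc n) i (rot ts))"
    then have p: "p < Suc n" using length_mult_at[OF len, of i] i by simp
    have *: "rot (mult_at (Suc n) k ts) ! p = (if p = 0 then mult_at (Suc n) k ts ! n else mult_at (Suc n) k ts ! (p - 1))"
      by (rule nth_rot[OF len']) (use p in simp)
    consider "k = n" | "k < n" using k by linarith
    then show "mult_at (Suc n) i (rot ts) ! p = rot (mult_at (Suc n) (i - 1) ts) ! p"
      unfolding k(1) diff_Suc_1 *
      by cases (use ts p in \<open>auto simp: nth_mult_at[OF len] nth_mult_at r\<close>)
  qed (use ts i length_mult_at[OF len, of i] length_mult_at[OF ts, of "i - 1"] in \<open>auto simp: length_rot\<close>)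
qed

lemma insert_one_rot:
  assumes ts: "length ts = Suc n"
  shows "insert_one 0 (rot ts) = rot (rot (insert_one n ts))"
    and "i \<in> {1..n} \<Longrightarrow> insert_one i (rot ts) = rot (insert_one (i - 1) ts)"
proof -
  obtain us u where us: "ts = us @ [u]" "length us = n" using ts by (cases ts rule: rev_cases) auto
  then show "insert_one 0 (rot ts) = rot (rot (insert_one n ts))"
    by (simp add: insert_one_def rot_def butlast_append)
  show "insert_one i (rot ts) = rot (insert_one (i - 1) ts)" if "i \<in> {1..n}"
    using us that by (auto simp: insert_one_def rot_def butlast_append Suc_le_eq)
qed

text \<open>Since \<open>rot\<close> undoes \<open>rotate1\<close>, its powers undo rotations, and a
  rotation by the full length is the identity.\<close>

lemma funpow_rot: "length ts = Suc n \<Longrightarrow> (rot ^^ Suc n) ts = ts"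
proof -
  assume len: "length ts = Suc n"
  have rot1: "rot (rotate1 xs) = xs" if "xs \<noteq> []" for xs :: "'a list"
    using that by (cases xs) (auto simp: rot_def)
  have "(rot ^^ m) (rotate m ts) = ts" for m
  proof (induction m)
    case (Suc m)
    have "rot (rotate1 (rotate m ts)) = rotate m ts" by (rule rot1) (use len in auto)
    with Suc show ?case by (simp only: funpow_Suc_right o_apply rotate_Suc)
  qed simp
  from this[of "Suc n"] len show ?thesis by (simp add: rotate_id del: funpow.simps rotate_Suc)
qed

section \<open>Maps induced on quotients of formal sums\<close>

lemma induced_coset:
  fixes u :: "'x \<Rightarrow>\<^sub>0 'k::{comm_ring,comm_monoid_mult}"
  assumes "ksubmodule fscale N" "ksubmodule fscale N'" "\<And>n. n \<in> N \<Longrightarrow> flin g n \<in> N'"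
  shows "induced N' g (u +o N) = flin g u +o N'"
  unfolding induced_def using assms(3)[OF rep_diff[OF assms(1), of u]]
  by (intro coset_eqI[OF assms(2)]) (simp add: lin_diff)

lemma kmod_hom_induced:
  fixes N :: "('x \<Rightarrow>\<^sub>0 'k::{comm_ring,comm_monoid_mult}) set"
  assumes N: "ksubmodule fscale N" "ksubmodule fscale N'" "\<And>n. n \<in> N \<Longrightarrow> flin g n \<in> N'"
    and g: "\<And>u. u \<in> F \<Longrightarrow> flin g u \<in> F'"
  shows "kmod_hom (quot fscale F N) (quot fscale F' N') (induced N' g)"
  unfolding kmod_hom_def ball_carr_quot
  using g by (auto simp: induced_coset[OF N] coset_plus N(1,2) quot_sm lin_add lin_fscale coset_in_carr
      coset_plus[OF N(1)] coset_plus[OF N(2)])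

lemma flin_gen_comp: "flin (\<lambda>x. gen (q x)) (flin (\<lambda>x. gen (q' x)) u) = flin (\<lambda>x. gen (q (q' x))) u"
  by (simp add: lin_flin lin_gen)

lemma flin_gen_tuples:
  assumes "\<And>xs. length xs = l \<Longrightarrow> length (q xs) = l'" "u \<in> tuples l"
  shows "flin (\<lambda>xs. gen (q xs)) u \<in> tuples l'"
proof -
  have "Poly_Mapping.keys (flin (\<lambda>xs. gen (q xs)) u) \<subseteq> {xs. length xs = l'}"
    using assms by (intro keys_lin order_trans[OF keys_gen]) auto
  then show ?thesis by simp
qed

lemma flin_gen_cong:
  assumes "u \<in> tuples l" "\<And>xs. length xs = l \<Longrightarrow> q xs = q' xs"
  shows "flin (\<lambda>xs. gen (q xs)) u = flin (\<lambda>xs. gen (q' xs)) u"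
  using assms by (intro lin_cong) auto

section \<open>Balanced maps on the cyclic tensor powers of \<open>T\<close>\<close>

context hopf_galois
begin

definition Sbal :: "nat \<Rightarrow> ('t list \<Rightarrow> ('y, 'k) quo) \<Rightarrow> bool" where
  "Sbal l f \<longleftrightarrow> pow_balanced (smT T) S (*) (*) l f"

definition Cbal :: "nat \<Rightarrow> ('t list \<Rightarrow> ('y, 'k) quo) \<Rightarrow> bool" where
  "Cbal l f \<longleftrightarrow> Sbal l f \<and>
    (\<forall>ts s. length ts = l \<and> s \<in> S \<longrightarrow> f (ts[0 := s * ts ! 0]) = f (ts[l - 1 := ts ! (l - 1) * s]))"

lemma cyc_rel_sub [simp]: "ksubmodule fscale (cyc_rel T S l)"
  by (simp add: cyc_rel_def)

lemma cyc_rel_zero: "Cbal l f \<Longrightarrow> u \<in> cyc_rel T S l \<Longrightarrow> qlin f u = 0"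
  unfolding cyc_rel_def
  by (erule hull_lin_zero[OF scaling_qscale, rotated])
     (auto simp: Cbal_def Sbal_def qlin_pow_gens qlin_diff qlin_gen)

lemma Cbal_proj: "Cbal l (\<lambda>ts. proj (cyc_rel T S l) (gen ts))"
proof -
  let ?G = "pow_gens (smT T) S (*) (*) l \<union>
     {gen (ts[0 := s * ts ! 0]) - gen (ts[l - 1 := ts ! (l - 1) * s]) | ts s. length ts = l \<and> s \<in> S}"
  have 0: "proj (cyc_rel T S l) u = 0" if "u \<in> ?G" for u
  proof -
    have "u \<in> cyc_rel T S l" unfolding cyc_rel_def by (rule hull_inc) (rule that)
    then show ?thesis by (simp add: proj_eq_0_iff)
  qed
  have "Sbal l (\<lambda>ts. proj (cyc_rel T S l) (gen ts))"
    unfolding Sbal_def by (rule pow_balanced_if_zero) (simp add: 0 flip: proj_eq_lin)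
  moreover have "proj (cyc_rel T S l) (gen (ts[0 := s * ts ! 0]) - gen (ts[l - 1 := ts ! (l - 1) * s])) = 0"
    if "length ts = l" "s \<in> S" for ts s
    by (rule 0) (use that in blast)
  ultimately show ?thesis by (simp add: Cbal_def proj_diff)
qed

text \<open>With positions counted modulo \<open>n + 1\<close>, the relation closing the tensor
  product to a circle is balancing between the last and the first entry. This form is symmetric
  under rotation.\<close>

lemma Cbal_iff:
  "Cbal (Suc n) f \<longleftrightarrow> multilinear (smT T) (Suc n) f \<and>
    (\<forall>ts i s. length ts = Suc n \<and> i \<le> n \<and> s \<in> S \<longrightarrow>
      f (ts[i := ts ! i * s]) = f (ts[Suc i mod Suc n := s * ts ! (Suc i mod Suc n)]))"
  (is "_ \<longleftrightarrow> _ \<and> ?R")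
proof -
  have "?R \<longleftrightarrow> (\<forall>ts i s. length ts = Suc n \<and> Suc i < Suc n \<and> s \<in> S \<longrightarrow>
        f (ts[i := ts ! i * s]) = f (ts[Suc i := s * ts ! Suc i])) \<and>
    (\<forall>ts s. length ts = Suc n \<and> s \<in> S \<longrightarrow> f (ts[0 := s * ts ! 0]) = f (ts[n := ts ! n * s]))"
    (is "_ \<longleftrightarrow> ?A \<and> ?B")
  proof
    assume R: "?R"
    have ?A
    proof (intro allI impI)
      fix ts :: "'t list" and i s assume "length ts = Suc n \<and> Suc i < Suc n \<and> s \<in> S"
      with R[rule_format, of ts i s] show "f (ts[i := ts ! i * s]) = f (ts[Suc i := s * ts ! Suc i])" by simp
    qed
    moreover have ?B
      using R by (metis le_refl mod_self)
    ultimately show "?A \<and> ?B" by blast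
  next
    assume AB: "?A \<and> ?B"
    show ?R
    proof (intro allI impI)
      fix ts :: "'t list" and i s assume "length ts = Suc n \<and> i \<le> n \<and> s \<in> S"
      with AB show "f (ts[i := ts ! i * s]) = f (ts[Suc i mod Suc n := s * ts ! (Suc i mod Suc n)])"
        by (cases "i = n") auto
    qed
  qed
  then show ?thesis by (simp add: Cbal_def Sbal_def pow_balanced_def)
qed

lemma klinear_mult_right: "Tlinear f \<Longrightarrow> Tlinear (\<lambda>x. f (x * a))"
  and klinear_mult_left: "Tlinear f \<Longrightarrow> Tlinear (\<lambda>x. f (a * x))"
  by (simp_all add: klinear_def distrib_left distrib_right smT_mult)

lemma Cbal_rot:
  assumes f: "Cbal (Suc n) f"
  shows "Cbal (Suc n) (\<lambda>ts. f (rot ts))"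
  unfolding Cbal_iff
proof (intro conjI allI impI)
  show "multilinear (smT T) (Suc n) (\<lambda>ts. f (rot ts))"
    using f unfolding Cbal_iff multilinear_def
    by (auto simp: rot_update less_Suc_eq_le length_rot)
  fix ts :: "'t list" and i s assume *: "length ts = Suc n \<and> i \<le> n \<and> s \<in> S"
  \<comment> \<open>The position to which \<open>rot\<close> moves entry \<open>i\<close>. It is
    also the cyclic neighbour of \<open>i\<close>, so balancing at \<open>p\<close> in the rotated
    list is balancing at \<open>i\<close> in \<open>ts\<close>.\<close>
  define p where "p = Suc i mod Suc n"
  have p: "p \<le> n" by (simp add: p_def less_Suc_eq_le[symmetric])
  have nth: "rot ts ! (Suc q mod Suc n) = ts ! q" if "q \<le> n" for q
    using that * by (cases "q = n") (auto simp: nth_rot)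
  have "f (rot (ts[i := ts ! i * s])) = f ((rot ts)[p := rot ts ! p * s])"
    using * by (simp add: rot_update p_def nth)
  also have "\<dots> = f ((rot ts)[Suc p mod Suc n := s * rot ts ! (Suc p mod Suc n)])"
    using f p * unfolding Cbal_iff by (metis length_rot)
  also have "\<dots> = f (rot (ts[p := s * ts ! p]))"
    using * p by (simp add: rot_update nth)
  finally show "f (rot (ts[i := ts ! i * s])) =
    f (rot (ts[Suc i mod Suc n := s * ts ! (Suc i mod Suc n)]))" by (simp add: p_def)
qed

lemma Cbal_mult_at_less:
  assumes f: "Cbal n f" and k: "k < n"
  shows "Cbal (Suc n) (\<lambda>ts. f (mult_at n k ts))"
  unfolding Cbal_iff
proof (intro conjI allI impI)
  obtain m where n: "n = Suc m" using k by (cases n) auto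
  have mult: "Tlinear (\<lambda>x. f (us[p := x]))" if "length us = n" "p < n" for us p
    using f that unfolding n Cbal_iff multilinear_def by blast
  have bal: "f (us[p := us ! p * s]) = f (us[Suc p mod n := s * us ! (Suc p mod n)])"
    if "length us = n" "p < n" "s \<in> S" for us p s
    using f that unfolding n Cbal_iff by simp
  show "multilinear (smT T) (Suc n) (\<lambda>ts. f (mult_at n k ts))"
    unfolding multilinear_def
  proof (intro allI impI)
    fix ts :: "'t list" and i assume ts: "length ts = Suc n \<and> i < Suc n"
    let ?us = "mult_at n k ts"
    have us: "length ?us = n" using ts k by (simp add: length_mult_at)
    have upd: "mult_at n k (ts[i := x]) = ?us[(if i \<le> k then i else i - 1) :=
       (if i = k then x * ts ! Suc k else if i = Suc k then ts ! k * x else x)]" for x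
      by (rule mult_at_update(1)) (use ts k in auto)
    show "Tlinear (\<lambda>x. f (mult_at n k (ts[i := x])))"
      unfolding upd
      using ts k klinear_mult_right[OF mult[OF us], of i "ts ! Suc k"]
        klinear_mult_left[OF mult[OF us], of "i - 1" "ts ! k"] mult[OF us, of i] mult[OF us, of "i - 1"]
      by (cases "i = k"; cases "i = Suc k") auto
  qed
  fix ts :: "'t list" and i s assume ts: "length ts = Suc n \<and> i \<le> n \<and> s \<in> S"
  let ?us = "mult_at n k ts"
  have us: "length ?us = n" using ts k by (simp add: length_mult_at)
  have upd: "mult_at n k (ts[i := x]) = ?us[(if i \<le> k then i else i - 1) :=
     (if i = k then x * ts ! Suc k else if i = Suc k then ts ! k * x else x)]" if "i \<le> n" for x i
    by (rule mult_at_update(1)) (use ts k that in auto)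
  have nth: "?us ! p = (if p < k then ts ! p else if p = k then ts ! k * ts ! Suc k else ts ! Suc p)"
    if "p < n" for p
    by (rule nth_mult_at(1)) (use ts k that in auto)
  \<comment> \<open>For \<open>i = k\<close> both sides put \<open>s\<close> into the same product,
    and associativity suffices. Otherwise the balancing survives at a shifted position, which wraps
    around for \<open>i = n\<close>.\<close>
  consider "i = k" | "i < k" | "k < i" "i < n" | "i = n" "i \<noteq> k" using ts by linarith
  then show "f (mult_at n k (ts[i := ts ! i * s])) =
    f (mult_at n k (ts[Suc i mod Suc n := s * ts ! (Suc i mod Suc n)]))"
  proof cases
    case 1
    then show ?thesis using k by (simp add: upd mult.assoc)
  next
    case 2
    then show ?thesis using bal[OF us, of i s] ts k by (simp add: upd nth mult.assoc)
  next
    case 3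
    then obtain i' where "i = Suc i'" by (cases i) auto
    with 3 show ?thesis using bal[OF us, of i' s] ts k by (auto simp add: upd nth mult.assoc)
  next
    case 4
    have "?us ! (n - 1) = (if n = Suc k then ts ! k * ts ! Suc k else ts ! n)"
      using nth[of "n - 1"] 4 k by auto
    with 4 show ?thesis using bal[OF us, of "n - 1" s] ts k
      by (auto simp add: upd nth[of 0] mult.assoc)
  qed
qed

lemma Cbal_cong: "(\<And>ts. length ts = l \<Longrightarrow> f ts = g ts) \<Longrightarrow> Cbal l f \<longleftrightarrow> Cbal l g"
  unfolding Cbal_def Sbal_def pow_balanced_def multilinear_def klinear_def
  by (simp cong: conj_cong imp_cong)

text \<open>The last face is the face \<open>0\<close> after a rotation, so it needs no treatment of
  its own.\<close>

lemma Cbal_mult_at: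
  assumes f: "Cbal n f" and k: "k \<le> n" "0 < n"
  shows "Cbal (Suc n) (\<lambda>ts. f (mult_at n k ts))"
proof (cases "k < n")
  case False
  then have [simp]: "k = n" using k by simp
  have "Cbal (Suc n) (\<lambda>ts. f (mult_at n 0 (rot ts)))"
    by (rule Cbal_rot[OF Cbal_mult_at_less[OF f k(2)]])
  moreover have "mult_at n 0 (rot ts) = mult_at n n ts" if "length ts = Suc n" for ts :: "'t list"
    using mult_at_rot(1)[of ts "n - 1"] that k by simp
  ultimately show ?thesis by (subst Cbal_cong[where g = "\<lambda>ts. f (mult_at n 0 (rot ts))"]) auto
qed (rule Cbal_mult_at_less[OF f])

lemma Cbal_insert_one:
  assumes f: "Cbal (Suc (Suc n)) f" and k: "k \<le> n"
  shows "Cbal (Suc n) (\<lambda>ts. f (insert_one k ts))"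
  unfolding Cbal_iff
proof (intro conjI allI impI)
  show "multilinear (smT T) (Suc n) (\<lambda>ts. f (insert_one k ts))"
    using f k unfolding Cbal_iff multilinear_def
    by (auto simp: insert_one_update length_insert_one)
  fix ts :: "'t list" and i s assume ts: "length ts = Suc n \<and> i \<le> n \<and> s \<in> S"
  let ?us = "insert_one k ts"
  have us: "length ?us = Suc (Suc n)" using ts k by (simp add: length_insert_one)
  have bal: "f (?us[p := ?us ! p * s]) = f (?us[Suc p mod Suc (Suc n) := s * ?us ! (Suc p mod Suc (Suc n))])"
    if "p < Suc (Suc n)" for p
    using f that ts us unfolding Cbal_iff by simp
  have upd: "insert_one k (ts[i := x]) = ?us[(if i \<le> k then i else Suc i) := x]" if "i \<le> n" for x i
    by (rule insert_one_update) (use ts k that in auto)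
  have nth: "?us ! p = (if p \<le> k then ts ! p else if p = Suc k then 1 else ts ! (p - 1))"
    if "p \<le> Suc n" for p
    by (rule nth_insert_one) (use ts k that in auto)
  \<comment> \<open>For \<open>i = k\<close> the element \<open>s\<close> must cross the inserted
    \<open>1\<close>, which takes two balancings: \<open>t s \<otimes> 1 \<otimes> t' = t \<otimes>
    s \<otimes> t' = t \<otimes> 1 \<otimes> s t'\<close>. In the other cases one balancing is
    enough.\<close>
  consider "i = k" "i < n" | "i = k" "i = n" | "i < k" | "k < i" "i < n" | "i = n" "i \<noteq> k" using ts by linarith
  then show "f (insert_one k (ts[i := ts ! i * s])) =
    f (insert_one k (ts[Suc i mod Suc n := s * ts ! (Suc i mod Suc n)]))"
  proof cases
    case 1
    then show ?thesis using bal[of k] bal[of "Suc k"] k by (simp add: upd nth)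
  next
    case 2
    then show ?thesis using bal[of k] bal[of "Suc k"] k by (simp add: upd nth)
  next
    case 3
    then show ?thesis using bal[of i] k ts by (simp add: upd nth)
  next
    case 4
    then show ?thesis using bal[of "Suc i"] k ts by (simp add: upd nth)
  next
    case 5
    then show ?thesis using bal[of "Suc i"] k ts by (simp add: upd nth)
  qed
qed

section \<open>The cyclic module of the extension\<close>

text \<open>Applying the universal balanced map after \<open>q\<close> gives a balanced map again,
  which therefore kills \<open>u\<close>.\<close>

lemma cyc_rel_list_op:
  assumes "\<And>f :: 't list \<Rightarrow> ('t list, 'k) quo. Cbal l' f \<Longrightarrow> Cbal l (\<lambda>ts. f (q ts))" "u \<in> cyc_rel T S l"
  shows "flin (\<lambda>ts. gen (q ts)) u \<in> cyc_rel T S l'"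
  using cyc_rel_zero[OF assms(1)[OF Cbal_proj] assms(2)]
  by (simp add: proj_eq_0_iff flip: proj_flin)

lemma
  shows cyc_rel_mult_at: "k \<le> Suc n \<Longrightarrow> u \<in> cyc_rel T S (Suc (Suc n)) \<Longrightarrow>
      flin (\<lambda>ts. gen (mult_at (Suc n) k ts)) u \<in> cyc_rel T S (Suc n)"
    and cyc_rel_insert_one: "k \<le> n \<Longrightarrow> u \<in> cyc_rel T S (Suc n) \<Longrightarrow>
      flin (\<lambda>ts. gen (insert_one k ts)) u \<in> cyc_rel T S (Suc (Suc n))"
    and cyc_rel_rot: "u \<in> cyc_rel T S (Suc n) \<Longrightarrow> flin (\<lambda>ts. gen (rot ts)) u \<in> cyc_rel T S (Suc n)"
  by (rule cyc_rel_list_op[OF Cbal_mult_at]; simp) (rule cyc_rel_list_op[OF Cbal_insert_one] cyc_rel_list_op[OF Cbal_rot]; simp)+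

lemma Z_T_sel:
  "deg (Z_T T S) n = quot fscale (tuples (Suc n)) (cyc_rel T S (Suc n))"
  "face (Z_T T S) n k = induced (cyc_rel T S n) (\<lambda>ts. gen (mult_at n k ts))"
  "degen (Z_T T S) n k = induced (cyc_rel T S (Suc (Suc n))) (\<lambda>ts. gen (insert_one k ts))"
  "cyc (Z_T T S) n = induced (cyc_rel T S (Suc n)) (\<lambda>ts. gen (rot ts))"
  by (simp_all add: Z_T_def insert_one_def rot_def)

lemma Z_T_coset:
  "k \<le> Suc n \<Longrightarrow> face (Z_T T S) (Suc n) k (u +o cyc_rel T S (Suc (Suc n))) =
     flin (\<lambda>ts. gen (mult_at (Suc n) k ts)) u +o cyc_rel T S (Suc n)"
  "k \<le> n \<Longrightarrow> degen (Z_T T S) n k (u +o cyc_rel T S (Suc n)) =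
     flin (\<lambda>ts. gen (insert_one k ts)) u +o cyc_rel T S (Suc (Suc n))"
  "cyc (Z_T T S) n (u +o cyc_rel T S (Suc n)) = flin (\<lambda>ts. gen (rot ts)) u +o cyc_rel T S (Suc n)"
  unfolding Z_T_sel
  by ((rule induced_coset; simp add: cyc_rel_mult_at), (rule induced_coset; simp add: cyc_rel_insert_one),
      (rule induced_coset; simp add: cyc_rel_rot))

lemma Z_T_hom:
  "k \<le> Suc n \<Longrightarrow> kmod_hom (deg (Z_T T S) (Suc n)) (deg (Z_T T S) n) (face (Z_T T S) (Suc n) k)"
  "k \<le> n \<Longrightarrow> kmod_hom (deg (Z_T T S) n) (deg (Z_T T S) (Suc n)) (degen (Z_T T S) n k)"
  "kmod_hom (deg (Z_T T S) n) (deg (Z_T T S) n) (cyc (Z_T T S) n)"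
proof -
  show "k \<le> Suc n \<Longrightarrow> kmod_hom (deg (Z_T T S) (Suc n)) (deg (Z_T T S) n) (face (Z_T T S) (Suc n) k)"
    unfolding Z_T_sel by (intro kmod_hom_induced flin_gen_tuples)
      (auto simp: cyc_rel_mult_at length_mult_at)
  show "k \<le> n \<Longrightarrow> kmod_hom (deg (Z_T T S) n) (deg (Z_T T S) (Suc n)) (degen (Z_T T S) n k)"
    unfolding Z_T_sel by (intro kmod_hom_induced flin_gen_tuples)
      (auto simp: cyc_rel_insert_one length_insert_one)
  show "kmod_hom (deg (Z_T T S) n) (deg (Z_T T S) n) (cyc (Z_T T S) n)"
    unfolding Z_T_sel by (intro kmod_hom_induced flin_gen_tuples)
      (auto simp: cyc_rel_rot length_rot)
qed

lemma ball_Z_T: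
  "(\<forall>x\<in>carr (deg (Z_T T S) n). P x) \<longleftrightarrow> (\<forall>u\<in>tuples (Suc n). P (u +o cyc_rel T S (Suc n)))"
  unfolding Z_T_sel by (simp only: ball_carr_quot Suc_eq_plus1)

lemma cyc_Z_T_funpow:
  "(cyc (Z_T T S) n ^^ m) (u +o cyc_rel T S (Suc n)) = flin (\<lambda>ts. gen ((rot ^^ m) ts)) u +o cyc_rel T S (Suc n)"
  by (induction m) (simp_all add: flin_gen_id Z_T_coset flin_gen_comp)

lemma cyclic_module_Z_T: "cyclic_module (Z_T T S)"
proof -
  have "simplicial_identities (Z_T T S)"
    unfolding simplicial_identities_def ball_Z_T
  proof (intro conjI allI impI ballI)
    fix n j i and u :: "'t list \<Rightarrow>\<^sub>0 'k"
    assume "j \<le> Suc (Suc n)" "i < j" "u \<in> tuples (Suc (Suc (Suc n)))"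
    then show "face (Z_T T S) (Suc n) i (face (Z_T T S) (Suc (Suc n)) j (u +o cyc_rel T S (Suc (Suc (Suc n))))) =
      face (Z_T T S) (Suc n) (j - 1) (face (Z_T T S) (Suc (Suc n)) i (u +o cyc_rel T S (Suc (Suc (Suc n)))))"
      by (simp add: Z_T_coset flin_gen_comp) (subst flin_gen_cong[OF _ mult_at_mult_at], auto)
  next
    fix n j i and u :: "'t list \<Rightarrow>\<^sub>0 'k"
    assume "j \<le> n" "i \<le> j" "u \<in> tuples (Suc n)"
    then show "degen (Z_T T S) (Suc n) i (degen (Z_T T S) n j (u +o cyc_rel T S (Suc n))) =
       degen (Z_T T S) (Suc n) (Suc j) (degen (Z_T T S) n i (u +o cyc_rel T S (Suc n)))"
      by (simp add: Z_T_coset flin_gen_comp) (subst flin_gen_cong[OF _ insert_one_insert_one], auto)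
  next
    fix n j i and u :: "'t list \<Rightarrow>\<^sub>0 'k"
    assume *: "j \<le> n" "i < j" "u \<in> tuples (Suc n)"
    then obtain m where "n = Suc m" by (cases n) auto
    then show "face (Z_T T S) (Suc n) i (degen (Z_T T S) n j (u +o cyc_rel T S (Suc n))) =
       degen (Z_T T S) (n - 1) (j - 1) (face (Z_T T S) n i (u +o cyc_rel T S (Suc n)))"
      using * by (simp add: Z_T_coset flin_gen_comp) (subst flin_gen_cong[OF _ mult_at_insert_one(2)], auto)
  next
    fix n j i and u :: "'t list \<Rightarrow>\<^sub>0 'k"
    assume *: "j \<le> n" "i \<in> {j, Suc j}" "u \<in> tuples (Suc n)"
    have "flin (\<lambda>ts. gen (mult_at (Suc n) i (insert_one j ts))) u = flin (\<lambda>ts. gen ts) u"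
      by (rule flin_gen_cong[OF *(3) mult_at_insert_one(1)]) (use * in auto)
    then show "face (Z_T T S) (Suc n) i (degen (Z_T T S) n j (u +o cyc_rel T S (Suc n))) = u +o cyc_rel T S (Suc n)"
      using * by (auto simp: Z_T_coset flin_gen_comp flin_gen_id)
  next
    fix n j i and u :: "'t list \<Rightarrow>\<^sub>0 'k"
    assume *: "j \<le> n" "i \<le> Suc n" "Suc j < i" "u \<in> tuples (Suc n)"
    then obtain m where "n = Suc m" by (cases n) auto
    then show "face (Z_T T S) (Suc n) i (degen (Z_T T S) n j (u +o cyc_rel T S (Suc n))) =
       degen (Z_T T S) (n - 1) j (face (Z_T T S) n (i - 1) (u +o cyc_rel T S (Suc n)))"
      using * by (simp add: Z_T_coset flin_gen_comp) (subst flin_gen_cong[OF _ mult_at_insert_one(3)], auto)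
  qed
  moreover have "cyclic_identities (Z_T T S)"
    unfolding cyclic_identities_def ball_Z_T
  proof (intro conjI allI impI ballI)
    fix n i and u :: "'t list \<Rightarrow>\<^sub>0 'k"
    assume *: "i \<in> {1..Suc n}" "u \<in> tuples (Suc (Suc n))"
    then have "i - 1 \<le> Suc n" by auto
    with * show "face (Z_T T S) (Suc n) i (cyc (Z_T T S) (Suc n) (u +o cyc_rel T S (Suc (Suc n)))) =
       cyc (Z_T T S) n (face (Z_T T S) (Suc n) (i - 1) (u +o cyc_rel T S (Suc (Suc n))))"
      by (simp add: Z_T_coset flin_gen_comp) (subst flin_gen_cong[OF _ mult_at_rot(2)], auto)
  next
    fix n and u :: "'t list \<Rightarrow>\<^sub>0 'k"
    assume "u \<in> tuples (Suc (Suc n))"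
    then show "face (Z_T T S) (Suc n) 0 (cyc (Z_T T S) (Suc n) (u +o cyc_rel T S (Suc (Suc n)))) =
       face (Z_T T S) (Suc n) (Suc n) (u +o cyc_rel T S (Suc (Suc n)))"
      by (simp add: Z_T_coset flin_gen_comp) (subst flin_gen_cong[OF _ mult_at_rot(1)], auto)
  next
    fix n i and u :: "'t list \<Rightarrow>\<^sub>0 'k"
    assume *: "i \<in> {1..n}" "u \<in> tuples (Suc n)"
    then have "i - 1 \<le> n" by auto
    with * show "degen (Z_T T S) n i (cyc (Z_T T S) n (u +o cyc_rel T S (Suc n))) =
       cyc (Z_T T S) (Suc n) (degen (Z_T T S) n (i - 1) (u +o cyc_rel T S (Suc n)))"
      by (simp add: Z_T_coset flin_gen_comp) (subst flin_gen_cong[OF _ insert_one_rot(2)], auto)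
  next
    fix n and u :: "'t list \<Rightarrow>\<^sub>0 'k"
    assume "u \<in> tuples (Suc n)"
    then show "degen (Z_T T S) n 0 (cyc (Z_T T S) n (u +o cyc_rel T S (Suc n))) =
       cyc (Z_T T S) (Suc n) (cyc (Z_T T S) (Suc n) (degen (Z_T T S) n n (u +o cyc_rel T S (Suc n))))"
      by (simp add: Z_T_coset flin_gen_comp) (subst flin_gen_cong[OF _ insert_one_rot(1)], auto)
  next
    fix n and u :: "'t list \<Rightarrow>\<^sub>0 'k"
    assume u: "u \<in> tuples (Suc n)"
    have "flin (\<lambda>ts. gen ((rot ^^ Suc n) ts)) u = flin (\<lambda>ts. gen ts) u"
      by (rule flin_gen_cong[OF u funpow_rot])
    then show "(cyc (Z_T T S) n ^^ Suc n) (u +o cyc_rel T S (Suc n)) = u +o cyc_rel T S (Suc n)"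
      by (simp only: cyc_Z_T_funpow flin_gen_id)
  qed
  moreover have "kmodule (deg (Z_T T S) n)" for n
    unfolding Z_T_sel by (rule kmodule_quot) (simp_all add: ksubmodule_keys)
  ultimately show ?thesis
    by (simp add: cyclic_module_def Z_T_hom)
qed

end

section \<open>Balanced maps on lists by recursion on the length\<close>

lemma pow_balanced_tail:
  fixes f :: "'m::plus list \<Rightarrow> ('y, 'k::{comm_ring,comm_monoid_mult}) quo"
  assumes f: "pow_balanced sc A ra la (Suc l) f"
  shows "pow_balanced sc A ra la l (\<lambda>xs. f (x # xs))"
  unfolding pow_balanced_def multilinear_def
proof (intro conjI allI impI)
  fix xs :: "'m list" and i assume "length xs = l \<and> i < l"
  then show "klinear sc qscale (\<lambda>y. f (x # xs[i := y]))"
    using f[unfolded pow_balanced_def multilinear_def, THEN conjunct1, rule_format, of "x # xs" "Suc i"] by simp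
next
  fix xs :: "'m list" and i a assume "length xs = l \<and> Suc i < l \<and> a \<in> A"
  then show "f (x # xs[i := ra (xs ! i) a]) = f (x # xs[Suc i := la a (xs ! Suc i)])"
    using f[unfolded pow_balanced_def, THEN conjunct2, rule_format, of "x # xs" "Suc i" a] by simp
qed

lemma pow_balanced_head:
  "pow_balanced sc A ra la (Suc l) f \<Longrightarrow> length xs = l \<Longrightarrow> klinear sc qscale (\<lambda>x. f (x # xs))"
  unfolding pow_balanced_def multilinear_def
  \<comment> \<open>The head is overwritten by the update at position \<open>0\<close>, so its value
    is arbitrary.\<close>
  by (erule conjE, erule allE[of _ "undefined # xs"], erule allE[of _ 0]) simp

lemma pow_balanced_second:
  "pow_balanced sc A ra la (Suc (Suc l)) f \<Longrightarrow> length xs = l \<Longrightarrow> a \<in> A \<Longrightarrow>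
    f (ra x a # y # xs) = f (x # la a y # xs)"
  unfolding pow_balanced_def
  by (erule conjE, erule allE[of _ "x # y # xs"], erule allE[of _ 0], erule allE[of _ a]) simp

text \<open>Besides linearity in the head, the only condition not inherited from the tails is
  balancing between the first two entries.\<close>

lemma pow_balanced_ConsI:
  fixes f :: "'m::plus list \<Rightarrow> ('y, 'k::{comm_ring,comm_monoid_mult}) quo"
  assumes head: "\<And>xs. length xs = l \<Longrightarrow> klinear sc qscale (\<lambda>x. f (x # xs))"
    and tail: "\<And>x. pow_balanced sc A ra la l (\<lambda>xs. f (x # xs))"
    and second: "\<And>x y xs a. l = Suc (length xs) \<Longrightarrow> a \<in> A \<Longrightarrow> f (ra x a # y # xs) = f (x # la a y # xs)"
  shows "pow_balanced sc A ra la (Suc l) f"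
  unfolding pow_balanced_def multilinear_def
proof (intro conjI allI impI)
  fix xs :: "'m list" and i assume *: "length xs = Suc l \<and> i < Suc l"
  then obtain y ys where xs: "xs = y # ys" by (cases xs) auto
  show "klinear sc qscale (\<lambda>x. f (xs[i := x]))"
  proof (cases i)
    case 0
    then show ?thesis using head[of ys] * by (simp add: xs)
  next
    case (Suc i')
    then show ?thesis using tail[of y] * by (simp add: xs pow_balanced_def multilinear_def)
  qed
next
  fix xs :: "'m list" and i a assume *: "length xs = Suc l \<and> Suc i < Suc l \<and> a \<in> A"
  then obtain y z ys where xs: "xs = y # z # ys" by (cases xs; cases "tl xs") auto
  show "f (xs[i := ra (xs ! i) a]) = f (xs[Suc i := la a (xs ! Suc i)])"
  proof (cases i)
    case 0
    then show ?thesis using second[of ys a y z] * by (simp add: xs)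
  next
    case (Suc i')
    then show ?thesis
      using tail[of y, unfolded pow_balanced_def, THEN conjunct2, rule_format, of "z # ys" i' a] *
      by (simp add: xs)
  qed
qed

lemma pow_balanced_0: "pow_balanced sc A ra la 0 f"
  by (simp add: pow_balanced_def multilinear_def)

lemma pow_balanced_qlin:
  assumes "\<And>x. pow_balanced sc A ra la l (f x)"
  shows "pow_balanced sc A ra la l (\<lambda>xs. qlin (\<lambda>x. f x xs) u)"
  using assms unfolding pow_balanced_def multilinear_def klinear_def
  by (simp add: qlin_fun_add qlin_fun_scale)

lemma pow_balanced_cong:
  assumes "\<And>xs. length xs = l \<Longrightarrow> f xs = g xs" "pow_balanced sc A ra la l g"
  shows "pow_balanced sc A ra la l f"
  using assms unfolding pow_balanced_def multilinear_def klinear_def by simp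

text \<open>Linearity is asked for on the support only, because a balanced map on lists is
  controlled only at one length.\<close>

lemma klinear_qlin:
  assumes "\<And>z. z \<in> Poly_Mapping.keys u \<Longrightarrow> klinear sc qscale (\<lambda>x. f x z)"
  shows "klinear sc qscale (\<lambda>x. qlin (f x) u)"
proof -
  have "qlin (f (x + y)) u = qlin (\<lambda>z. f x z + f y z) u" "qlin (f (sc c x)) u = qlin (\<lambda>z. qscale c (f x z)) u" for c x y
    by (rule lin_cong, use assms in \<open>simp add: klinear_def\<close>)+
  then show ?thesis by (simp add: klinear_def qlin_fun_add qlin_fun_scale)
qed

context hopf_galois
begin

lemma Sbal_tail: "Sbal (Suc l) h \<Longrightarrow> Sbal l (\<lambda>ts. h (x # ts))"
  unfolding Sbal_def by (rule pow_balanced_tail)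

lemma Sbal_head: "Sbal (Suc l) h \<Longrightarrow> length ts = l \<Longrightarrow> Tlinear (\<lambda>x. h (x # ts))"
  unfolding Sbal_def by (rule pow_balanced_head)

lemma Sbal_second: "Sbal (Suc (Suc l)) h \<Longrightarrow> length ts = l \<Longrightarrow> s \<in> S \<Longrightarrow> h ((x * s) # y # ts) = h (x # (s * y) # ts)"
  unfolding Sbal_def by (rule pow_balanced_second)

definition Bbal :: "nat \<Rightarrow> ('b list \<Rightarrow> ('y, 'k) quo) \<Rightarrow> bool" where
  "Bbal l f \<longleftrightarrow> pow_balanced (smB \<B>) UNIV (rR \<B>) (lR \<B>) l f"

text \<open>Balancing multiplies the last entry by elements of \<open>S\<close> from the left only,
  so a right factor \<open>z\<close> does not interfere.\<close>

lemma Sbal_last_mult: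
  "Sbal (Suc l) h \<Longrightarrow> Sbal (Suc l) (\<lambda>ts. h (butlast ts @ [last ts * z]))"
proof (induction l arbitrary: h)
  case 0
  then show ?case
    unfolding Sbal_def
    by (intro pow_balanced_ConsI) (auto simp: pow_balanced_0 intro: klinear_mult_right dest: pow_balanced_head)
next
  case (Suc l)
  show ?case
    unfolding Sbal_def
  proof (rule pow_balanced_ConsI)
    fix ts :: "'t list" assume ts: "length ts = Suc l"
    then show "Tlinear (\<lambda>x. h (butlast (x # ts) @ [last (x # ts) * z]))"
      using Sbal_head[OF Suc.prems, of "butlast ts @ [last ts * z]"] by (cases ts) auto
  next
    fix x
    show "pow_balanced (smT T) S (*) (*) (Suc l) (\<lambda>xs. h (butlast (x # xs) @ [last (x # xs) * z]))"
      by (rule pow_balanced_cong[OF _ Suc.IH[OF Sbal_tail[OF Suc.prems, of x], unfolded Sbal_def]]) auto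
  next
    fix x y s and ts :: "'t list" assume "Suc l = Suc (length ts)" "s \<in> S"
    then show "h (butlast ((x * s) # y # ts) @ [last ((x * s) # y # ts) * z]) =
        h (butlast (x # (s * y) # ts) @ [last (x # (s * y) # ts) * z])"
      using Sbal_second[OF Suc.prems, of "if ts = [] then [] else butlast ts @ [last ts * z]"]
      by (cases ts) (auto simp: Sbal_second[OF Suc.prems] mult.assoc)
  qed
qed

section \<open>The comparison map\<close>

text \<open>For \<open>bs = [b\<^sub>0, \<dots>, b\<^sub>n]\<close>, \<open>chain bs t\<close> is
  \<open>t b\<^sub>0\<^bsup>{-}\<^esup> \<otimes> b\<^sub>0\<^bsup>{+}\<^esup> b\<^sub>1\<^bsup>{-}\<^esup> \<otimes> \<dots> \<otimes> b\<^sub>n\<^bsup>{+}\<^esup>\<close>.\<close>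

primrec chain :: "'b list \<Rightarrow> 't \<Rightarrow> ('t list \<Rightarrow>\<^sub>0 'k)" where
  "chain [] t = gen [t]"
| "chain (b # bs) t = flin (\<lambda>(m, p). flin (\<lambda>ts. gen ((t * m) # ts)) (chain bs p)) (rep (translation \<B> T S b))"

definition Chain :: "('t list \<Rightarrow> ('y, 'k) quo) \<Rightarrow> 'b list \<Rightarrow> 't \<Rightarrow> ('y, 'k) quo" where
  "Chain h bs t = qlin h (chain bs t)"

lemma Chain_Nil [simp]: "Chain h [] t = h [t]"
  by (simp add: Chain_def qlin_gen)

lemma Chain_Cons: "Chain h (b # bs) t = Tau (\<lambda>m p. Chain (\<lambda>ts. h ((t * m) # ts)) bs p) b"
  by (simp add: Chain_def Tau_def qlin_flin qlin_gen case_prod_unfold)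

lemma keys_chain: "Poly_Mapping.keys (chain bs t) \<subseteq> {ts. length ts = Suc (length bs)}"
proof (induction bs arbitrary: t)
  case (Cons b bs)
  show ?case
    using subsetD[OF Cons] by (auto intro!: keys_lin order_trans[OF keys_gen])
qed auto

lemma Chain_cong: "(\<And>ts. length ts = Suc (length bs) \<Longrightarrow> h ts = h' ts) \<Longrightarrow> Chain h bs t = Chain h' bs t"
  unfolding Chain_def using keys_chain[of bs t] by (intro lin_cong) auto

lemma klinear_Chain_fun:
  assumes "\<And>ts. length ts = Suc (length bs) \<Longrightarrow> klinear sc qscale (\<lambda>x. f x ts)"
  shows "klinear sc qscale (\<lambda>x. Chain (f x) bs t)"
  unfolding Chain_def using keys_chain[of bs t] by (intro klinear_qlin) (auto intro: assms)

lemma Chain_left: "Chain h bs (a * t) = Chain (\<lambda>ts. h ((a * hd ts) # tl ts)) bs t"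
  by (cases bs) (simp_all add: Chain_Cons mult.assoc)

lemma klinear_Tau: "(\<And>m p. klinear sc qscale (\<lambda>x. f x m p)) \<Longrightarrow> klinear sc qscale (\<lambda>x. Tau (f x) b)"
  unfolding Tau_def case_prod_unfold by (rule klinear_qlin)

lemma klinear_Chain:
  assumes h: "Sbal (Suc (length bs)) h"
  shows "Tlinear (Chain h bs)"
proof (cases bs)
  case Nil
  then show ?thesis using Sbal_head[OF h] by (auto simp: klinear_def)
next
  case (Cons b bs')
  have "Tlinear (\<lambda>t. Chain (\<lambda>ts. h ((t * m) # ts)) bs' p)" for m p
    by (rule klinear_Chain_fun) (use Cons in \<open>intro klinear_mult_right Sbal_head[OF h], simp\<close>)
  then show ?thesis
    unfolding Cons Chain_Cons by (rule klinear_Tau)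
qed

lemma TTbal_iff:
  "TTbal g \<longleftrightarrow> (\<forall>y. Tlinear (\<lambda>x. g x y)) \<and> (\<forall>x. Tlinear (g x)) \<and>
    (\<forall>x. \<forall>s\<in>S. \<forall>y. g (x * s) y = g x (s * y))"
  by (auto simp: TTbal_def bilinear_def klinear_def)

lemma TTbal_Chain:
  assumes h: "Sbal (Suc (Suc (length bs))) h"
  shows "TTbal (\<lambda>x p. Chain (\<lambda>ts. h (x # ts)) bs p)"
  unfolding TTbal_iff
proof (intro conjI allI ballI)
  fix p show "Tlinear (\<lambda>x. Chain (\<lambda>ts. h (x # ts)) bs p)"
    by (rule klinear_Chain_fun) (rule Sbal_head[OF h])
next
  fix x show "Tlinear (Chain (\<lambda>ts. h (x # ts)) bs)"
    by (rule klinear_Chain[OF Sbal_tail[OF h]])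
next
  fix x s p assume "s \<in> S"
  have "h ((x * s) # ts) = h (x # (s * hd ts) # tl ts)" if "length ts = Suc (length bs)" for ts
    using Sbal_second[OF h, of "tl ts" s x "hd ts"] that \<open>s \<in> S\<close> by (cases ts) auto
  then show "Chain (\<lambda>ts. h ((x * s) # ts)) bs p = Chain (\<lambda>ts. h (x # ts)) bs (s * p)"
    unfolding Chain_left by (rule Chain_cong)
qed

lemma Bbal_Tau: "(\<And>m p. Bbal l (\<lambda>bs. f m p bs)) \<Longrightarrow> Bbal l (\<lambda>bs. Tau (\<lambda>m p. f m p bs) b)"
  unfolding Tau_def case_prod_unfold Bbal_def by (rule pow_balanced_qlin)

text \<open>Balancing over \<open>R\<close> holds because \<open>xi r\<close> on one factor and
  \<open>zeta r\<close> on the next both place \<open>j r\<close> in the middle of the same entry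
  \<open>b{+} b'{-}\<close>, by \<open>Tau_xi\<close> and \<open>Tau_zeta\<close>.\<close>

lemma Bbal_Chain: "Sbal (Suc l) h \<Longrightarrow> Bbal l (\<lambda>bs. Chain h bs t)"
proof (induction l arbitrary: h t)
  case 0
  show ?case by (simp add: Bbal_def pow_balanced_0)
next
  case (Suc l)
  show ?case
    unfolding Bbal_def
  proof (rule pow_balanced_ConsI)
    fix bs :: "'b list" assume "length bs = l"
    then have "TTbal (\<lambda>x p. Chain (\<lambda>ts. h (x # ts)) bs p)"
      using Suc.prems TTbal_Chain by blast
    note g = TTbal_left_mult[OF this]
    show "Blinear (\<lambda>b. Chain h (b # bs) t)"
      by (simp add: Chain_Cons klinear_def Tau_add[OF g] Tau_sm[OF g])
  next
    fix b
    show "pow_balanced (smB \<B>) UNIV (rR \<B>) (lR \<B>) l (\<lambda>bs. Chain h (b # bs) t)"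
      unfolding Bbal_def[symmetric] Chain_Cons by (intro Bbal_Tau Suc.IH Sbal_tail Suc.prems)
  next
    fix b b' r and bs :: "'b list" assume l: "l = Suc (length bs)"
    have g: "TTbal (\<lambda>x p. Chain (\<lambda>ts. h (x # ts)) (b' # bs) p)"
      using Suc.prems by (intro TTbal_Chain) (simp add: l)
    have g': "TTbal (\<lambda>x p. Chain (\<lambda>ts. h (a # x # ts)) bs p)" for a
      using TTbal_Chain[OF Sbal_tail] Suc.prems by (simp add: l)
    have "Chain h (rR \<B> b r # b' # bs) t =
        Tau (\<lambda>m p. Tau (\<lambda>m' p'. Chain (\<lambda>ts. h (t * m # p * j r * m' # ts)) bs p') b') b"
      unfolding rR_def by (simp add: Chain_Cons Tau_xi[OF TTbal_left_mult[OF g], unfolded Chain_Cons])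
    also have "\<dots> = Chain h (b # lR \<B> r b' # bs) t"
      by (simp add: Chain_Cons lR_def Tau_zeta[OF TTbal_left_mult[OF g']] mult.assoc)
    finally show "Chain h (rR \<B> b r # b' # bs) t = Chain h (b # lR \<B> r b' # bs) t" .
  qed
qed

lemma Chain_zeta:
  assumes "Sbal (Suc (Suc (length bs))) h"
  shows "Chain h (b * zeta \<B> r # bs) t = Chain h (b # bs) (t * j r)"
  by (simp add: Chain_Cons Tau_zeta[OF TTbal_left_mult[OF TTbal_Chain[OF assms]]] mult.assoc)

lemma Chain_snoc:
  "Chain h (bs @ [b]) t = Tau (\<lambda>m p. Chain (\<lambda>ts. h (butlast ts @ [last ts * m, p])) bs t) b"
proof (induction bs arbitrary: h t)
  case (Cons c bs)
  have "Chain (\<lambda>ts. h (x # butlast ts @ [last ts * m, p])) bs t =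
      Chain (\<lambda>ts. h (butlast (x # ts) @ [last (x # ts) * m, p])) bs t" for x m p t
    by (rule Chain_cong) auto
  then show ?case
    by (simp add: Chain_Cons Cons del: butlast.simps last.simps) (rule Tau_Tau)
qed (simp add: Chain_Cons)

text \<open>By \<open>Tau_S\<close> the element \<open>s\<close> passes through one pair
  \<open>b{-} \<otimes> b{+}\<close> after the other, from the left end of the chain to the right
  end.\<close>

lemma Chain_right_S:
  "Sbal (Suc (length bs)) h \<Longrightarrow> s \<in> S \<Longrightarrow> Chain h bs (t * s) = Chain (\<lambda>ts. h (butlast ts @ [last ts * s])) bs t"
proof (induction bs arbitrary: h t)
  case (Cons b bs)
  have g: "TTbal (\<lambda>x p. Chain (\<lambda>ts. h (x # ts)) bs p)"
    using Cons.prems by (intro TTbal_Chain) simp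
  have "Chain h (b # bs) (t * s) = Tau (\<lambda>m p. Chain (\<lambda>ts. h (t * m # ts)) bs (p * s)) b"
    using Tau_S[OF TTbal_left_mult[OF g] Cons.prems(2), of t] by (simp add: Chain_Cons mult.assoc)
  also have "\<dots> = Tau (\<lambda>m p. Chain (\<lambda>ts. h (t * m # butlast ts @ [last ts * s])) bs p) b"
    using Cons.prems by (simp add: Cons.IH Sbal_tail)
  also have "(\<lambda>m p. Chain (\<lambda>ts. h (t * m # butlast ts @ [last ts * s])) bs p) =
      (\<lambda>m p. Chain (\<lambda>ts. h (butlast (t * m # ts) @ [last (t * m # ts) * s])) bs p)"
    by (intro ext Chain_cong) auto
  finally show ?case by (simp only: Chain_Cons)
qed simp


section \<open>The iterated coproduct and the diagonal action\<close>

definition Dn :: "nat \<Rightarrow> ('b list \<Rightarrow> ('y, 'k) quo) \<Rightarrow> 'b \<Rightarrow> ('y, 'k) quo" where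
  "Dn n f b = qlin f (rep (cop_iter \<B> n b))"

lemma Bpow_rel_sub [simp]: "ksubmodule fscale (Bpow_rel \<B> l)"
  by (simp add: Bpow_rel_def)

lemma Bbal_zero: "Bbal l f \<Longrightarrow> u \<in> Bpow_rel \<B> l \<Longrightarrow> qlin f u = 0"
  unfolding Bpow_rel_def Bbal_def
  by (erule hull_lin_zero[OF scaling_qscale, rotated]) (rule qlin_pow_gens)

lemma Bbal_tail: "Bbal (Suc l) f \<Longrightarrow> Bbal l (\<lambda>bs. f (x # bs))"
  unfolding Bbal_def by (rule pow_balanced_tail)

lemma Bbal_head: "Bbal (Suc l) f \<Longrightarrow> length bs = l \<Longrightarrow> Blinear (\<lambda>x. f (x # bs))"
  unfolding Bbal_def by (rule pow_balanced_head)

lemma Bbal_second: "Bbal (Suc (Suc l)) f \<Longrightarrow> length bs = l \<Longrightarrow>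
    f (x * xi \<B> r # y # bs) = f (x # y * zeta \<B> r # bs)"
  unfolding Bbal_def using pow_balanced_second[of _ UNIV "rR \<B>" "lR \<B>" l f bs r x y]
  by (simp add: rR_def lR_def)

lemma Bbal_cong: "(\<And>bs. length bs = l \<Longrightarrow> f bs = g bs) \<Longrightarrow> Bbal l g \<Longrightarrow> Bbal l f"
  unfolding Bbal_def by (rule pow_balanced_cong)

lemma Bbal_ConsI:
  assumes "\<And>bs. length bs = l \<Longrightarrow> Blinear (\<lambda>x. f (x # bs))"
    and "\<And>x. Bbal l (\<lambda>bs. f (x # bs))"
    and "\<And>x y bs r. l = Suc (length bs) \<Longrightarrow> f (x * xi \<B> r # y # bs) = f (x # y * zeta \<B> r # bs)"
  shows "Bbal (Suc l) f"
  using assms unfolding Bbal_def by (intro pow_balanced_ConsI) (auto simp: rR_def lR_def)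

lemma klinear_multB_left: "Blinear f \<Longrightarrow> Blinear (\<lambda>x. f (a * x))"
  and klinear_multB_right: "Blinear f \<Longrightarrow> Blinear (\<lambda>x. f (x * a))"
  by (simp_all add: klinear_def distrib_left distrib_right smB_mult)

text \<open>Both \<open>R\<close>-actions on \<B> are right multiplications, so left multiplication
  in every factor commutes with them.\<close>

lemma Bbal_map2: "Bbal (length bs) f \<Longrightarrow> Bbal (length bs) (\<lambda>cs. f (map2 (*) bs cs))"
proof (induction bs arbitrary: f)
  case Nil
  show ?case by (simp add: Bbal_def pow_balanced_0)
next
  case (Cons b bs)
  have f: "Bbal (Suc (length bs)) f" using Cons.prems by simp
  have "Bbal (Suc (length bs)) (\<lambda>cs. f (map2 (*) (b # bs) cs))"
  proof (rule Bbal_ConsI)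
    fix cs :: "'b list" assume "length cs = length bs"
    then show "Blinear (\<lambda>x. f (map2 (*) (b # bs) (x # cs)))"
      using klinear_multB_left[OF Bbal_head[OF f, of "map2 (*) bs cs"]] by simp
  next
    fix x show "Bbal (length bs) (\<lambda>cs. f (map2 (*) (b # bs) (x # cs)))"
      using Cons.IH[OF Bbal_tail[OF f]] by simp
  next
    fix x y r and cs :: "'b list" assume "length bs = Suc (length cs)"
    then show "f (map2 (*) (b # bs) (x * xi \<B> r # y # cs)) = f (map2 (*) (b # bs) (x # y * zeta \<B> r # cs))"
      using Bbal_second[of "length cs" f] f by (cases bs) (simp_all flip: mult.assoc)
  qed
  then show ?case by simp
qed

text \<open>Needed because \<open>rep\<close> chooses from the whole coset: it ensures that
  representatives of tensors of length \<open>l\<close> contain no lists of other lengths.\<close>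

lemma Bpow_rel_tuples: "Bpow_rel \<B> l \<subseteq> tuples l"
  unfolding Bpow_rel_def
proof (rule hull_minimal)
  have gen: "gen xs \<in> tuples l" if "length xs = l" for xs :: "'b list"
    using that keys_gen[of xs] by auto
  note sub = ksubmoduleD[OF ksubmodule_keys[of "{xs :: 'b list. length xs = l}"]]
  show "pow_gens (smB \<B>) UNIV (rR \<B>) (lR \<B>) l \<subseteq> tuples l"
  proof
    fix u :: "'b list \<Rightarrow>\<^sub>0 'k" assume "u \<in> pow_gens (smB \<B>) UNIV (rR \<B>) (lR \<B>) l"
    then consider
        xs i x y where "length xs = l" "u = gen (xs[i := x + y]) - gen (xs[i := x]) - gen (xs[i := y])"
      | xs i c x where "length xs = l" "u = gen (xs[i := smB \<B> c x]) - fscale c (gen (xs[i := x]))"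
      | xs i x y where "length xs = l" "u = gen (xs[i := x]) - gen (xs[Suc i := y])"
      unfolding pow_gens_def by blast
    then show "u \<in> tuples l"
      by (cases; simp only:; intro sub(4,5) gen; simp)
  qed
qed (rule ksubmodule_keys)

lemma rep_coset_tuples: "u \<in> tuples l \<Longrightarrow> rep (u +o Bpow_rel \<B> l) \<in> tuples l"
  using ksubmoduleD(2)[OF ksubmodule_keys[of "{xs :: 'b list. length xs = l}"], of u "rep (u +o Bpow_rel \<B> l) - u"]
    subsetD[OF Bpow_rel_tuples rep_diff[OF Bpow_rel_sub[of l], of u]] by simp

lemma cop_iter_coset: "\<exists>u\<in>tuples (Suc n). cop_iter \<B> n b = u +o Bpow_rel \<B> (Suc n)"
proof (induction n arbitrary: b)
  case 0
  show ?case using keys_gen[of "[b]"] by (intro bexI[of _ "gen [b]"]) (auto simp: One_nat_def)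
next
  case (Suc n)
  have k: "rep (cop_iter \<B> n b) \<in> tuples (Suc n)" for b
  proof -
    obtain u where "u \<in> tuples (Suc n)" "cop_iter \<B> n b = u +o Bpow_rel \<B> (Suc n)" using Suc[of b] by blast
    then show ?thesis using rep_coset_tuples[of u "Suc n"] by simp
  qed
  have "flin (\<lambda>(b1, b2). flin (\<lambda>bs. gen (b1 # bs)) (rep (cop_iter \<B> n b2))) (rep (cop \<B> b)) \<in> tuples (Suc (Suc n))"
    using subsetD[OF k[simplified]] by (auto intro!: keys_lin order_trans[OF keys_gen])
  then show ?case by (intro bexI) simp_all
qed

lemma keys_cop_iter: "Poly_Mapping.keys (rep (cop_iter \<B> n b)) \<subseteq> {bs. length bs = Suc n}"
proof -
  obtain u where "u \<in> tuples (Suc n)" "cop_iter \<B> n b = u +o Bpow_rel \<B> (Suc n)"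
    using cop_iter_coset by blast
  then show ?thesis using rep_coset_tuples[of u "Suc n"] by simp
qed

lemma Dn_cong: "(\<And>cs. length cs = Suc n \<Longrightarrow> f cs = g cs) \<Longrightarrow> Dn n f b = Dn n g b"
  unfolding Dn_def using keys_cop_iter[of n b] by (intro lin_cong) auto

lemma Dn_fun_add: "Dn n (\<lambda>cs. f cs + g cs) b = Dn n f b + Dn n g b"
  by (simp add: Dn_def qlin_fun_add)

lemma klinear_Dn_fun:
  assumes "\<And>cs. length cs = Suc n \<Longrightarrow> klinear sc qscale (\<lambda>x. f x cs)"
  shows "klinear sc qscale (\<lambda>x. Dn n (f x) b)"
  unfolding Dn_def using keys_cop_iter[of n b] by (intro klinear_qlin) (auto intro: assms)

lemma Dn_Tau: "Dn n (\<lambda>cs. Tau (\<lambda>m p. f m p cs) b') b = Tau (\<lambda>m p. Dn n (f m p) b) b'"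
  unfolding Dn_def Tau_def case_prod_unfold by (rule qlin_swap)

lemma Dn_0: "Bbal 1 f \<Longrightarrow> Dn 0 f b = f [b]"
  by (simp add: Dn_def qlin_rep_coset Bbal_zero qlin_gen)

lemma Dn_Suc: "Bbal (Suc (Suc n)) f \<Longrightarrow> Dn (Suc n) f b = D (\<lambda>b1 b2. Dn n (\<lambda>cs. f (b1 # cs)) b2) b"
  by (simp add: Dn_def D_def qlin_rep_coset Bbal_zero qlin_gen qlin_flin case_prod_unfold)

lemma BBbal_mult:
  assumes g: "BBbal g"
  shows "BBbal (\<lambda>x y. D (\<lambda>x' y'. g (x * x') (y * y')) b)"
proof -
  have g': "BBbal (\<lambda>x' y'. g (x * x') (y * y'))" for x y
    using g by (simp add: BBbal_def bilinear_def distrib_left smB_mult flip: mult.assoc)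
  show ?thesis
    using g[unfolded BBbal_def bilinear_ext] D_takeuchi[OF g']
    by (simp add: BBbal_def bilinear_def sum_fun_add sum_fun_scale distrib_right smB_mult mult.assoc)
qed

lemma BBbal_zeta: "BBbal g \<Longrightarrow> BBbal (\<lambda>x y. g (x * zeta \<B> r) y)"
  by (simp add: BBbal_def bilinear_def distrib_right smB_mult mult.assoc xi_zeta)
     (simp flip: mult.assoc)

text \<open>The coproduct of \<open>zeta r\<close> is \<open>zeta r \<otimes> 1\<close>, by
  \<open>D_zeta\<close> at \<open>1\<close>; the rest is multiplicativity.\<close>

lemma D_zeta_left:
  assumes g: "BBbal g"
  shows "D g (zeta \<B> r * b) = D (\<lambda>x y. g (zeta \<B> r * x) y) b"
  using D_mult[OF g, of "zeta \<B> r" b] D_zeta[OF BBbal_mult[OF g], of b 1 r]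
    D_one[OF BBbal_zeta[OF BBbal_mult[OF g]], of r b] by simp


text \<open>The two claims are intertwined: balancedness of \<open>Dn n'\<close> after splitting off
  one factor needs its behaviour under right multiplication by \<open>zeta r\<close>, while the
  recursion for \<open>Dn\<close> needs that balancedness. Hence linearity and both rules for
  \<open>zeta r\<close> are proved in one induction (\<open>all\<close>), whose passage to the next
  degree is \<open>BB\<close>.\<close>

lemma
  assumes f: "Bbal (Suc n) f"
  shows Dn_zeta_left: "Dn n f (zeta \<B> r * b) = Dn n (\<lambda>cs. f (zeta \<B> r * hd cs # tl cs)) b"
    and BBbal_Dn_aux: "n = Suc n' \<Longrightarrow> BBbal (\<lambda>x y. Dn n' (\<lambda>cs. f (x # cs)) y)"
proof -
  have Bbal_hd: "Bbal (Suc l) (\<lambda>cs. f (hd cs * zeta \<B> r # tl cs))"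
    "Bbal (Suc l) (\<lambda>cs. f (zeta \<B> r * hd cs # tl cs))" if f: "Bbal (Suc l) f" for l f r
  proof -
    have comm: "f (x * xi \<B> r' * zeta \<B> r # y # cs) = f (x * zeta \<B> r # y * zeta \<B> r' # cs)"
      if "l = Suc (length cs)" for x y r' cs
    proof -
      have "x * xi \<B> r' * zeta \<B> r = x * zeta \<B> r * xi \<B> r'" by (simp add: mult.assoc xi_zeta)
      then show ?thesis using Bbal_second[of "length cs" f] f that by simp
    qed
    have comm': "f (zeta \<B> r * (x * xi \<B> r') # y # cs) = f (zeta \<B> r * x # y * zeta \<B> r' # cs)"
      if "l = Suc (length cs)" for x y r' cs
      using Bbal_second[of "length cs" f] f that by (simp flip: mult.assoc)
    show "Bbal (Suc l) (\<lambda>cs. f (hd cs * zeta \<B> r # tl cs))"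
      by (rule Bbal_ConsI)
         (auto intro: klinear_multB_right Bbal_head[OF f] Bbal_tail[OF f] comm)
    show "Bbal (Suc l) (\<lambda>cs. f (zeta \<B> r * hd cs # tl cs))"
      by (rule Bbal_ConsI)
         (auto intro: klinear_multB_left Bbal_head[OF f] Bbal_tail[OF f] comm')
  qed
  have BB: "BBbal (\<lambda>x y. Dn n (\<lambda>cs. f (x # cs)) y)"
    if f: "Bbal (Suc (Suc n)) f"
      and add: "\<And>f :: 'b list \<Rightarrow> ('a, 'k) quo. Bbal (Suc n) f \<Longrightarrow> Blinear (Dn n f)"
      and zeta: "\<And>(f :: 'b list \<Rightarrow> ('a, 'k) quo) b r. Bbal (Suc n) f \<Longrightarrow> Dn n f (b * zeta \<B> r) = Dn n (\<lambda>cs. f (hd cs * zeta \<B> r # tl cs)) b"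
    for n and f :: "'b list \<Rightarrow> ('a, 'k) quo"
  proof -
    have "Blinear (\<lambda>x. Dn n (\<lambda>cs. f (x # cs)) y)" for y
      by (rule klinear_Dn_fun) (rule Bbal_head[OF f])
    moreover have "Blinear (Dn n (\<lambda>cs. f (x # cs)))" for x
      by (rule add[OF Bbal_tail[OF f]])
    moreover have "Dn n (\<lambda>cs. f (x * xi \<B> r # cs)) y = Dn n (\<lambda>cs. f (x # cs)) (y * zeta \<B> r)" for x y r
    proof -
      have "f (x * xi \<B> r # cs) = f (x # hd cs * zeta \<B> r # tl cs)" if "length cs = Suc n" for cs
        using Bbal_second[OF f, of "tl cs" x r "hd cs"] that by (cases cs) auto
      then show ?thesis unfolding zeta[OF Bbal_tail[OF f]] by (rule Dn_cong)
    qed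
    ultimately show ?thesis by (simp add: BBbal_def bilinear_def klinear_def)
  qed
  have all: "Blinear (Dn n f) \<and>
      (\<forall>b r. Dn n f (b * zeta \<B> r) = Dn n (\<lambda>cs. f (hd cs * zeta \<B> r # tl cs)) b) \<and>
      (\<forall>b r. Dn n f (zeta \<B> r * b) = Dn n (\<lambda>cs. f (zeta \<B> r * hd cs # tl cs)) b)"
    if "Bbal (Suc n) f" for n and f :: "'b list \<Rightarrow> ('a, 'k) quo"
    using that
  proof (induction n arbitrary: f)
    case 0
    then have 1: "Bbal 1 f" by simp
    show ?case
      using Bbal_head[OF 0, of "[]"] Bbal_hd[OF 0] by (simp add: Dn_0 Dn_0[OF 1] klinear_def)
  next
    case (Suc n)
    have g: "BBbal (\<lambda>x y. Dn n (\<lambda>cs. f (x # cs)) y)"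
      by (rule BB[OF Suc.prems]) (use Suc.IH in blast)+
    have "Blinear (Dn (Suc n) f)"
      by (simp add: Dn_Suc[OF Suc.prems] klinear_def D_add[OF g] D_sm[OF g])
    moreover have "Dn (Suc n) f (b * zeta \<B> r) = Dn (Suc n) (\<lambda>cs. f (hd cs * zeta \<B> r # tl cs)) b"
        "Dn (Suc n) f (zeta \<B> r * b) = Dn (Suc n) (\<lambda>cs. f (zeta \<B> r * hd cs # tl cs)) b" for b r
      by (simp_all add: Dn_Suc[OF Suc.prems] Dn_Suc[OF Bbal_hd(1)[OF Suc.prems]] Dn_Suc[OF Bbal_hd(2)[OF Suc.prems]]
          D_zeta[OF g] D_zeta_left[OF g])
    ultimately show ?case by blast
  qed
  from all[OF f] show "Dn n f (zeta \<B> r * b) = Dn n (\<lambda>cs. f (zeta \<B> r * hd cs # tl cs)) b" by blast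
  show "BBbal (\<lambda>x y. Dn n' (\<lambda>cs. f (x # cs)) y)" if "n = Suc n'"
    by (rule BB) (use f that all in blast)+
qed

lemma BBbal_Dn: "Bbal (Suc (Suc n)) f \<Longrightarrow> BBbal (\<lambda>x y. Dn n (\<lambda>cs. f (x # cs)) y)"
  by (rule BBbal_Dn_aux) auto

lemma klinear_D: "(\<And>m p. klinear sc qscale (\<lambda>x. f x m p)) \<Longrightarrow> klinear sc qscale (\<lambda>x. D (f x) b)"
  unfolding D_def case_prod_unfold by (rule klinear_qlin)

lemma Bbal_D: "(\<And>m p. Bbal l (\<lambda>bs. f m p bs)) \<Longrightarrow> Bbal l (\<lambda>bs. D (\<lambda>m p. f m p bs) b)"
  unfolding D_def case_prod_unfold Bbal_def by (rule pow_balanced_qlin)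

text \<open>The diagonal action is well defined on the tensor power over \<open>R\<close>:
  \<open>xi r\<close> on one factor becomes \<open>zeta r\<close> on the left of the second leg of
  the coproduct by \<open>D_takeuchi\<close>, and \<open>Dn_zeta_left\<close> carries it to the next
  factor.\<close>

lemma Bbal_diag: "Bbal (Suc n) f \<Longrightarrow> Bbal (Suc n) (\<lambda>bs. Dn n (\<lambda>cs. f (map2 (*) bs cs)) b)"
proof (induction n arbitrary: f b)
  case 0
  have map2: "Bbal 1 (\<lambda>cs. f (map2 (*) [x] cs))" for x
    using Bbal_map2[of "[x]" f] 0 by simp
  show ?case
  proof (rule Bbal_ConsI)
    fix bs :: "'b list" assume "length bs = 0"
    then show "Blinear (\<lambda>x. Dn 0 (\<lambda>cs. f (map2 (*) (x # bs) cs)) b)"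
      using klinear_multB_right[OF Bbal_head[OF 0, of "[]"]] by (simp add: Dn_0[OF map2])
  qed (simp_all add: Bbal_def pow_balanced_0)
next
  case (Suc n)
  have map2: "Bbal (Suc (Suc n)) (\<lambda>cs. f (map2 (*) bs cs))" if "length bs = Suc (Suc n)" for bs
    using Bbal_map2[of bs f] Suc.prems that by simp
  have Dn: "Dn (Suc n) (\<lambda>cs. f (map2 (*) (x # bs) cs)) b =
      D (\<lambda>b1 b2. Dn n (\<lambda>cs. f (x * b1 # map2 (*) bs cs)) b2) b" if "length bs = Suc n" for x bs
    using Dn_Suc[OF map2[of "x # bs"]] that by simp
  show ?case
  proof (rule Bbal_ConsI)
    fix bs :: "'b list" assume bs: "length bs = Suc n"
    show "Blinear (\<lambda>x. Dn (Suc n) (\<lambda>cs. f (map2 (*) (x # bs) cs)) b)"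
      unfolding Dn[OF bs]
      by (intro klinear_D klinear_Dn_fun klinear_multB_right Bbal_head[OF Suc.prems]) (simp add: bs)
  next
    fix x
    have "Bbal (Suc n) (\<lambda>bs. D (\<lambda>b1 b2. Dn n (\<lambda>cs. f (x * b1 # map2 (*) bs cs)) b2) b)"
      by (intro Bbal_D Suc.IH[of "\<lambda>cs. f (_ # cs)"] Bbal_tail Suc.prems)
    then show "Bbal (Suc n) (\<lambda>bs. Dn (Suc n) (\<lambda>cs. f (map2 (*) (x # bs) cs)) b)"
      by (rule Bbal_cong[rotated]) (rule Dn)
  next
    fix x y r and bs :: "'b list" assume bs: "Suc n = Suc (length bs)"
    then have len: "length (y # bs) = Suc n" "length (y * zeta \<B> r # bs) = Suc n" by simp_all
    let ?K = "\<lambda>u v. Dn n (\<lambda>cs. f (x * u # map2 (*) (y # bs) cs)) v"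
    have f: "Bbal (Suc (Suc n)) (\<lambda>cs. f (map2 (*) (x # y # bs) cs))" by (rule map2) (simp add: bs)
    have K: "BBbal ?K" using BBbal_Dn[OF f] by simp
    have "Dn (Suc n) (\<lambda>cs. f (map2 (*) (x * xi \<B> r # y # bs) cs)) b = D (\<lambda>b1 b2. ?K (xi \<B> r * b1) b2) b"
      by (simp only: Dn[OF len(1)] mult.assoc)
    also have "\<dots> = D (\<lambda>b1 b2. ?K b1 (zeta \<B> r * b2)) b"
      by (rule D_takeuchi[OF K])
    also have "\<dots> = D (\<lambda>b1 b2. Dn n (\<lambda>cs. f (x * b1 # map2 (*) (y * zeta \<B> r # bs) cs)) b2) b"
    proof -
      have "?K u (zeta \<B> r * v) = Dn n (\<lambda>cs. f (x * u # map2 (*) (y * zeta \<B> r # bs) cs)) v" for u v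
      proof -
        have tail: "Bbal (Suc n) (\<lambda>cs. f (x * u # map2 (*) (y # bs) cs))"
          using Bbal_tail[OF f, of u] by simp
        have "f (x * u # map2 (*) (y # bs) (zeta \<B> r * hd cs # tl cs)) = f (x * u # map2 (*) (y * zeta \<B> r # bs) cs)"
          if "length cs = Suc n" for cs
          using that by (cases cs) (simp_all add: mult.assoc)
        then show ?thesis unfolding Dn_zeta_left[OF tail] by (rule Dn_cong)
      qed
      then show ?thesis by simp
    qed
    also have "\<dots> = Dn (Suc n) (\<lambda>cs. f (map2 (*) (x # y * zeta \<B> r # bs) cs)) b"
      by (simp only: Dn[OF len(2)])
    finally show "Dn (Suc n) (\<lambda>cs. f (map2 (*) (x * xi \<B> r # y # bs) cs)) b =
        Dn (Suc n) (\<lambda>cs. f (map2 (*) (x # y * zeta \<B> r # bs) cs)) b" .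
  qed
qed

text \<open>The dual reading of surjectivity of \<vartheta>: the elements
  \<open>e f(1) \<otimes> f(2)\<close> generate, so a balanced map vanishing on them is
  zero.\<close>

lemma Hopf_surj:
  assumes g: "BBbal g" and 0: "\<And>e f. D (\<lambda>x y. g (e * x) y) f = 0"
  shows "g b b' = 0"
proof -
  have "gen (b, b') +o BB_rel \<B> \<in> Hopf_map \<B> ` carr (BBop \<B>)"
    using hopf by (auto simp: right_times_Hopf_def bij_betw_def BB_def tensor_def BB_rel_def intro!: coset_in_carr)
  then obtain X where X: "Hopf_map \<B> X = gen (b, b') +o BB_rel \<B>" by force
  have "g b b' = qlin (\<lambda>(x, y). g x y) (rep (Hopf_map \<B> X))"
    by (simp add: X qlin_rep_coset BBbal_zero[OF g] qlin_gen)
  also have "\<dots> = qlin (\<lambda>(e, f). D (\<lambda>x y. g (e * x) y) f) (rep X)"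
    unfolding Hopf_map_def
    by (subst qlin_rep_induced) (simp_all add: BBbal_zero[OF g], simp add: case_prod_unfold qlin_flin qlin_gen D_def)
  also have "\<dots> = 0" by (simp add: 0 case_prod_unfold lin_fun_zero)
  finally show ?thesis .
qed

text \<open>Iterated surjectivity of the Hopf map: the tensors whose last factor is \<open>1\<close> generate the
  tensor power of \<open>\<B>\<close> under the diagonal action.\<close>

lemma Bbal_eq_0:
  assumes "Bbal (Suc n) f" "\<And>c d. length c = n \<Longrightarrow> Dn n (\<lambda>cs. f (map2 (*) (c @ [1]) cs)) d = 0" "length bs = Suc n"
  shows "f bs = 0"
  using assms
proof (induction n arbitrary: f bs)
  case 0
  then obtain b where bs: "bs = [b]" by (cases bs) auto
  have "Bbal 1 (\<lambda>cs. f (map2 (*) [1] cs))" using Bbal_map2[of "[1]" f] 0 by simp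
  with 0(2)[of "[]" b] show ?case by (simp add: Dn_0 bs)
next
  case (Suc n)
  then obtain b bs' where bs: "bs = b # bs'" "length bs' = Suc n" by (cases bs) auto
  have f1: "Bbal (Suc (Suc n)) (\<lambda>cs. f (map2 (*) (1 # c @ [1]) cs))" if "length c = n" for c
    using Bbal_map2[of "1 # c @ [1]" f] Suc.prems(1) that by simp
  have "Dn n (\<lambda>cs. f (b # map2 (*) (c @ [1]) cs)) d = 0" if c: "length c = n" for c d
  proof (rule Hopf_surj[where g = "\<lambda>x y. Dn n (\<lambda>cs. f (x # map2 (*) (c @ [1]) cs)) y"])
    show "BBbal (\<lambda>x. Dn n (\<lambda>cs. f (x # map2 (*) (c @ [1]) cs)))"
      using BBbal_Dn[OF f1[OF c]] by simp
    fix e d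
    have "Bbal (Suc (Suc n)) (\<lambda>cs. f (map2 (*) ((e # c) @ [1]) cs))"
      using Bbal_map2[of "(e # c) @ [1]" f] Suc.prems(1) c by simp
    from Dn_Suc[OF this] Suc.prems(2)[of "e # c" d] c
    show "D (\<lambda>x y. Dn n (\<lambda>cs. f (e * x # map2 (*) (c @ [1]) cs)) y) d = 0" by simp
  qed
  from Suc.IH[OF Bbal_tail[OF Suc.prems(1)] this bs(2)] show ?case by (simp add: bs)
qed


section \<open>Compatibility of the comparison map\<close>

text \<open>Inserting \<open>b{-} \<otimes> b{+}\<close> between \<open>x\<close> and
  \<open>y\<close> preserves balancing over \<open>S\<close> because
  \<open>b{-} \<otimes> b{+}\<close> commutes with \<open>S\<close>.\<close>

lemma TTbal_sandwich:
  assumes g: "TTbal g"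
  shows "TTbal (\<lambda>x y. Tau (\<lambda>m p. g (t * (x * m)) (p * y)) b)"
proof -
  have g': "TTbal (\<lambda>m p. g (t * (x * m)) (p * y))" for x y
    using TTbal_left_mult[OF TTbal_right_mult[OF g], of "t * x" y] by (simp add: mult.assoc)
  show ?thesis
    using g[unfolded TTbal_def bilinear_ext] Tau_S[OF g']
    by (simp add: TTbal_def bilinear_def sum_fun_add sum_fun_scale distrib_left distrib_right smT_mult mult.assoc)
qed

lemma Sbal_last:
  assumes h: "Sbal (Suc l) h" and us: "length us = l"
  shows "Tlinear (\<lambda>z. h (us @ [z]))"
  using h[unfolded Sbal_def pow_balanced_def multilinear_def, THEN conjunct1, rule_format, of "us @ [undefined]" l] us
  by (simp add: list_update_append)

text \<open>In a product of chain factors with the legs of \<open>b\<close>, every inner entry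
  acquires \<open>b(i){+} b(i+1){-}\<close>. These cancel by \<open>D_Tau_Tau\<close>, so only
  \<open>b{-}\<close> at the left end and \<open>b{+}\<close> at the right end survive; this will
  become the action on \<open>T_S\<close>.\<close>

lemma Dn_Chain:
  "Sbal (Suc (Suc n)) h \<Longrightarrow> length bs = Suc n \<Longrightarrow>
    Dn n (\<lambda>cs. Chain h (map2 (*) bs cs) t) b = Tau (\<lambda>m p. Chain (\<lambda>ts. h (butlast ts @ [last ts * p])) bs (t * m)) b"
proof (induction n arbitrary: h bs t b)
  case 0
  then obtain b0 where bs: "bs = [b0]" by (cases bs) auto
  have "Bbal 1 (\<lambda>cs. Chain h (map2 (*) bs cs) t)"
    using Bbal_map2[of bs] Bbal_Chain[of 1 h t] 0 by (simp add: bs)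
  then have "Dn 0 (\<lambda>cs. Chain h (map2 (*) bs cs) t) b = Chain h [b0 * b] t"
    by (simp add: Dn_0 bs)
  also have "\<dots> = Tau (\<lambda>m p. Tau (\<lambda>m' p'. h [t * (m' * m), p * p']) b) b0"
    using Tau_prod[OF TTbal_left_mult[OF TTbal_Chain[of "[]" h]], of t b0 b] 0 by (simp add: Chain_Cons)
  also have "\<dots> = Tau (\<lambda>m p. Chain (\<lambda>ts. h (butlast ts @ [last ts * p])) bs (t * m)) b"
    by (subst Tau_Tau) (simp add: bs Chain_Cons mult.assoc)
  finally show ?case .
next
  case (Suc n)
  then obtain b0 bs' where bs: "bs = b0 # bs'" "length bs' = Suc n" by (cases bs) auto
  define G where "G z x p = Chain (\<lambda>ts. h (butlast (x # ts) @ [last (x # ts) * z])) bs' p" for z x p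
  have h': "Sbal (Suc (Suc (length bs'))) h" using Suc.prems bs by simp
  have G: "TTbal (G z)" for z
    unfolding G_def by (rule TTbal_Chain[OF Sbal_last_mult[OF h']])
  have G': "G z x p = Chain (\<lambda>ts. h (x # butlast ts @ [last ts * z])) bs' p" for z x p
    unfolding G_def by (rule Chain_cong) auto
  \<comment> \<open>The three slots receive the translation legs of the coproduct of
    \<open>b\<close>: \<open>x\<close> enters the first entry, \<open>y\<close> the entry between
    \<open>b0\<close> and \<open>bs'\<close>, and \<open>z\<close> the right end of the last
    entry.\<close>
  define g where "g x y z = Tau (\<lambda>m p. G z (t * (x * m)) (p * y)) b0" for x y z
  have g1: "TTbal (\<lambda>x y. g x y z)" for z
    unfolding g_def by (rule TTbal_sandwich[OF G])
  have g2: "TTbal (g x)" for x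
    unfolding TTbal_iff
  proof (intro conjI allI ballI)
    show "Tlinear (\<lambda>y. g x y z)" for z
      using g1[of z] by (simp add: TTbal_iff)
    show "Tlinear (g x y)" for y
      unfolding g_def G'
      using klinear_mult_left[OF Sbal_last[OF h', of "_ # butlast _"]]
      by (intro klinear_Tau klinear_Chain_fun) (simp add: bs)
    fix y s z assume s: "s \<in> S"
    have "G z a (q * s) = G (s * z) a q" for a q
      unfolding G' Chain_right_S[OF Sbal_last_mult[OF Sbal_tail[OF h', of a], of z] s] by (simp add: mult.assoc)
    then show "g x (y * s) z = g x y (s * z)"
      by (simp add: g_def flip: mult.assoc)
  qed
  have "Bbal (Suc (Suc n)) (\<lambda>cs. Chain h (map2 (*) bs cs) t)"
    using Bbal_map2[of bs] Bbal_Chain[of "Suc (Suc n)" h t] Suc.prems by simp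
  then have "Dn (Suc n) (\<lambda>cs. Chain h (map2 (*) bs cs) t) b =
    D (\<lambda>b1 b2. Dn n (\<lambda>cs. Chain h (b0 * b1 # map2 (*) bs' cs) t) b2) b"
    by (simp add: Dn_Suc bs)
  also have "\<dots> = D (\<lambda>b1 b2. Tau (\<lambda>m' p'. Tau (\<lambda>m'' p''. g m' (p' * m'') p'') b2) b1) b"
  proof -
    have "Dn n (\<lambda>cs. Chain h (b0 * b1 # map2 (*) bs' cs) t) b2 =
        Tau (\<lambda>m' p'. Tau (\<lambda>m'' p''. g m' (p' * m'') p'') b2) b1" for b1 b2
    proof -
      have prod: "Chain h (b0 * b1 # ds) t =
          Tau (\<lambda>m p. Tau (\<lambda>m' p'. Chain (\<lambda>ts. h (t * (m' * m) # ts)) ds (p * p')) b1) b0"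
        if "length ds = Suc n" for ds
        using Tau_prod[OF TTbal_left_mult[OF TTbal_Chain[of ds h]]] Suc.prems that by (simp add: Chain_Cons)
      have "Dn n (\<lambda>cs. Chain h (b0 * b1 # map2 (*) bs' cs) t) b2 =
          Dn n (\<lambda>cs. Tau (\<lambda>m p. Tau (\<lambda>m' p'. Chain (\<lambda>ts. h (t * (m' * m) # ts)) (map2 (*) bs' cs) (p * p')) b1) b0) b2"
        by (rule Dn_cong) (simp add: prod bs)
      also have "\<dots> = Tau (\<lambda>m p. Tau (\<lambda>m' p'.
          Dn n (\<lambda>cs. Chain (\<lambda>ts. h (t * (m' * m) # ts)) (map2 (*) bs' cs) (p * p')) b2) b1) b0"
        by (simp only: Dn_Tau)
      also have "\<dots> = Tau (\<lambda>m p. Tau (\<lambda>m' p'. Tau (\<lambda>m'' p''. G p'' (t * (m' * m)) (p * (p' * m''))) b2) b1) b0"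
        using Suc.IH[OF Sbal_tail[OF Suc.prems(1)] bs(2)] by (simp add: G' mult.assoc)
      also have "\<dots> = Tau (\<lambda>m' p'. Tau (\<lambda>m'' p''. g m' (p' * m'') p'') b2) b1"
        unfolding g_def by (subst Tau_Tau, subst (2) Tau_Tau, rule refl)
      finally show ?thesis .
    qed
    then show ?thesis by simp
  qed
  also have "\<dots> = Tau (\<lambda>m p. g m 1 p) b"
    by (rule D_Tau_Tau[OF g1 g2])
  also have "\<dots> = Tau (\<lambda>m p. Chain (\<lambda>ts. h (butlast ts @ [last ts * p])) bs (t * m)) b"
    by (simp add: g_def G_def bs Chain_Cons mult.assoc del: butlast.simps last.simps)
  finally show ?case .
qed

lemma mult_at_0: "mult_at (Suc n) 0 (x # y # ts) = (x * y) # ts"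
  by (simp add: mult_at_def)

lemma mult_at_Suc: "k < n \<Longrightarrow> mult_at (Suc n) (Suc k) (x # ts) = x # mult_at n k ts"
  by (simp add: mult_at_def)

text \<open>Multiplying entries \<open>k\<close> and \<open>k + 1\<close> of a chain brings together
  the two legs of \<open>b_k\<close>, and \<open>Tau_mult\<close> contracts them to
  \<open>j (eps b_k)\<close>, which is absorbed by a neighbouring factor.\<close>

lemma Chain_eps:
  "length bs = Suc n \<Longrightarrow> 0 < n \<Longrightarrow> k \<le> n \<Longrightarrow> Sbal (Suc n) h \<Longrightarrow>
    Chain h (eps_at \<B> n k bs) t = Chain (\<lambda>ts. h (mult_at (Suc n) k ts)) bs t"
proof (induction k arbitrary: n bs h t)
  case 0
  then obtain b0 b1 r where bs: "bs = b0 # b1 # r" by (cases bs; cases "tl bs") auto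
  then have r: "Suc (length r) = n" using 0 by simp
  have h: "Sbal (Suc (length (b1 # r))) h" using 0 r by simp
  have "Chain (\<lambda>ts. h (mult_at (Suc n) 0 ts)) bs t = Tau (\<lambda>m p. Chain h (b1 # r) (t * (m * p))) b0"
    by (simp add: bs Chain_Cons mult_at_0 mult.assoc)
  also have "\<dots> = Chain h (b1 # r) (t * j (eps \<B> b0))"
    by (rule Tau_mult) (rule klinear_mult_left[OF klinear_Chain[OF h]])
  also have "\<dots> = Chain h (eps_at \<B> n 0 bs) t"
    using h 0 by (simp add: Chain_zeta eps_at_def bs lR_def)
  finally show ?case by simp
next
  case (Suc k)
  then obtain b0 bs' m where bs: "bs = b0 # bs'" "length bs' = n" and n: "n = Suc m" by (cases bs; cases n) auto
  show ?case
  proof (cases m)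
    \<comment> \<open>Here \<open>bs\<close> has two entries and the last one is contracted. There
      is no following factor, so its counit goes to the preceding one through \<open>xi\<close>, as
      in the second branch of \<open>eps_at\<close>.\<close>
    case 0
    then obtain b1 where b1: "bs' = [b1]" and k: "k = 0" using bs n Suc.prems by (cases bs') auto
    have h: "Sbal 2 h" using Suc.prems n 0 by (simp add: numeral_2_eq_2)
    have add: "Tlinear (\<lambda>x. h [a, x])" for a
      using Sbal_last[of 1 h "[a]"] h by (simp add: numeral_2_eq_2)
    have "Chain (\<lambda>ts. h (mult_at (Suc n) (Suc k) ts)) bs t = Tau (\<lambda>m p. Tau (\<lambda>m' p'. h [t * m, p * (m' * p')]) b1) b0"
      by (simp add: bs b1 Chain_Cons n 0 k mult_at_0 mult_at_Suc mult.assoc)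
    also have "\<dots> = Tau (\<lambda>m p. h [t * m, p * j (eps \<B> b1)]) b0"
      by (simp add: Tau_mult[OF klinear_mult_left[OF add]])
    also have "\<dots> = Chain h (eps_at \<B> n (Suc k) bs) t"
      using Tau_xi[OF TTbal_left_mult[OF TTbal_Chain[of "[]" h]], of t b0 "eps \<B> b1"] h
      by (simp add: bs b1 n 0 k eps_at_def rR_def Chain_Cons numeral_2_eq_2)
    finally show ?thesis by simp
  next
    case (Suc m')
    have k: "k \<le> m" using Suc.prems n by simp
    have "eps_at \<B> n (Suc k) bs = b0 # eps_at \<B> m k bs'"
      using k by (auto simp: eps_at_def bs n Suc)
    moreover have "Chain (\<lambda>ts. h (t * m' # mult_at (Suc m) k ts)) bs' p =
       Chain (\<lambda>ts. h (mult_at (Suc n) (Suc k) (t * m' # ts))) bs' p" for m' p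
      using k by (intro Chain_cong) (simp add: mult_at_Suc n)
    ultimately show ?thesis
      using Suc.IH[OF _ _ k Sbal_tail] Suc.prems bs n Suc
      by (simp add: Chain_Cons)
  qed
qed

text \<open>By \<open>D_Tau_Tau\<close>, a coproduct at entry \<open>k\<close> leaves a
  \<open>1\<close> between the two translation legs of \<open>b_k\<close>. Earlier entries are
  independent of it and are peeled off with \<open>Tau_D\<close>.\<close>

lemma Chain_cop:
  "k < length bs \<Longrightarrow> Sbal (Suc (Suc (length bs))) h \<Longrightarrow>
    D (\<lambda>b1 b2. Chain h (take k bs @ b1 # b2 # drop (Suc k) bs) t) (bs ! k) = Chain (\<lambda>ts. h (insert_one k ts)) bs t"
proof (induction k arbitrary: bs h t)
  case 0
  then obtain b r where bs: "bs = b # r" by (cases bs) auto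
  define g where "g x y z = Chain (\<lambda>ts. h (t * x # y # ts)) r z" for x y z
  have g2: "TTbal (g x)" for x
    unfolding g_def using 0 by (intro TTbal_Chain[OF Sbal_tail]) (simp add: bs)
  have h: "Sbal (Suc (Suc (Suc (length r)))) h" using 0 by (simp add: bs)
  have g1: "TTbal (\<lambda>x y. g x y z)" for z
    unfolding TTbal_iff
  proof (intro conjI allI ballI)
    show "Tlinear (\<lambda>x. g x y z)" for y
      unfolding g_def using h by (intro klinear_Chain_fun klinear_mult_left Sbal_head[OF h]) simp
    show "Tlinear (\<lambda>y. g x y z)" for x
      using g2[of x] by (simp add: TTbal_iff)
    show "g (x * s) y z = g x (s * y) z" if "s \<in> S" for x s y
      unfolding g_def using that by (intro Chain_cong) (simp add: Sbal_second[OF h] flip: mult.assoc)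
  qed
  show ?case
    using D_Tau_Tau[OF g1 g2, of b] by (simp add: bs Chain_Cons g_def insert_one_def)
next
  case (Suc k)
  then obtain b r where bs: "bs = b # r" by (cases bs) auto
  have "D (\<lambda>b1 b2. Chain h (take (Suc k) bs @ b1 # b2 # drop (Suc (Suc k)) bs) t) (bs ! Suc k) =
     Tau (\<lambda>m p. D (\<lambda>b1 b2. Chain (\<lambda>ts. h (t * m # ts)) (take k r @ b1 # b2 # drop (Suc k) r) p) (r ! k)) b"
    by (simp add: bs Chain_Cons Tau_D)
  also have "\<dots> = Tau (\<lambda>m p. Chain (\<lambda>ts. h (t * m # insert_one k ts)) r p) b"
    using Suc.prems by (subst Suc.IH) (auto simp: bs intro: Sbal_tail)
  also have "\<dots> = Chain (\<lambda>ts. h (insert_one (Suc k) ts)) bs t"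
    by (simp add: bs Chain_Cons insert_one_def)
  finally show ?case .
qed

text \<open>Folding the last entry of a chain into its first one gives
  \<open>b\<^sub>n\<^bsup>{+}\<^esup> t b\<^sub>0\<^bsup>{-}\<^esup> \<otimes> b\<^sub>0\<^bsup>{+}\<^esup> b\<^sub>1\<^bsup>{-}\<^esup> \<otimes> \<dots>\<close>; this is a face map, so its compatibility with the other
  structure maps is contained in the simplicial and cyclic identities.\<close>

abbreviation wrap :: "nat \<Rightarrow> 't list \<Rightarrow> 't list" where
  "wrap n \<equiv> mult_at (Suc n) (Suc n)"

lemma wrap_Cons: "length us = Suc n \<Longrightarrow> wrap n (x # us) = (last us * x) # butlast us"
  by (auto simp: mult_at_def last_conv_nth simp flip: length_0_conv)

text \<open>By \<open>Tau_prod\<close>, \<open>x[0] (b x[1]){-} \<otimes> (b x[1]){+}\<close> is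
  \<open>x[0] x[1]{-} b{-} \<otimes> b{+} x[1]{+}\<close>, and \<open>Rho_Tau\<close> reduces it to
  \<open>b{-} \<otimes> b{+} x\<close>. After wrapping, this is the chain with \<open>b\<close> at
  the other end, rotated once.\<close>

lemma Chain_rho:
  assumes h: "Sbal (Suc (Suc n)) (\<lambda>ts. k (wrap n ts))" and bs: "length bs = n"
  shows "Rho (\<lambda>x0 x1. Chain (\<lambda>ts. k (wrap n ts)) (b * x1 # bs) x0) x =
    Chain (\<lambda>ts. k (rot (wrap n ts))) (bs @ [b]) x"
proof -
  let ?G = "\<lambda>x p. Chain (\<lambda>ts. k (wrap n (x # ts))) bs p"
  have G: "TTbal ?G"
    using TTbal_Chain[of bs] h bs by simp
  have "Rho (\<lambda>x0 x1. Chain (\<lambda>ts. k (wrap n ts)) (b * x1 # bs) x0) x =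
     Rho (\<lambda>x0 x1. Tau (\<lambda>m p. Tau (\<lambda>m' p'. ?G (x0 * (m' * m)) (p * p')) x1) b) x"
    by (simp add: Chain_Cons Tau_prod[OF TTbal_left_mult[OF G]])
  also have "\<dots> = Rho (\<lambda>x0 x1. Tau (\<lambda>m' p'. Tau (\<lambda>m p. ?G (1 * ((x0 * m') * m)) (p * p')) b) x1) x"
    by (subst Tau_Tau) (simp add: mult.assoc)
  also have "\<dots> = Tau (\<lambda>m p. ?G (1 * (1 * m)) (p * x)) b"
    by (rule Rho_Tau[OF TTbal_sandwich[OF G]])
  also have "\<dots> = Tau (\<lambda>m p. Chain (\<lambda>ts. k (rot (wrap n (butlast ts @ [last ts * m, p])))) bs x) b"
  proof -
    have "Chain (\<lambda>ts. k (wrap n (m # ts))) bs (p * x) = Chain (\<lambda>ts. k (rot (wrap n (butlast ts @ [last ts * m, p])))) bs x"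
      for m p
      unfolding Chain_left
    proof (rule Chain_cong)
      fix ts :: "'t list" assume ts: "length ts = Suc (length bs)"
      then obtain t us where "ts = t # us" by (cases ts) auto
      with ts bs show "k (wrap n (m # p * hd ts # tl ts)) = k (rot (wrap n (butlast ts @ [last ts * m, p])))"
        by (cases us rule: rev_cases) (auto simp: wrap_Cons rot_def mult.assoc butlast_append)
    qed
    then show ?thesis by simp
  qed
  finally show ?thesis by (simp add: Chain_snoc)
qed

lemma wrap_last_mult:
  "length ts = Suc (Suc n) \<Longrightarrow> wrap n (butlast ts @ [last ts * p]) = wrap n ((p * hd ts) # tl ts)"
  by (cases ts; cases "tl ts" rule: rev_cases) (auto simp: wrap_Cons mult.assoc butlast_append)

section \<open>The inverse of the comparison map\<close>

text \<open>\<open>cochain [t\<^sub>0, \<dots>, t\<^sub>n]\<close> is the image of \<open>t\<^sub>0 \<otimes> \<dots> \<otimes> t\<^sub>n\<close> under the iterated Galois map to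
  \<open>T \<otimes> \<B> \<otimes> \<dots> \<otimes> \<B>\<close>.\<close>

primrec cochain :: "'t list \<Rightarrow> ('t \<times> 'b list \<Rightarrow>\<^sub>0 'k)" where
  "cochain [] = 0"
| "cochain (t # ts) = (if ts = [] then gen (t, [])
     else flin (\<lambda>(y, c). flin (\<lambda>(y0, y1). gen (t * y0, y1 # c)) (rep (coact T y))) (cochain ts))"

definition Cochain :: "('t \<Rightarrow> 'b list \<Rightarrow> ('y, 'k) quo) \<Rightarrow> 't list \<Rightarrow> ('y, 'k) quo" where
  "Cochain g ts = qlin (\<lambda>(t, c). g t c) (cochain ts)"

lemma Cochain_single [simp]: "Cochain g [t] = g t []"
  by (simp add: Cochain_def qlin_gen)

lemma Cochain_Cons:
  "ts \<noteq> [] \<Longrightarrow> Cochain g (t # ts) = Cochain (\<lambda>y c. Rho (\<lambda>y0 y1. g (t * y0) (y1 # c)) y) ts"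
  by (simp add: Cochain_def Rho_def qlin_flin qlin_gen case_prod_unfold)

lemma keys_cochain: "Poly_Mapping.keys (cochain ts) \<subseteq> {(t, c). Suc (length c) = length ts}"
proof (induction ts)
  case (Cons t ts)
  then show ?case
    by (auto intro!: keys_lin order_trans[OF keys_gen])
qed simp

lemma Cochain_cong:
  "(\<And>t c. Suc (length c) = length ts \<Longrightarrow> g t c = g' t c) \<Longrightarrow> Cochain g ts = Cochain g' ts"
  unfolding Cochain_def using keys_cochain[of ts] by (intro lin_cong) auto

lemma klinear_Cochain_fun:
  assumes "\<And>t c. Suc (length c) = length ts \<Longrightarrow> klinear sc qscale (\<lambda>x. g x t c)"
  shows "klinear sc qscale (\<lambda>x. Cochain (g x) ts)"
  unfolding Cochain_def using keys_cochain[of ts] by (intro klinear_qlin) (auto intro: assms)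

text \<open>Balanced maps on \<open>T \<otimes> \<B> \<otimes> \<dots> \<otimes> \<B>\<close> over
  \<open>R\<close>, with \<open>l\<close> factors \<B>.\<close>

definition Qbal :: "nat \<Rightarrow> ('t \<Rightarrow> 'b list \<Rightarrow> ('y, 'k) quo) \<Rightarrow> bool" where
  "Qbal l g \<longleftrightarrow> (\<forall>c. length c = l \<longrightarrow> Tlinear (\<lambda>t. g t c)) \<and> (\<forall>t. Bbal l (g t)) \<and>
    (\<forall>t r b c. l = Suc (length c) \<longrightarrow> g (t * j r) (b # c) = g t (b * zeta \<B> r # c))"

lemma TBbal_iff:
  "TBbal g \<longleftrightarrow> (\<forall>y. Tlinear (\<lambda>x. g x y)) \<and> (\<forall>x. Blinear (g x)) \<and>
    (\<forall>x r y. g (x * j r) y = g x (y * zeta \<B> r))"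
  by (auto simp: TBbal_def bilinear_def klinear_def)

lemma TBbal_Qbal: "Qbal (Suc l) g \<Longrightarrow> length c = l \<Longrightarrow> TBbal (\<lambda>x y. g x (y # c))"
  unfolding Qbal_def TBbal_iff using Bbal_head[of l] by auto

lemma klinear_Rho: "(\<And>m p. klinear sc qscale (\<lambda>x. f x m p)) \<Longrightarrow> klinear sc qscale (\<lambda>x. Rho (f x) t)"
  unfolding Rho_def case_prod_unfold by (rule klinear_qlin)

lemma Bbal_Rho: "(\<And>m p. Bbal l (\<lambda>bs. f m p bs)) \<Longrightarrow> Bbal l (\<lambda>bs. Rho (\<lambda>m p. f m p bs) t)"
  unfolding Rho_def case_prod_unfold Bbal_def by (rule pow_balanced_qlin)

text \<open>A factor \<open>j r\<close> on \<open>y\<close> appears as \<open>xi r\<close> on the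
  new \<B>-leg by \<open>Rho_j\<close>, and balancing with the following factor turns it into
  \<open>zeta r\<close> there.\<close>

lemma Qbal_Rho:
  assumes g: "Qbal (Suc l) g"
  shows "Qbal l (\<lambda>y c. Rho (\<lambda>y0 y1. g (a * y0) (y1 # c)) y)"
proof -
  have k: "TBbal (\<lambda>x y. g (a * x) (y # c))" if "length c = l" for c
    by (rule TBbal_left_mult[OF TBbal_Qbal[OF g that]])
  have "Bbal l (\<lambda>c. Rho (\<lambda>y0 y1. g (a * y0) (y1 # c)) y)" for y
    using g by (intro Bbal_Rho Bbal_tail) (simp add: Qbal_def)
  moreover have "g t (x * xi \<B> r # b # c) = g t (x # b * zeta \<B> r # c)" if "l = Suc (length c)" for t x r b c
    using g that by (intro Bbal_second[of "length c"]) (simp_all add: Qbal_def)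
  ultimately show ?thesis
    unfolding Qbal_def by (simp add: klinear_def Rho_add[OF k] Rho_sm[OF k] Rho_j[OF k])
qed

lemma Cochain_S:
  assumes "\<And>y c. length c = length ts \<Longrightarrow> g' y c = g (s * y) c"
  shows "Cochain g' (t # ts) = Cochain g ((s * t) # ts)"
proof (cases "ts = []")
  case False
  then show ?thesis
    using assms by (auto simp: Cochain_Cons mult.assoc intro!: Cochain_cong)
qed (use assms in simp)

lemma Sbal_Cochain: "Qbal l g \<Longrightarrow> Sbal (Suc l) (Cochain g)"
proof (induction l arbitrary: g)
  case 0
  show ?case
    unfolding Sbal_def
    by (rule pow_balanced_ConsI) (use 0 in \<open>auto simp: Qbal_def pow_balanced_0\<close>)
next
  case (Suc l)
  let ?g = "\<lambda>a y c. Rho (\<lambda>y0 y1. g (a * y0) (y1 # c)) y"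
  have Cons: "Cochain g (a # ts) = Cochain (?g a) ts" if "length ts = Suc l" for a ts
    using that by (intro Cochain_Cons) auto
  show ?case
    unfolding Sbal_def
  proof (rule pow_balanced_ConsI)
    fix ts :: "'t list" assume ts: "length ts = Suc l"
    have "Tlinear (\<lambda>x. Cochain (?g x) ts)"
      using Suc.prems
      by (intro klinear_Cochain_fun klinear_Rho klinear_mult_right) (simp add: Qbal_def ts)
    then show "Tlinear (\<lambda>x. Cochain g (x # ts))" by (simp add: Cons[OF ts])
  next
    fix x
    show "pow_balanced (smT T) S (*) (*) (Suc l) (\<lambda>ts. Cochain g (x # ts))"
      by (rule pow_balanced_cong[OF Cons Suc.IH[OF Qbal_Rho[OF Suc.prems], unfolded Sbal_def]])
  next
    fix x y s and ts :: "'t list" assume *: "Suc l = Suc (length ts)" "s \<in> S"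
    have "?g (x * s) z c = ?g x (s * z) c" if "length c = l" for z c
      using Rho_S_mult[OF TBbal_left_mult[OF TBbal_Qbal[OF Suc.prems that]] *(2)] by (simp add: mult.assoc)
    then have "Cochain (?g (x * s)) (y # ts) = Cochain (?g x) ((s * y) # ts)"
      by (intro Cochain_S) (use * in simp)
    then show "Cochain g ((x * s) # y # ts) = Cochain g (x # (s * y) # ts)"
      using * by (simp add: Cons)
  qed
qed

text \<open>Each coaction is right \<open>S\<close>-linear, so \<open>s\<close> travels from the
  last entry through all coactions to the right of the \<open>T\<close>-leg.\<close>

lemma Cochain_right:
  "Qbal l g \<Longrightarrow> length ts = Suc l \<Longrightarrow> s \<in> S \<Longrightarrow>
    Cochain g (butlast ts @ [last ts * s]) = Cochain (\<lambda>t c. g (t * s) c) ts"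
proof (induction ts arbitrary: l g)
  case (Cons t ts)
  show ?case
  proof (cases l)
    case (Suc m)
    then have ts: "length ts = Suc m" "ts \<noteq> []" using Cons.prems by auto
    have g: "Qbal (Suc m) g" using Cons.prems Suc by simp
    have "Cochain g (butlast (t # ts) @ [last (t # ts) * s]) =
       Cochain (\<lambda>y c. Rho (\<lambda>y0 y1. g (t * y0) (y1 # c)) (y * s)) ts"
      using Cons.IH[OF Qbal_Rho[OF g] ts(1) Cons.prems(3)] ts by (simp add: Cochain_Cons)
    also have "\<dots> = Cochain (\<lambda>y c. Rho (\<lambda>y0 y1. g (t * y0 * s) (y1 # c)) y) ts"
      using Rho_mult_S[OF TBbal_left_mult[OF TBbal_Qbal[OF g]] Cons.prems(3)] ts
      by (intro Cochain_cong) (simp add: mult.assoc)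
    finally show ?thesis using ts by (simp add: Cochain_Cons)
  qed (use Cons.prems in simp)
qed simp

text \<open>A factor \<open>s\<close> on the first entry ends up on the left of the
  \<open>T\<close>-leg and one on the last entry on its right; the trace property of
  \<open>g\<close> identifies the two.\<close>

lemma Cbal_Cochain:
  assumes g: "Qbal n g" and S: "\<And>s t c. s \<in> S \<Longrightarrow> length c = n \<Longrightarrow> g (s * t) c = g (t * s) c"
  shows "Cbal (Suc n) (Cochain g)"
  unfolding Cbal_def
proof (intro conjI allI impI)
  show "Sbal (Suc n) (Cochain g)" by (rule Sbal_Cochain[OF g])
  fix ts :: "'t list" and s assume *: "length ts = Suc n \<and> s \<in> S"
  then obtain t ts' where ts: "ts = t # ts'" "length ts' = n" by (cases ts) auto
  have "Cochain g (ts[0 := s * ts ! 0]) = Cochain (\<lambda>y c. g (s * y) c) ts"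
    by (simp add: ts Cochain_S[of ts' "\<lambda>y c. g (s * y) c" g s t])
  also have "\<dots> = Cochain (\<lambda>y c. g (y * s) c) ts"
    by (rule Cochain_cong) (use S * in simp)
  also have "\<dots> = Cochain g (butlast ts @ [last ts * s])"
    by (rule Cochain_right[OF g, symmetric]) (use * in auto)
  also have "butlast ts @ [last ts * s] = ts[Suc n - 1 := ts ! (Suc n - 1) * s]"
    using * by (cases ts rule: rev_cases) (auto simp: nth_append list_update_append)
  finally show "Cochain g (ts[0 := s * ts ! 0]) = Cochain g (ts[Suc n - 1 := ts ! (Suc n - 1) * s])" .
qed

text \<open>One direction of the bijectivity of the iterated Galois map: \<open>Rho_Tau\<close>
  removes a coaction and the translation map following it, one entry at a time.\<close>

lemma Cochain_Chain: "Sbal (length ts) h \<Longrightarrow> ts \<noteq> [] \<Longrightarrow> Cochain (\<lambda>t c. Chain h c t) ts = h ts"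
proof (induction ts arbitrary: h)
  case (Cons t ts)
  show ?case
  proof (cases "ts = []")
    case False
    have "Cochain (\<lambda>t c. Chain h c t) (t # ts) =
        Cochain (\<lambda>y c. Rho (\<lambda>y0 y1. Tau (\<lambda>m p. Chain (\<lambda>ts. h (t * (y0 * m) # ts)) c p) y1) y) ts"
      using False by (simp add: Cochain_Cons Chain_Cons mult.assoc)
    also have "\<dots> = Cochain (\<lambda>y c. Chain (\<lambda>ts. h (t # ts)) c y) ts"
    proof (rule Cochain_cong)
      fix y and c :: "'b list" assume "Suc (length c) = length ts"
      then have "Sbal (Suc (Suc (length c))) h" using Cons.prems by simp
      from Rho_Tau[OF TTbal_left_mult[OF TTbal_Chain[OF this]], of t y]
      show "Rho (\<lambda>y0 y1. Tau (\<lambda>m p. Chain (\<lambda>ts. h (t * (y0 * m) # ts)) c p) y1) y = Chain (\<lambda>ts. h (t # ts)) c y"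
        by simp
    qed
    also have "\<dots> = h (t # ts)"
      using Cons.prems False by (intro Cons.IH) (auto intro: Sbal_tail)
    finally show ?thesis .
  qed simp
qed simp

text \<open>The other direction, where \<open>Tau_Rho_one\<close> cancels a translation map against
  the coaction following it.\<close>

lemma Chain_Cochain: "Qbal (length c) g \<Longrightarrow> Chain (Cochain g) c t = g t c"
proof (induction c arbitrary: g t)
  case (Cons b c)
  have g: "Qbal (Suc (length c)) g" using Cons.prems by simp
  have "Chain (Cochain g) (b # c) t =
      Tau (\<lambda>m p. Chain (Cochain (\<lambda>y c. Rho (\<lambda>y0 y1. g (t * m * y0) (y1 # c)) y)) c p) b"
  proof -
    have "Chain (\<lambda>ts. Cochain g (x # ts)) c p = Chain (Cochain (\<lambda>y c. Rho (\<lambda>y0 y1. g (x * y0) (y1 # c)) y)) c p"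
      for x p by (intro Chain_cong Cochain_Cons) auto
    then show ?thesis by (simp add: Chain_Cons)
  qed
  also have "\<dots> = Tau (\<lambda>m p. Rho (\<lambda>y0 y1. g (t * (m * y0)) (y1 # c)) p) b"
  proof -
    have "Chain (Cochain (\<lambda>y c. Rho (\<lambda>y0 y1. g (x * y0) (y1 # c)) y)) c = Rho (\<lambda>y0 y1. g (x * y0) (y1 # c))" for x
      by (rule ext) (rule Cons.IH[OF Qbal_Rho[OF g]])
    then have "(\<lambda>m. Chain (Cochain (\<lambda>y c. Rho (\<lambda>y0 y1. g (t * m * y0) (y1 # c)) y)) c) =
        (\<lambda>m. Rho (\<lambda>y0 y1. g (t * m * y0) (y1 # c)))" by (intro ext) (simp only:)
    then show ?thesis by (simp add: mult.assoc)
  qed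
  also have "\<dots> = g t (b # c)"
    using Tau_Rho_one[OF TBbal_left_mult[OF TBbal_Qbal[OF g refl]], of t b] by simp
  finally show ?case .
qed simp

end

lemma gen_in_keys: "x \<in> A \<Longrightarrow> gen x \<in> {u. Poly_Mapping.keys u \<subseteq> A}"
  using keys_gen[of x] by auto

text \<open>Keeps representatives chosen by \<open>rep\<close> supported on the carriers of the two
  modules.\<close>

lemma bal_rel_subset:
  fixes M :: "('k::{comm_ring,comm_monoid_mult}, 'm::plus, 'z) kmod_scheme"
    and N :: "('k, 'n::plus, 'y) kmod_scheme"
  assumes "\<And>x y. x \<in> carr M \<Longrightarrow> y \<in> carr M \<Longrightarrow> x + y \<in> carr M" "\<And>c x. x \<in> carr M \<Longrightarrow> sm M c x \<in> carr M"
    and "\<And>x y. x \<in> carr N \<Longrightarrow> y \<in> carr N \<Longrightarrow> x + y \<in> carr N" "\<And>c x. x \<in> carr N \<Longrightarrow> sm N c x \<in> carr N"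
    and "\<And>x a. x \<in> carr M \<Longrightarrow> a \<in> A \<Longrightarrow> ra x a \<in> carr M" "\<And>x a. x \<in> carr N \<Longrightarrow> a \<in> A \<Longrightarrow> la a x \<in> carr N"
  shows "bal_rel M N A ra la \<subseteq> {u. Poly_Mapping.keys u \<subseteq> carr M \<times> carr N}"
  unfolding bal_rel_def
proof (rule hull_minimal)
  let ?F = "{u :: 'm \<times> 'n \<Rightarrow>\<^sub>0 'k. Poly_Mapping.keys u \<subseteq> carr M \<times> carr N}"
  have gen: "gen (x, y) \<in> ?F" if "x \<in> carr M" "y \<in> carr N" for x y
    by (rule gen_in_keys) (use that in simp)
  note sub = ksubmoduleD[OF ksubmodule_keys[of "carr M \<times> carr N"]]
  show "{gen (m + m', n) - gen (m, n) - gen (m', n) | m m' n. m \<in> carr M \<and> m' \<in> carr M \<and> n \<in> carr N} \<union>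
     {gen (m, n + n') - gen (m, n) - gen (m, n') | m n n'. m \<in> carr M \<and> n \<in> carr N \<and> n' \<in> carr N} \<union>
     {gen (sm M c m, n) - fscale c (gen (m, n)) | c m n. m \<in> carr M \<and> n \<in> carr N} \<union>
     {gen (m, sm N c n) - fscale c (gen (m, n)) | c m n. m \<in> carr M \<and> n \<in> carr N} \<union>
     {gen (ra m a, n) - gen (m, la a n) | m a n. m \<in> carr M \<and> a \<in> A \<and> n \<in> carr N} \<subseteq> ?F" (is "?G \<subseteq> _")
  proof
    fix u assume "u \<in> ?G"
    then consider
        m m' n where "m \<in> carr M" "m' \<in> carr M" "n \<in> carr N" "u = gen (m + m', n) - gen (m, n) - gen (m', n)"
      | m n n' where "m \<in> carr M" "n \<in> carr N" "n' \<in> carr N" "u = gen (m, n + n') - gen (m, n) - gen (m, n')"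
      | c m n where "m \<in> carr M" "n \<in> carr N" "u = gen (sm M c m, n) - fscale c (gen (m, n))"
      | c m n where "m \<in> carr M" "n \<in> carr N" "u = gen (m, sm N c n) - fscale c (gen (m, n))"
      | m a n where "m \<in> carr M" "a \<in> A" "n \<in> carr N" "u = gen (ra m a, n) - gen (m, la a n)"
      by blast
    then show "u \<in> ?F"
      by (cases; simp only:; intro sub(4,5) gen assms; assumption)
  qed
qed (rule ksubmodule_keys)

section \<open>Transport of a cyclic structure\<close>

text \<open>Each identity is checked after applying \<phi>. The homomorphism assumptions keep both
  sides in the carrier, where \<phi> is injective.\<close>

lemma cyclic_module_transport:
  assumes Z': "cyclic_module Z'"
    and mod: "\<And>n. kmodule (deg Z n)"
    and face: "\<And>n k. k \<le> Suc n \<Longrightarrow> kmod_hom (deg Z (Suc n)) (deg Z n) (face Z (Suc n) k)"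
    and degen: "\<And>n k. k \<le> n \<Longrightarrow> kmod_hom (deg Z n) (deg Z (Suc n)) (degen Z n k)"
    and cyc: "\<And>n. kmod_hom (deg Z n) (deg Z n) (cyc Z n)"
    and \<phi>: "cyclic_iso Z Z' \<phi>"
  shows "cyclic_module Z"
proof -
  have inj: "inj_on (\<phi> n) (carr (deg Z n))" and hom: "x \<in> carr (deg Z n) \<Longrightarrow> \<phi> n x \<in> carr (deg Z' n)" for n x
    using \<phi> by (auto simp: cyclic_iso_def kmod_iso_def kmod_hom_def bij_betw_def)
  have cl: "x \<in> carr (deg Z (Suc n)) \<Longrightarrow> k \<le> Suc n \<Longrightarrow> face Z (Suc n) k x \<in> carr (deg Z n)"
    "y \<in> carr (deg Z n) \<Longrightarrow> k \<le> n \<Longrightarrow> degen Z n k y \<in> carr (deg Z (Suc n))"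
    "y \<in> carr (deg Z n) \<Longrightarrow> cyc Z n y \<in> carr (deg Z n)" for n k x y
    using face degen cyc by (auto simp: kmod_hom_def)
  have int: "x \<in> carr (deg Z (Suc n)) \<Longrightarrow> k \<le> Suc n \<Longrightarrow> \<phi> n (face Z (Suc n) k x) = face Z' (Suc n) k (\<phi> (Suc n) x)"
    "y \<in> carr (deg Z n) \<Longrightarrow> k \<le> n \<Longrightarrow> \<phi> (Suc n) (degen Z n k y) = degen Z' n k (\<phi> n y)"
    "y \<in> carr (deg Z n) \<Longrightarrow> \<phi> n (cyc Z n y) = cyc Z' n (\<phi> n y)" for n k x y
    using \<phi> by (auto simp: cyclic_iso_def)
  have eqI: "x = y" if "\<phi> n x = \<phi> n y" "x \<in> carr (deg Z n)" "y \<in> carr (deg Z n)" for n x y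
    using inj that by (auto dest: inj_onD)
  have simp': "simplicial_identities Z'" and cyc': "cyclic_identities Z'"
    using Z' by (auto simp: cyclic_module_def)
  note s = simp'[unfolded simplicial_identities_def]
  note s1 = s[THEN conjunct1, rule_format]
    and s2 = s[THEN conjunct2, THEN conjunct1, rule_format]
    and s3 = s[THEN conjunct2, THEN conjunct2, THEN conjunct1, rule_format]
    and s4 = s[THEN conjunct2, THEN conjunct2, THEN conjunct2, THEN conjunct1, rule_format]
    and s5 = s[THEN conjunct2, THEN conjunct2, THEN conjunct2, THEN conjunct2, rule_format]
  note c = cyc'[unfolded cyclic_identities_def]
  note c1 = c[THEN conjunct1, rule_format]
    and c2 = c[THEN conjunct2, THEN conjunct1, rule_format]
    and c3 = c[THEN conjunct2, THEN conjunct2, THEN conjunct1, rule_format]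
    and c4 = c[THEN conjunct2, THEN conjunct2, THEN conjunct2, THEN conjunct1, rule_format]
    and c5 = c[THEN conjunct2, THEN conjunct2, THEN conjunct2, THEN conjunct2, rule_format]
  have "simplicial_identities Z"
    unfolding simplicial_identities_def
  proof (intro conjI allI impI ballI)
    fix n j i x assume *: "j \<le> Suc (Suc n)" "i < j" "x \<in> carr (deg Z (Suc (Suc n)))"
    then have "j - 1 \<le> Suc n" "i \<le> Suc n" by auto
    then show "face Z (Suc n) i (face Z (Suc (Suc n)) j x) = face Z (Suc n) (j - 1) (face Z (Suc (Suc n)) i x)"
      using * s1[OF *(1,2) hom[OF *(3)]] by (intro eqI[of n]) (simp_all add: cl int)
  next
    fix n j i x assume *: "j \<le> n" "i \<le> j" "x \<in> carr (deg Z n)"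
    then show "degen Z (Suc n) i (degen Z n j x) = degen Z (Suc n) (Suc j) (degen Z n i x)"
      using s2[OF *(1,2) hom[OF *(3)]] by (intro eqI[of "Suc (Suc n)"]) (simp_all add: cl int)
  next
    fix n j i x assume *: "j \<le> n" "i < j" "x \<in> carr (deg Z n)"
    then obtain m where m: "n = Suc m" by (cases n) auto
    then have "j - 1 \<le> m" "i \<le> Suc m" using * by auto
    then show "face Z (Suc n) i (degen Z n j x) = degen Z (n - 1) (j - 1) (face Z n i x)"
      using * s3[OF *(1,2) hom[OF *(3)]] unfolding m by (intro eqI[of "Suc m"]) (auto simp: cl int)
  next
    fix n j i x assume *: "j \<le> n" "i \<in> {j, Suc j}" "x \<in> carr (deg Z n)"
    then show "face Z (Suc n) i (degen Z n j x) = x"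
      using s4[OF *(1,2) hom[OF *(3)]] by (intro eqI[of n]) (auto simp: cl int)
  next
    fix n j i x assume *: "j \<le> n" "i \<le> Suc n" "Suc j < i" "x \<in> carr (deg Z n)"
    then obtain m where m: "n = Suc m" by (cases n) auto
    then have "i - 1 \<le> Suc m" "j \<le> m" using * by auto
    then show "face Z (Suc n) i (degen Z n j x) = degen Z (n - 1) j (face Z n (i - 1) x)"
      using * s5[OF *(1,2,3) hom[OF *(4)]] unfolding m by (intro eqI[of "Suc m"]) (auto simp: cl int)
  qed
  moreover have "cyclic_identities Z"
    unfolding cyclic_identities_def
  proof (intro conjI allI impI ballI)
    fix n i x assume *: "i \<in> {1..Suc n}" "x \<in> carr (deg Z (Suc n))"
    then have "i - 1 \<le> Suc n" by auto
    then show "face Z (Suc n) i (cyc Z (Suc n) x) = cyc Z n (face Z (Suc n) (i - 1) x)"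
      using * c1[OF *(1) hom[OF *(2)]] by (intro eqI[of n]) (simp_all add: cl int)
  next
    fix n x assume *: "x \<in> carr (deg Z (Suc n))"
    then show "face Z (Suc n) 0 (cyc Z (Suc n) x) = face Z (Suc n) (Suc n) x"
      using c2[OF hom[OF *]] by (intro eqI[of n]) (simp_all add: cl int)
  next
    fix n i x assume *: "i \<in> {1..n}" "x \<in> carr (deg Z n)"
    then have "i - 1 \<le> n" by auto
    then show "degen Z n i (cyc Z n x) = cyc Z (Suc n) (degen Z n (i - 1) x)"
      using * c3[OF *(1) hom[OF *(2)]] by (intro eqI[of "Suc n"]) (simp_all add: cl int)
  next
    fix n x assume *: "x \<in> carr (deg Z n)"
    then show "degen Z n 0 (cyc Z n x) = cyc Z (Suc n) (cyc Z (Suc n) (degen Z n n x))"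
      using c4[OF hom[OF *]] by (intro eqI[of "Suc n"]) (simp_all add: cl int)
  next
    fix n x assume x: "x \<in> carr (deg Z n)"
    have "(cyc Z n ^^ m) x \<in> carr (deg Z n) \<and> \<phi> n ((cyc Z n ^^ m) x) = (cyc Z' n ^^ m) (\<phi> n x)" for m
      by (induction m) (use x in \<open>simp_all add: cl int\<close>)
    moreover have "(cyc Z' n ^^ Suc n) (\<phi> n x) = \<phi> n x"
      by (rule c5[OF hom[OF x]])
    ultimately show "(cyc Z n ^^ Suc n) x = x"
      using x by (metis eqI)
  qed
  ultimately show ?thesis
    using mod face degen cyc by (simp add: cyclic_module_def)
qed

context hopf_galois
begin

section \<open>Balanced maps on the cyclic module of the bialgebroid\<close>

abbreviation "X \<equiv> T_S \<B> T S"

lemma comm_sub [simp]: "ksubmodule (smT T) (commutators T S)"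
  by (simp add: commutators_def)

lemma X_sel: "carr X = {pT T S t | t. True}" "sm X c (pT T S t) = pT T S (smT T c t)"
  "bact X b x = pT T S (lin (smT T) (\<lambda>(tm, tp). tp * rep x * tm) (rep (translation \<B> T S b)))"
  "bcoact X x = flin (\<lambda>(t0, b). gen (pT T S t0, b)) (rep (coact T (rep x))) +o TSB_rel \<B> T S"
  using quot_sm[OF scaling_smT comm_sub, of UNIV c t]
  by (simp_all add: T_S_def TS_mod_def quot_sel(1) pT_def)

lemma pT_in [simp]: "pT T S t \<in> carr X"
  by (auto simp: X_sel)

lemma pT_add: "pT T S t + pT T S t' = pT T S (t + t')"
  by (simp add: pT_def coset_plus[OF comm_sub])

lemma pT_comm: "s \<in> S \<Longrightarrow> pT T S (s * t) = pT T S (t * s)"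
  unfolding pT_def by (rule coset_eqI[OF comm_sub], unfold commutators_def, rule hull_inc) blast

lemma commutators_zero:
  assumes f: "Tlinear f" and s: "\<And>s t. s \<in> S \<Longrightarrow> f (s * t) = f (t * s)"
    and x: "x \<in> commutators T S"
  shows "f x = 0"
proof -
  have diff: "f (x - y) = f x - f y" for x y
    using f unfolding klinear_def by (metis add_diff_cancel_right' diff_add_cancel)
  have "commutators T S \<subseteq> {x. f x = 0}"
    unfolding commutators_def
    by (intro hull_minimal ksubmodule_kernel[OF scaling_qscale f]) (auto simp: diff intro: s)
  with x show ?thesis by auto
qed

lemma rep_pT:
  assumes f: "Tlinear f" and s: "\<And>s t. s \<in> S \<Longrightarrow> f (s * t) = f (t * s)"
  shows "f (rep (pT T S t)) = f t"
proof -
  have "f (rep (pT T S t) - t) = 0"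
    unfolding pT_def by (rule commutators_zero[OF f _ rep_diff[OF comm_sub]]) (rule s)
  then show ?thesis
    using f unfolding klinear_def by (metis add.left_neutral diff_add_cancel)
qed

text \<open>Balanced maps on \<open>\<B> \<otimes> \<dots> \<otimes> \<B> \<otimes> T_S\<close> over
  \<B>. They are written on \<open>T\<close> with a trace condition over \<open>S\<close>, which
  avoids classes modulo commutators; the last clause is balancing over \<B>, since \<open>b\<close>
  acts on \<open>T_S\<close> by \<open>b{+} t b{-}\<close>.\<close>

definition ZBbal :: "nat \<Rightarrow> ('b list \<Rightarrow> 't \<Rightarrow> ('y, 'k) quo) \<Rightarrow> bool" where
  "ZBbal n H \<longleftrightarrow> (\<forall>t. Bbal (Suc n) (\<lambda>bs. H bs t)) \<and>
    (\<forall>bs. length bs = Suc n \<longrightarrow> Tlinear (H bs) \<and>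
      (\<forall>s\<in>S. \<forall>t. H bs (s * t) = H bs (t * s)) \<and>
      (\<forall>b t. Dn n (\<lambda>cs. H (map2 (*) bs cs) t) b = Tau (\<lambda>m p. H bs (p * t * m)) b))"

definition ev :: "('b list \<Rightarrow> 't \<Rightarrow> ('y, 'k) quo) \<Rightarrow> ('b list \<Rightarrow>\<^sub>0 'k) set \<times> 't set \<Rightarrow> ('y, 'k) quo" where
  "ev H z = qlin (\<lambda>bs. H bs (rep (snd z))) (rep (fst z))"

lemma ev_coset:
  assumes H: "ZBbal n H" and u: "u \<in> tuples (Suc n)"
  shows "ev H (u +o Bpow_rel \<B> (Suc n), pT T S t) = qlin (\<lambda>bs. H bs t) u"
proof -
  have "ev H (u +o Bpow_rel \<B> (Suc n), pT T S t) = qlin (\<lambda>bs. H bs (rep (pT T S t))) u"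
  proof -
    have "Bbal (Suc n) (\<lambda>bs. H bs (rep (pT T S t)))" using H by (simp add: ZBbal_def)
    then show ?thesis by (simp add: ev_def qlin_rep_coset Bbal_zero)
  qed
  also have "\<dots> = qlin (\<lambda>bs. H bs t) u"
  proof (rule lin_cong)
    fix bs assume "bs \<in> Poly_Mapping.keys u"
    then have "Tlinear (H bs)" "\<And>s t. s \<in> S \<Longrightarrow> H bs (s * t) = H bs (t * s)"
      using H u unfolding ZBbal_def by blast+
    then show "H bs (rep (pT T S t)) = H bs t" by (rule rep_pT)
  qed
  finally show ?thesis .
qed

lemma Bpow_sel: "carr (Bpow \<B> l) = {u +o Bpow_rel \<B> l | u. u \<in> tuples l}"
  "sm (Bpow \<B> l) c (u +o Bpow_rel \<B> l) = fscale c u +o Bpow_rel \<B> l"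
  by (simp_all add: Bpow_def quot_sel(1) quot_sm)

lemma coset_in_Bpow [simp]: "u \<in> tuples l \<Longrightarrow> u +o Bpow_rel \<B> l \<in> carr (Bpow \<B> l)"
  by (auto simp: Bpow_sel)

lemma rep_tuples: "\<beta> \<in> carr (Bpow \<B> l) \<Longrightarrow> rep \<beta> \<in> tuples l"
  using rep_coset_tuples by (auto simp: Bpow_sel)

lemma qlin_diag:
  assumes f: "Bbal (Suc n) f"
  shows "qlin f (rep (diag_act \<B> n \<beta> b)) = qlin (\<lambda>bs. Dn n (\<lambda>cs. f (map2 (*) bs cs)) b) (rep \<beta>)"
  unfolding diag_act_def by (simp add: qlin_rep_induced Bbal_zero[OF f] qlin_flin qlin_gen Dn_def)

lemma diag_in_Bpow: "\<beta> \<in> carr (Bpow \<B> (Suc n)) \<Longrightarrow> diag_act \<B> n \<beta> b \<in> carr (Bpow \<B> (Suc n))"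
proof -
  assume \<beta>: "\<beta> \<in> carr (Bpow \<B> (Suc n))"
  have "Poly_Mapping.keys (flin (\<lambda>cs. gen (map2 (*) bs cs)) (rep (cop_iter \<B> n b))) \<subseteq> {xs. length xs = Suc n}"
    if "length bs = Suc n" for bs
    by (intro keys_lin order_trans[OF keys_gen]) (use that subsetD[OF keys_cop_iter] in auto)
  then have "flin (\<lambda>bs. flin (\<lambda>cs. gen (map2 (*) bs cs)) (rep (cop_iter \<B> n b))) (rep \<beta>) \<in> tuples (Suc n)"
    using rep_tuples[OF \<beta>] unfolding mem_Collect_eq by - (rule keys_lin, blast)
  then show ?thesis
    unfolding diag_act_def induced_def Suc_eq_plus1[symmetric] by (rule coset_in_Bpow)
qed

definition ZF :: "nat \<Rightarrow> (('b list \<Rightarrow>\<^sub>0 'k) set \<times> 't set \<Rightarrow>\<^sub>0 'k) set" where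
  "ZF n = {u. Poly_Mapping.keys u \<subseteq> carr (Bpow \<B> (Suc n)) \<times> carr X}"

lemma ZF_sub: "ksubmodule fscale (ZF n)"
  unfolding ZF_def by (rule ksubmodule_keys)

lemma ZB_rel_sub [simp]: "ksubmodule fscale (ZB_rel \<B> X n)"
  by (simp add: ZB_rel_def)

lemma Bpow_closed: "x \<in> carr (Bpow \<B> l) \<Longrightarrow> y \<in> carr (Bpow \<B> l) \<Longrightarrow> x + y \<in> carr (Bpow \<B> l)"
  "x \<in> carr (Bpow \<B> l) \<Longrightarrow> sm (Bpow \<B> l) c x \<in> carr (Bpow \<B> l)"
proof -
  have "kmodule (Bpow \<B> l)"
    unfolding Bpow_def by (rule kmodule_quot) (simp_all add: ksubmodule_keys)
  then show "x \<in> carr (Bpow \<B> l) \<Longrightarrow> y \<in> carr (Bpow \<B> l) \<Longrightarrow> x + y \<in> carr (Bpow \<B> l)"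
    "x \<in> carr (Bpow \<B> l) \<Longrightarrow> sm (Bpow \<B> l) c x \<in> carr (Bpow \<B> l)"
    by (simp_all add: kmodule_def)
qed

lemma X_closed: "x \<in> carr X \<Longrightarrow> y \<in> carr X \<Longrightarrow> x + y \<in> carr X" "x \<in> carr X \<Longrightarrow> sm X c x \<in> carr X"
  "bact X b x \<in> carr X"
  using X_sel(2,3) by (auto simp: X_sel(1) pT_add)

lemma ZB_rel_subset: "ZB_rel \<B> X n \<subseteq> ZF n"
  unfolding ZB_rel_def ZF_def Suc_eq_plus1[symmetric]
  by (rule bal_rel_subset) (auto intro: Bpow_closed X_closed diag_in_Bpow)

lemma ZB_zero:
  assumes H: "ZBbal n H" and u: "u \<in> ZB_rel \<B> X n"
  shows "qlin (ev H) u = 0"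
proof -
  have B: "Bbal (Suc n) (\<lambda>bs. H bs t)" for t using H by (simp add: ZBbal_def)
  note sub = ksubmoduleD[OF ksubmodule_keys[of "{xs :: 'b list. length xs = Suc n}"]]
  have lin: "Tlinear (\<lambda>t. qlin (\<lambda>bs. H bs t) v)" if "v \<in> tuples (Suc n)" for v
  proof -
    have "qlin (\<lambda>bs. H bs (x + y)) v = qlin (\<lambda>bs. H bs x + H bs y) v"
      "qlin (\<lambda>bs. H bs (smT T c x)) v = qlin (\<lambda>bs. qscale c (H bs x)) v" for x y c
      using H that by (auto intro!: lin_cong simp: ZBbal_def klinear_def)
    then show ?thesis by (simp add: klinear_def qlin_fun_add qlin_fun_scale)
  qed
  have "balanced qscale (Bpow \<B> (Suc n)) X UNIV (diag_act \<B> n) (bact X) (\<lambda>\<beta> x. ev H (\<beta>, x))"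
    unfolding balanced_def
  proof (intro conjI ballI allI)
    fix m m' x assume "m \<in> carr (Bpow \<B> (Suc n))" "m' \<in> carr (Bpow \<B> (Suc n))" "x \<in> carr X"
    then obtain u u' t where "u \<in> tuples (Suc n)" "u' \<in> tuples (Suc n)"
      "m = u +o Bpow_rel \<B> (Suc n)" "m' = u' +o Bpow_rel \<B> (Suc n)" "x = pT T S t"
      unfolding Bpow_sel(1) X_sel(1) by blast
    then show "ev H (m + m', x) = ev H (m, x) + ev H (m', x)"
      by (simp only: coset_plus[OF Bpow_rel_sub] ev_coset[OF H] sub(2) qlin_add)
  next
    fix m x x' assume "m \<in> carr (Bpow \<B> (Suc n))" "x \<in> carr X" "x' \<in> carr X"
    then obtain u t t' where "u \<in> tuples (Suc n)" "m = u +o Bpow_rel \<B> (Suc n)" "x = pT T S t" "x' = pT T S t'"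
      unfolding Bpow_sel(1) X_sel(1) by blast
    then show "ev H (m, x + x') = ev H (m, x) + ev H (m, x')"
      using lin[of u] by (simp only: pT_add ev_coset[OF H] klinear_def)
  next
    fix c m x assume "m \<in> carr (Bpow \<B> (Suc n))" "x \<in> carr X"
    then obtain u t where "u \<in> tuples (Suc n)" "m = u +o Bpow_rel \<B> (Suc n)" "x = pT T S t"
      unfolding Bpow_sel(1) X_sel(1) by blast
    then show "ev H (sm (Bpow \<B> (Suc n)) c m, x) = qscale c (ev H (m, x))"
      by (simp only: Bpow_sel(2) ev_coset[OF H] sub(4) qlin_fscale)
  next
    fix c m x assume "m \<in> carr (Bpow \<B> (Suc n))" "x \<in> carr X"
    then obtain u t where "u \<in> tuples (Suc n)" "m = u +o Bpow_rel \<B> (Suc n)" "x = pT T S t"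
      unfolding Bpow_sel(1) X_sel(1) by blast
    then show "ev H (m, sm X c x) = qscale c (ev H (m, x))"
      using lin[of u] by (simp only: X_sel(2) ev_coset[OF H] klinear_def)
  next
    fix \<beta> b x assume *: "\<beta> \<in> carr (Bpow \<B> (Suc n))" "x \<in> carr X"
    note \<beta> = rep_tuples[OF *(1)]
    have eq: "Dn n (\<lambda>cs. H (map2 (*) bs cs) t) b = Tau (\<lambda>m p. H bs (p * t * m)) b" if "length bs = Suc n" for bs t
      using H that by (simp add: ZBbal_def)
    have eq': "Tau (\<lambda>m p. H bs (p * t * m)) b =
        H bs (rep (pT T S (lin (smT T) (\<lambda>(tm, tp). tp * t * tm) (rep (translation \<B> T S b)))))"
      if "length bs = Suc n" for bs t
    proof -
      have f: "Tlinear (H bs)" "\<And>s t. s \<in> S \<Longrightarrow> H bs (s * t) = H bs (t * s)"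
        using H that by (auto simp: ZBbal_def)
      show ?thesis
        by (subst rep_pT[OF f], assumption) (simp add: lin_apply[OF f(1)] Tau_def case_prod_unfold)
    qed
    have "ev H (diag_act \<B> n \<beta> b, x) = qlin (\<lambda>bs. Dn n (\<lambda>cs. H (map2 (*) bs cs) (rep x)) b) (rep \<beta>)"
      by (simp add: ev_def qlin_diag[OF B])
    also have "\<dots> = ev H (\<beta>, bact X b x)"
      unfolding ev_def X_sel(3) fst_conv snd_conv
      by (rule lin_cong) (use \<beta> eq eq' in auto)
    finally show "ev H (diag_act \<B> n \<beta> b, x) = ev H (\<beta>, bact X b x)" .
  qed
  from lin_bal_rel[OF scaling_qscale this, of u] u show ?thesis
    by (simp add: ZB_rel_def)
qed

text \<open>Why the action of \<B> descends to \<open>T_S\<close>: the trace property makes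
  \<open>p * t * m\<close> balanced over \<open>S\<close> in its two legs, and \<open>Tau_S\<close>
  then turns commutators inside into equalities.\<close>

lemma
  assumes f: "Tlinear f" and s: "\<And>s t. s \<in> S \<Longrightarrow> f (s * t) = f (t * s)"
  shows TTbal_trace: "TTbal (\<lambda>m p. f (p * t * m))"
    and Tau_trace: "s \<in> S \<Longrightarrow> Tau (\<lambda>m p. f (p * (s * t) * m)) b = Tau (\<lambda>m p. f (p * (t * s) * m)) b"
proof -
  show TT: "TTbal (\<lambda>m p. f (p * t * m))" for t
    unfolding TTbal_def bilinear_def
  proof (intro conjI allI ballI)
    fix x s y assume "s \<in> S"
    from s[OF this, of "y * t * x"] show "f (y * t * (x * s)) = f (s * y * t * x)" by (simp add: mult.assoc)
  qed (use f in \<open>simp_all add: klinear_def distrib_left distrib_right smT_mult\<close>)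
  assume "s \<in> S"
  from Tau_S[OF TT this, of t b]
  show "Tau (\<lambda>m p. f (p * (s * t) * m)) b = Tau (\<lambda>m p. f (p * (t * s) * m)) b"
    by (simp add: mult.assoc)
qed

definition Z_proj :: "nat \<Rightarrow> 'b list \<Rightarrow> 't \<Rightarrow> (('b list \<Rightarrow>\<^sub>0 'k) set \<times> 't set, 'k) quo" where
  "Z_proj n bs t = proj (ZB_rel \<B> X n) (gen (gen bs +o Bpow_rel \<B> (Suc n), pT T S t))"

text \<open>The map \<open>gen\<close> is not additive in the coset it contains; additivity appears
  only after \<open>proj\<close>. Therefore \<open>u\<close> is decomposed by induction over its
  finite support.\<close>

lemma Z_proj_coset:
  assumes u: "u \<in> tuples (Suc n)"
  shows "proj (ZB_rel \<B> X n) (gen (u +o Bpow_rel \<B> (Suc n), pT T S t)) = qlin (\<lambda>bs. Z_proj n bs t) u"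
proof -
  let ?P = "\<lambda>\<beta>. proj (ZB_rel \<B> X n) (gen (\<beta>, pT T S t))"
  have bal: "balanced qscale (Bpow \<B> (Suc n)) X UNIV (diag_act \<B> n) (bact X)
      (\<lambda>\<beta> x. proj (ZB_rel \<B> X n) (gen (\<beta>, x)))"
    by (rule balanced_proj) (simp add: ZB_rel_def)
  let ?N = "Bpow_rel \<B> (Suc n)"
  have add: "?P ((v + w) +o ?N) = ?P (v +o ?N) + ?P (w +o ?N)" if "v \<in> tuples (Suc n)" "w \<in> tuples (Suc n)" for v w
    using bal that coset_in_Bpow by (simp add: balanced_def flip: coset_plus[OF Bpow_rel_sub])
  have sc: "?P (fscale c v +o ?N) = qscale c (?P (v +o ?N))" if "v \<in> tuples (Suc n)" for c v
    using bal that coset_in_Bpow by (simp add: balanced_def flip: Bpow_sel(2))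
  note sub = ksubmoduleD[OF ksubmodule_keys[of "{xs :: 'b list. length xs = Suc n}"]]
  have zero: "?P (0 +o ?N) = 0"
    using add[of 0 0] by (simp del: set_zero_plus)
  have "(\<Sum>x\<in>A. fscale (c x) (gen x)) \<in> tuples (Suc n) \<and>
      ?P ((\<Sum>x\<in>A. fscale (c x) (gen x)) +o ?N) = (\<Sum>x\<in>A. qscale (c x) (Z_proj n x t))"
    if "finite A" "A \<subseteq> {xs. length xs = Suc n}" for A c
    using that
  proof (induction A rule: finite_induct)
    case empty
    then show ?case using zero by (simp del: set_zero_plus)
  next
    case (insert x A)
    then have x: "gen x \<in> tuples (Suc n)" by (intro gen_in_keys) simp
    have "fscale (c x) (gen x) \<in> tuples (Suc n)" by (rule sub(4)[OF x])
    with insert have "fscale (c x) (gen x) + (\<Sum>x\<in>A. fscale (c x) (gen x)) \<in> tuples (Suc n)"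
      "?P ((fscale (c x) (gen x) + (\<Sum>x\<in>A. fscale (c x) (gen x))) +o ?N) =
        qscale (c x) (Z_proj n x t) + (\<Sum>x\<in>A. qscale (c x) (Z_proj n x t))"
      using sub(2)[of "fscale (c x) (gen x)"] add[of "fscale (c x) (gen x)"] sc[OF x]
      by (simp_all add: Z_proj_def del: mem_Collect_eq)
    with insert show ?case by (simp del: mem_Collect_eq)
  qed
  from this[of "Poly_Mapping.keys u" "Poly_Mapping.lookup u"] u
  have "?P (flin gen u +o ?N) = qlin (\<lambda>bs. Z_proj n bs t) u" by (simp add: lin_def)
  then show ?thesis by (simp add: flin_gen_id)
qed

lemma ZBbal_Z_proj: "ZBbal n (Z_proj n)"
proof -
  let ?N = "Bpow_rel \<B> (Suc n)"
  let ?P = "\<lambda>\<beta> x. proj (ZB_rel \<B> X n) (gen (\<beta>, x))"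
  have bal: "balanced qscale (Bpow \<B> (Suc n)) X UNIV (diag_act \<B> n) (bact X) ?P"
    by (rule balanced_proj) (simp add: ZB_rel_def)
  have B: "Bbal (Suc n) (\<lambda>bs. Z_proj n bs t)" for t
    unfolding Bbal_def
  proof (rule pow_balanced_if_zero)
    fix u assume "u \<in> pow_gens (smB \<B>) UNIV (rR \<B>) (lR \<B>) (Suc n)"
    then have u: "u \<in> ?N" unfolding Bpow_rel_def by (rule hull_inc)
    then have u': "u \<in> tuples (Suc n)" using Bpow_rel_tuples by blast
    have "qlin (\<lambda>bs. Z_proj n bs t) u = ?P (u +o ?N) (pT T S t)" by (rule Z_proj_coset[OF u', symmetric])
    also have "u +o ?N = 0 +o ?N" by (rule coset_eqI[OF Bpow_rel_sub]) (simp add: u)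
    also have "?P (0 +o ?N) (pT T S t) = qlin (\<lambda>bs. Z_proj n bs t) 0" by (rule Z_proj_coset) simp
    finally show "qlin (\<lambda>bs. Z_proj n bs t) u = 0" by simp
  qed
  have "Tlinear (Z_proj n bs)" "\<And>s t. s \<in> S \<Longrightarrow> Z_proj n bs (s * t) = Z_proj n bs (t * s)"
    "Dn n (\<lambda>cs. Z_proj n (map2 (*) bs cs) t) b = Tau (\<lambda>m p. Z_proj n bs (p * t * m)) b"
    if bs: "length bs = Suc n" for bs b t
  proof -
    have gen: "gen bs \<in> tuples (Suc n)" by (rule gen_in_keys) (simp add: bs)
    note \<beta> = coset_in_Bpow[OF gen]
    show add: "Tlinear (Z_proj n bs)"
      using bal \<beta> pT_in unfolding klinear_def Z_proj_def balanced_def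
      by (simp flip: pT_add X_sel(2))
    show comm: "Z_proj n bs (s * t) = Z_proj n bs (t * s)" if "s \<in> S" for s t
      by (simp add: Z_proj_def pT_comm[OF that])
    let ?\<beta> = "gen bs +o ?N"
    have "Dn n (\<lambda>cs. Z_proj n (map2 (*) bs cs) t) b = qlin (\<lambda>bs. Dn n (\<lambda>cs. Z_proj n (map2 (*) bs cs) t) b) (rep ?\<beta>)"
      by (simp add: qlin_rep_coset Bbal_zero[OF Bbal_diag[OF B]] qlin_gen)
    also have "\<dots> = qlin (\<lambda>bs. Z_proj n bs t) (rep (diag_act \<B> n ?\<beta> b))"
      by (rule qlin_diag[OF B, symmetric])
    also have "\<dots> = ?P (diag_act \<B> n ?\<beta> b) (pT T S t)"
    proof -
      obtain v where v: "v \<in> tuples (Suc n)" "diag_act \<B> n ?\<beta> b = v +o ?N"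
        using diag_in_Bpow[OF \<beta>, of b] by (auto simp: Bpow_sel)
      show ?thesis unfolding v(2) Z_proj_coset[OF v(1)] by (simp add: qlin_rep_coset Bbal_zero[OF B])
    qed
    also have "\<dots> = ?P ?\<beta> (bact X b (pT T S t))"
      using bal \<beta> by (simp add: balanced_def)
    also have "\<dots> = Tau (\<lambda>m p. Z_proj n bs (p * rep (pT T S t) * m)) b"
      by (simp add: X_sel(3) lin_apply[OF add] Tau_def case_prod_unfold flip: Z_proj_def)
    also have "\<dots> = Tau (\<lambda>m p. Z_proj n bs (p * t * m)) b"
    proof (rule rep_pT)
      show "Tlinear (\<lambda>t. Tau (\<lambda>m p. Z_proj n bs (p * t * m)) b)"
        by (intro klinear_Tau klinear_mult_left[OF klinear_mult_right[OF add]])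
      show "Tau (\<lambda>m p. Z_proj n bs (p * (s * t) * m)) b = Tau (\<lambda>m p. Z_proj n bs (p * (t * s) * m)) b" if "s \<in> S" for s t
        by (rule Tau_trace[OF add comm that])
    qed
    finally show "Dn n (\<lambda>cs. Z_proj n (map2 (*) bs cs) t) b = Tau (\<lambda>m p. Z_proj n bs (p * t * m)) b" .
  qed
  with B show ?thesis unfolding ZBbal_def by blast
qed

text \<open>Expresses membership in \<open>ZB_rel\<close> through a \<open>ZBbal\<close> map, to
  which pullbacks can be applied.\<close>

lemma proj_ev:
  assumes u: "u \<in> ZF n"
  shows "proj (ZB_rel \<B> X n) u = qlin (ev (Z_proj n)) u"
  unfolding proj_eq_lin[of _ u]
proof (rule lin_cong)
  fix z assume "z \<in> Poly_Mapping.keys u"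
  then obtain v t where "v \<in> tuples (Suc n)" "z = (v +o Bpow_rel \<B> (Suc n), pT T S t)"
    using u by (auto simp: ZF_def Bpow_sel X_sel(1))
  then show "proj (ZB_rel \<B> X n) (gen z) = ev (Z_proj n) z"
    by (simp add: Z_proj_coset ev_coset[OF ZBbal_Z_proj])
qed

end

lemma pow_balanced_init:
  fixes f :: "'m::plus list \<Rightarrow> ('y, 'k::{comm_ring,comm_monoid_mult}) quo"
  assumes f: "pow_balanced sc A ra la (Suc l) f"
  shows "pow_balanced sc A ra la l (\<lambda>xs. f (xs @ [y]))"
  unfolding pow_balanced_def multilinear_def
proof (intro conjI allI impI)
  fix xs :: "'m list" and i assume "length xs = l \<and> i < l"
  then show "klinear sc qscale (\<lambda>x. f (xs[i := x] @ [y]))"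
    using f[unfolded pow_balanced_def multilinear_def, THEN conjunct1, rule_format, of "xs @ [y]" i]
    by (simp add: list_update_append)
next
  fix xs :: "'m list" and i a assume "length xs = l \<and> Suc i < l \<and> a \<in> A"
  then show "f (xs[i := ra (xs ! i) a] @ [y]) = f (xs[Suc i := la a (xs ! Suc i)] @ [y])"
    using f[unfolded pow_balanced_def, THEN conjunct2, rule_format, of "xs @ [y]" i a]
    by (simp add: list_update_append nth_append)
qed

context hopf_galois
begin

section \<open>The isomorphism\<close>

definition Phi_form :: "nat \<Rightarrow> ('t list \<Rightarrow> ('y, 'k) quo) \<Rightarrow> 'b list \<Rightarrow> 't \<Rightarrow> ('y, 'k) quo" where
  "Phi_form n k bs t = Chain (\<lambda>ts. k (wrap n ts)) bs t"

definition Phi :: "nat \<Rightarrow> ('b list \<Rightarrow>\<^sub>0 'k) set \<times> 't set \<Rightarrow> ('t list \<Rightarrow>\<^sub>0 'k)" where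
  "Phi n z = flin (\<lambda>bs. flin (\<lambda>ts. gen (wrap n ts)) (chain bs (rep (snd z)))) (rep (fst z))"

lemma qlin_Phi: "qlin k (Phi n z) = ev (Phi_form n k) z"
  by (simp add: Phi_def ev_def Phi_form_def Chain_def qlin_flin qlin_gen)

lemma Sbal_wrap: "Cbal (Suc n) k \<Longrightarrow> Sbal (Suc (Suc n)) (\<lambda>ts. k (wrap n ts))"
  using Cbal_mult_at[of "Suc n" k "Suc n"] by (simp add: Cbal_def)

lemma ZBbal_Phi_form:
  assumes k: "Cbal (Suc n) k"
  shows "ZBbal n (Phi_form n k)"
  unfolding ZBbal_def
proof (intro conjI allI impI ballI)
  note h = Sbal_wrap[OF k]
  show "Bbal (Suc n) (\<lambda>bs. Phi_form n k bs t)" for t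
    unfolding Phi_form_def by (rule Bbal_Chain[OF h])
  fix bs :: "'b list" assume bs: "length bs = Suc n"
  then have h': "Sbal (Suc (length bs)) (\<lambda>ts. k (wrap n ts))" using h by simp
  show "Tlinear (Phi_form n k bs)"
    unfolding Phi_form_def by (rule klinear_Chain[OF h'])
  have last: "Chain (\<lambda>ts. k (wrap n (butlast ts @ [last ts * p]))) bs t = Chain (\<lambda>ts. k (wrap n ts)) bs (p * t)" for p t
    unfolding Chain_left by (rule Chain_cong) (simp add: wrap_last_mult bs)
  show "Phi_form n k bs (s * t) = Phi_form n k bs (t * s)" if "s \<in> S" for s t
    unfolding Phi_form_def Chain_right_S[OF h' that] last ..
  show "Dn n (\<lambda>cs. Phi_form n k (map2 (*) bs cs) t) b = Tau (\<lambda>m p. Phi_form n k bs (p * t * m)) b" for b t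
    unfolding Phi_form_def Dn_Chain[OF h bs] last by (simp add: mult.assoc)
qed

lemma wrap_snoc_one: "length ts = Suc n \<Longrightarrow> wrap n (butlast ts @ [last ts * 1, 1]) = ts"
  by (cases ts; cases "tl ts" rule: rev_cases) (auto simp: mult_at_def nth_append butlast_append)

text \<open>The translation map sends \<open>1\<close> to \<open>1 \<otimes> 1\<close>, so wrapping
  merely removes the trailing \<open>1\<close>. The work is in showing that \<open>Tau_one\<close>
  applies, that is, that the form is balanced over \<open>S\<close> in the legs of the last
  factor.\<close>

lemma Phi_form_snoc_one:
  assumes k: "Cbal (Suc n) k" and c: "length c = n"
  shows "Phi_form n k (c @ [1]) t = Chain k c t"
proof -
  note h = Sbal_wrap[OF k]
  have "TTbal (\<lambda>m p. Chain (\<lambda>ts. k (wrap n (butlast ts @ [last ts * m, p]))) c t)"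
    unfolding TTbal_iff
  proof (intro conjI allI ballI)
    show "Tlinear (\<lambda>m. Chain (\<lambda>ts. k (wrap n (butlast ts @ [last ts * m, p]))) c t)" for p
    proof (rule klinear_Chain_fun, rule klinear_mult_left)
      fix ts :: "'t list" assume "length ts = Suc (length c)"
      then show "Tlinear (\<lambda>x. k (wrap n (butlast ts @ [x, p])))"
        using h[unfolded Sbal_def pow_balanced_def multilinear_def, THEN conjunct1, rule_format,
            of "butlast ts @ [undefined, p]" n] c
        by (simp add: list_update_append)
    qed
    show "Tlinear (\<lambda>p. Chain (\<lambda>ts. k (wrap n (butlast ts @ [last ts * m, p]))) c t)" for m
      using Sbal_last[OF h, of "butlast _ @ [last _ * m]"] c by (intro klinear_Chain_fun) simp
    fix m s p assume s: "s \<in> S"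
    show "Chain (\<lambda>ts. k (wrap n (butlast ts @ [last ts * (m * s), p]))) c t =
        Chain (\<lambda>ts. k (wrap n (butlast ts @ [last ts * m, s * p]))) c t"
    proof (rule Chain_cong)
      fix ts :: "'t list" assume "length ts = Suc (length c)"
      then show "k (wrap n (butlast ts @ [last ts * (m * s), p])) = k (wrap n (butlast ts @ [last ts * m, s * p]))"
        using h[unfolded Sbal_def pow_balanced_def, THEN conjunct2, rule_format,
            of "butlast ts @ [last ts * m, p]" n s] c s
        by (simp add: list_update_append nth_append mult.assoc)
    qed
  qed
  then have "Phi_form n k (c @ [1]) t = Chain (\<lambda>ts. k (wrap n (butlast ts @ [last ts * 1, 1]))) c t"
    by (simp add: Phi_form_def Chain_snoc Tau_one)
  also have "\<dots> = Chain k c t"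
    by (rule Chain_cong) (simp only: wrap_snoc_one c)
  finally show ?thesis .
qed

lemma ev_cong:
  assumes "z \<in> carr (Bpow \<B> (Suc n)) \<times> carr X" "\<And>bs t. length bs = Suc n \<Longrightarrow> H bs t = H' bs t"
  shows "ev H z = ev H' z"
  unfolding ev_def
proof (rule lin_cong)
  fix bs assume "bs \<in> Poly_Mapping.keys (rep (fst z))"
  then have "length bs = Suc n" using rep_tuples[of "fst z" "Suc n"] assms(1) by (cases z) auto
  then show "H bs (rep (snd z)) = H' bs (rep (snd z))" by (rule assms(2))
qed

lemma Dn_one: "Bbal (Suc n) f \<Longrightarrow> Dn n f 1 = f (replicate (Suc n) 1)"
proof (induction n arbitrary: f)
  case (Suc n)
  then show ?case
    by (simp add: Dn_Suc D_one[OF BBbal_Dn] Bbal_tail)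
qed (simp add: Dn_0)

lemma map2_replicate_one: "length bs = n \<Longrightarrow> map2 (*) bs (replicate n 1) = (bs :: 'b list)"
  by (induction bs arbitrary: n) auto

text \<open>Balancing between \<open>T\<close> and the first factor is hidden in the diagonal action
  of \<open>zeta r\<close>. On the \<B>-factors it multiplies the first one only; on the other side
  its translation is \<open>j r \<otimes> 1\<close>, so \<open>t\<close> becomes
  \<open>t * j r\<close>.\<close>

lemma Qbal_ZBbal:
  assumes H: "ZBbal n H"
  shows "Qbal n (\<lambda>t c. H (c @ [1]) t)"
  unfolding Qbal_def
proof (intro conjI allI impI)
  show "Tlinear (\<lambda>t. H (c @ [1]) t)" if "length c = n" for c
    using H that by (simp add: ZBbal_def)
  show "Bbal n (\<lambda>c. H (c @ [1]) t)" for t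
    using H unfolding ZBbal_def Bbal_def by (intro pow_balanced_init) blast
  fix t r b and c :: "'b list" assume n: "n = Suc (length c)"
  let ?bs = "b # c @ [1]"
  have bs: "length ?bs = Suc n" "length (b * zeta \<B> r # c @ [1]) = Suc n" using n by simp_all
  have B: "Bbal (Suc n) (\<lambda>cs. H (map2 (*) bs cs) t)" if "length bs = Suc n" for bs
    using Bbal_map2[of bs "\<lambda>cs. H cs t"] H that by (simp add: ZBbal_def)
  have add: "Tlinear (H ?bs)" and comm: "\<And>s t. s \<in> S \<Longrightarrow> H ?bs (s * t) = H ?bs (t * s)"
    using H bs(1) unfolding ZBbal_def by blast+
  have TT: "TTbal (\<lambda>m p. H ?bs (p * t * m))"
    by (rule TTbal_trace[OF add comm])
  have "H ?bs (t * j r) = Tau (\<lambda>m p. H ?bs (p * t * m)) (zeta \<B> r)"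
    using Tau_zeta[OF TT, of 1 r] Tau_one[OF TTbal_left_mult[OF TT], of "j r"] by simp
  also have "\<dots> = Dn n (\<lambda>cs. H (map2 (*) ?bs cs) t) (zeta \<B> r)"
    using H bs(1) unfolding ZBbal_def by metis
  also have "\<dots> = Dn n (\<lambda>cs. H (map2 (*) ?bs (zeta \<B> r * hd cs # tl cs)) t) 1"
    using Dn_zeta_left[OF B[OF bs(1)], of r 1] by simp
  also have "\<dots> = Dn n (\<lambda>cs. H (map2 (*) (b * zeta \<B> r # c @ [1]) cs) t) 1"
  proof (rule Dn_cong)
    fix cs :: "'b list" assume "length cs = Suc n"
    then show "H (map2 (*) ?bs (zeta \<B> r * hd cs # tl cs)) t = H (map2 (*) (b * zeta \<B> r # c @ [1]) cs) t"
      by (cases cs) (simp_all add: mult.assoc)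
  qed
  also have "\<dots> = H (b * zeta \<B> r # c @ [1]) t"
    by (simp only: Dn_one[OF B[OF bs(2)]] map2_replicate_one[OF bs(2)])
  finally show "H ((b # c) @ [1]) (t * j r) = H ((b * zeta \<B> r # c) @ [1]) t" by simp
qed

lemma Cbal_Cochain_ZBbal:
  assumes H: "ZBbal n H"
  shows "Cbal (Suc n) (Cochain (\<lambda>t c. H (c @ [1]) t))"
proof (rule Cbal_Cochain[OF Qbal_ZBbal[OF H]])
  fix s t and c :: "'b list" assume "s \<in> S" "length c = n"
  moreover from this have "length (c @ [1]) = Suc n" by simp
  ultimately show "H (c @ [1]) (s * t) = H (c @ [1]) (t * s)"
    using H unfolding ZBbal_def by blast
qed

text \<open>On lists ending in \<open>1\<close> both sides agree by \<open>Chain_Cochain\<close>.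
  Being balanced over \<B>, they agree on the diagonal translates of such lists, and by
  \<open>Bbal_eq_0\<close> these generate.\<close>

lemma Phi_form_Cochain:
  assumes H: "ZBbal n H" and bs: "length bs = Suc n"
  shows "Phi_form n (Cochain (\<lambda>t c. H (c @ [1]) t)) bs t = H bs t"
proof -
  let ?k = "Cochain (\<lambda>t c. H (c @ [1]) t)"
  note k = Cbal_Cochain_ZBbal[OF H]
  note H' = ZBbal_Phi_form[OF k]
  have one: "Phi_form n ?k (c @ [1]) t = H (c @ [1]) t" if "length c = n" for c t
    using Phi_form_snoc_one[OF k that] Chain_Cochain[of c "\<lambda>t c. H (c @ [1]) t"] Qbal_ZBbal[OF H] that by simp
  have "Phi_form n ?k bs t - H bs t = 0"
  proof (rule Bbal_eq_0[OF _ _ bs])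
    have "Bbal (Suc n) (\<lambda>bs. Phi_form n ?k bs t)" "Bbal (Suc n) (\<lambda>bs. H bs t)"
      using H H' by (simp_all add: ZBbal_def)
    then show "Bbal (Suc n) (\<lambda>bs. Phi_form n ?k bs t - H bs t)"
      by (simp add: Bbal_def pow_balanced_def multilinear_def klinear_def scalingD(8)[OF scaling_qscale])
    fix c :: "'b list" and d assume c: "length c = n"
    have "Dn n (\<lambda>cs. Phi_form n ?k (map2 (*) (c @ [1]) cs) t - H (map2 (*) (c @ [1]) cs) t) d =
      Dn n (\<lambda>cs. Phi_form n ?k (map2 (*) (c @ [1]) cs) t) d - Dn n (\<lambda>cs. H (map2 (*) (c @ [1]) cs) t) d"
      using Dn_fun_add[of n "\<lambda>cs. Phi_form n ?k (map2 (*) (c @ [1]) cs) t - H (map2 (*) (c @ [1]) cs) t"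
          "\<lambda>cs. H (map2 (*) (c @ [1]) cs) t" d] by simp
    also have "Dn n (\<lambda>cs. Phi_form n ?k (map2 (*) (c @ [1]) cs) t) d = Tau (\<lambda>m p. Phi_form n ?k (c @ [1]) (p * t * m)) d"
      using H' c by (simp add: ZBbal_def)
    also have "Dn n (\<lambda>cs. H (map2 (*) (c @ [1]) cs) t) d = Tau (\<lambda>m p. H (c @ [1]) (p * t * m)) d"
      using H c by (simp add: ZBbal_def)
    finally show "Dn n (\<lambda>cs. Phi_form n ?k (map2 (*) (c @ [1]) cs) t - H (map2 (*) (c @ [1]) cs) t) d = 0"
      by (simp add: one[OF c])
  qed
  then show ?thesis by simp
qed

lemma cyc_rel_iff:
  "u \<in> cyc_rel T S l \<longleftrightarrow> qlin (\<lambda>ts. proj (cyc_rel T S l) (gen ts)) u = 0"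
  by (simp add: proj_eq_0_iff flip: proj_eq_lin)

text \<open>Well-definedness and injectivity of the comparison map in one statement. For the
  direction from left to right, the universal map \<open>Z_proj n\<close> is itself a pullback along
  \<open>Phi n\<close>, by \<open>Phi_form_Cochain\<close>, and hence kills
  \<open>w\<close>.\<close>

lemma Phi_mem_iff:
  assumes w: "w \<in> ZF n"
  shows "flin (Phi n) w \<in> cyc_rel T S (Suc n) \<longleftrightarrow> w \<in> ZB_rel \<B> X n"
proof
  assume "w \<in> ZB_rel \<B> X n"
  then show "flin (Phi n) w \<in> cyc_rel T S (Suc n)"
    unfolding cyc_rel_iff by (simp add: qlin_flin qlin_Phi ZB_zero[OF ZBbal_Phi_form[OF Cbal_proj]])
next
  assume "flin (Phi n) w \<in> cyc_rel T S (Suc n)"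
  then have "qlin (Cochain (\<lambda>t c. Z_proj n (c @ [1]) t)) (flin (Phi n) w) = 0"
    by (rule cyc_rel_zero[OF Cbal_Cochain_ZBbal[OF ZBbal_Z_proj]])
  moreover have "qlin (ev (Phi_form n (Cochain (\<lambda>t c. Z_proj n (c @ [1]) t)))) w = qlin (ev (Z_proj n)) w"
  proof (rule lin_cong, rule ev_cong)
    fix z assume "z \<in> Poly_Mapping.keys w"
    then show "z \<in> carr (Bpow \<B> (Suc n)) \<times> carr X" using w by (auto simp: ZF_def)
  qed (rule Phi_form_Cochain[OF ZBbal_Z_proj])
  ultimately have "qlin (ev (Z_proj n)) w = 0" by (simp add: qlin_flin qlin_Phi)
  then show "w \<in> ZB_rel \<B> X n" using proj_ev[OF w] by (simp add: proj_eq_0_iff)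
qed

lemma keys_Phi:
  assumes "z \<in> carr (Bpow \<B> (Suc n)) \<times> carr X"
  shows "Phi n z \<in> tuples (Suc n)"
proof -
  have "Poly_Mapping.keys (flin (\<lambda>ts. gen (wrap n ts)) (chain bs t)) \<subseteq> {ts. length ts = Suc n}"
    if "length bs = Suc n" for bs t
    using subsetD[OF keys_chain[of bs t]] that
    by (intro keys_lin order_trans[OF keys_gen]) (auto simp: length_mult_at)
  moreover have "rep (fst z) \<in> tuples (Suc n)" using rep_tuples[of "fst z" "Suc n"] assms by (cases z) auto
  ultimately show ?thesis
    unfolding Phi_def mem_Collect_eq by - (rule keys_lin, blast)
qed

lemma flin_Phi: "u \<in> ZF n \<Longrightarrow> flin (Phi n) u \<in> tuples (Suc n)"
  using keys_Phi unfolding ZF_def mem_Collect_eq by - (rule keys_lin, blast)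

lemma Z_B_sel:
  "deg (Z_B \<B> X) n = quot fscale (ZF n) (ZB_rel \<B> X n)"
  "face (Z_B \<B> X) (Suc n) k = induced (ZB_rel \<B> X n)
     (\<lambda>(\<beta>, x). gen (induced (Bpow_rel \<B> (Suc n)) (\<lambda>bs. gen (eps_at \<B> (Suc n) k bs)) \<beta>, x))"
  "degen (Z_B \<B> X) n k = induced (ZB_rel \<B> X (Suc n))
     (\<lambda>(\<beta>, x). gen (induced (Bpow_rel \<B> (Suc (Suc n))) (cop_at \<B> k) \<beta>, x))"
  "cyc (Z_B \<B> X) n = induced (ZB_rel \<B> X n)
     (\<lambda>(\<beta>, x). flin (\<lambda>bs. flin (\<lambda>(x0, b).
        gen (gen ((last bs * b) # butlast bs) +o Bpow_rel \<B> (Suc n), x0)) (rep (bcoact X x))) (rep \<beta>))"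
  by (simp_all add: Z_B_def tensor_def ZF_def ZB_rel_def)

definition comparison :: "nat \<Rightarrow> (('b list \<Rightarrow>\<^sub>0 'k) set \<times> 't set \<Rightarrow>\<^sub>0 'k) set \<Rightarrow> ('t list \<Rightarrow>\<^sub>0 'k) set" where
  "comparison n = induced (cyc_rel T S (Suc n)) (Phi n)"

lemma comparison_coset:
  "comparison n (u +o ZB_rel \<B> X n) = flin (Phi n) u +o cyc_rel T S (Suc n)"
  unfolding comparison_def
  by (rule induced_coset) (use ZB_rel_subset Phi_mem_iff in auto)

lemma kmod_iso_comparison: "kmod_iso (deg (Z_B \<B> X) n) (deg (Z_T T S) n) (comparison n)"
  unfolding kmod_iso_def bij_betw_def
proof (intro conjI)
  show "kmod_hom (deg (Z_B \<B> X) n) (deg (Z_T T S) n) (comparison n)"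
    unfolding Z_B_sel Z_T_sel comparison_def
    by (rule kmod_hom_induced) (use ZB_rel_subset Phi_mem_iff flin_Phi in auto)
  show "inj_on (comparison n) (carr (deg (Z_B \<B> X) n))"
  proof (rule inj_onI)
    fix x y assume "x \<in> carr (deg (Z_B \<B> X) n)" "y \<in> carr (deg (Z_B \<B> X) n)" and eq: "comparison n x = comparison n y"
    then obtain u v where u: "u \<in> ZF n" "x = u +o ZB_rel \<B> X n" and v: "v \<in> ZF n" "y = v +o ZB_rel \<B> X n"
      unfolding Z_B_sel quot_sel by blast
    have "flin (Phi n) (u - v) \<in> cyc_rel T S (Suc n)"
      using eq by (simp add: u v comparison_coset coset_eq_iff[OF cyc_rel_sub] lin_diff)
    then have "u - v \<in> ZB_rel \<B> X n"
      using Phi_mem_iff[OF ksubmoduleD(5)[OF ZF_sub u(1) v(1)]] by simp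
    then show "x = y" unfolding u v by (rule coset_eqI[OF ZB_rel_sub])
  qed
  show "comparison n ` carr (deg (Z_B \<B> X) n) = carr (deg (Z_T T S) n)"
  proof
    show "comparison n ` carr (deg (Z_B \<B> X) n) \<subseteq> carr (deg (Z_T T S) n)"
      unfolding Z_T_sel Z_B_sel(1) quot_sel(1)[of fscale "ZF n"]
      using coset_in_carr[OF flin_Phi] by (auto simp: comparison_coset simp del: mem_Collect_eq)
    show "carr (deg (Z_T T S) n) \<subseteq> comparison n ` carr (deg (Z_B \<B> X) n)"
    proof
      fix y assume "y \<in> carr (deg (Z_T T S) n)"
      then obtain v where v: "v \<in> tuples (Suc n)" "y = v +o cyc_rel T S (Suc n)"
        unfolding Z_T_sel quot_sel by blast
      let ?g = "\<lambda>(t, c). (gen (c @ [1]) +o Bpow_rel \<B> (Suc n), pT T S t)"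
      \<comment> \<open>The preimage is the cochain of \<open>v\<close> with \<open>1\<close>
        appended as last \<B>-factor. As a preimage is needed only for each single \<open>v\<close>,
        no relations have to be respected.\<close>
      define w where "w = flin (\<lambda>ts. flin (\<lambda>z. gen (?g z)) (cochain ts)) v"
      have c: "gen (c @ [1]) \<in> tuples (Suc n)" if "length c = n" for c :: "'b list"
        by (rule gen_in_keys) (use that in simp)
      have "Poly_Mapping.keys (flin (\<lambda>z. gen (?g z)) (cochain ts)) \<subseteq> carr (Bpow \<B> (Suc n)) \<times> carr X"
        if len: "length ts = Suc n" for ts
      proof (rule keys_lin)
        fix z assume "z \<in> Poly_Mapping.keys (cochain ts)"
        then obtain t and d :: "'b list" where z: "z = (t, d)" "length d = n"
          using subsetD[OF keys_cochain[of ts]] len by (cases z) auto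
        show "Poly_Mapping.keys (gen (?g z)) \<subseteq> carr (Bpow \<B> (Suc n)) \<times> carr X"
          using coset_in_Bpow[OF c[OF z(2)]] by (intro order_trans[OF keys_gen]) (simp add: z)
      qed
      then have w: "w \<in> ZF n"
        using v(1) unfolding w_def ZF_def mem_Collect_eq by - (rule keys_lin, blast)
      let ?k = "\<lambda>ts. proj (cyc_rel T S (Suc n)) (gen ts)"
      have "qlin ?k (flin (Phi n) w) = qlin (\<lambda>ts. Cochain (\<lambda>t c. ev (Phi_form n ?k) (?g (t, c))) ts) v"
        by (simp add: w_def qlin_flin qlin_gen qlin_Phi Cochain_def case_prod_unfold)
      also have "\<dots> = qlin ?k v"
      proof (rule lin_cong)
        fix ts assume "ts \<in> Poly_Mapping.keys v"
        then have ts: "length ts = Suc n" using v(1) by auto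
        have "Cochain (\<lambda>t c. ev (Phi_form n ?k) (?g (t, c))) ts = Cochain (\<lambda>t c. Chain ?k c t) ts"
        proof (rule Cochain_cong)
          fix t and c :: "'b list" assume "Suc (length c) = length ts"
          then have "length c = n" using ts by simp
          then show "ev (Phi_form n ?k) (?g (t, c)) = Chain ?k c t"
            using ev_coset[OF ZBbal_Phi_form[OF Cbal_proj] c] Phi_form_snoc_one[OF Cbal_proj]
            by (simp add: qlin_gen)
        qed
        also have "\<dots> = ?k ts"
          using Cbal_proj[of "Suc n"] ts by (intro Cochain_Chain) (auto simp: Cbal_def)
        finally show "Cochain (\<lambda>t c. ev (Phi_form n ?k) (?g (t, c))) ts = ?k ts" .
      qed
      finally have "flin (Phi n) w - v \<in> cyc_rel T S (Suc n)"
        by (simp add: cyc_rel_iff qlin_diff)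
      then have "comparison n (w +o ZB_rel \<B> X n) = y"
        unfolding comparison_coset v(2) by (rule coset_eqI[OF cyc_rel_sub])
      then show "y \<in> comparison n ` carr (deg (Z_B \<B> X) n)"
        unfolding Z_B_sel using coset_in_carr[OF w] by blast
    qed
  qed
qed

text \<open>That \<open>f\<close> respects \<open>ZB_rel\<close> is not checked directly: on formal
  sums \<open>Phi\<close> intertwines \<open>f\<close> with \<open>q\<close> modulo
  \<open>cyc_rel\<close>, the list operation preserves relations, and \<open>Phi_mem_iff\<close>
  reflects them back.\<close>

lemma list_op_transport:
  assumes q: "\<And>k :: 't list \<Rightarrow> ('t list, 'k) quo. Cbal (Suc n') k \<Longrightarrow> Cbal (Suc n) (\<lambda>ts. k (q ts))"
    and f: "\<And>z. z \<in> carr (Bpow \<B> (Suc n)) \<times> carr X \<Longrightarrow> f z \<in> ZF n'"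
    and key: "\<And>z (k :: 't list \<Rightarrow> ('t list, 'k) quo). z \<in> carr (Bpow \<B> (Suc n)) \<times> carr X \<Longrightarrow> Cbal (Suc n') k \<Longrightarrow>
      qlin (ev (Phi_form n' k)) (f z) = ev (Phi_form n (\<lambda>ts. k (q ts))) z"
  shows "kmod_hom (deg (Z_B \<B> X) n) (deg (Z_B \<B> X) n') (induced (ZB_rel \<B> X n') f)"
    and "x \<in> carr (deg (Z_B \<B> X) n) \<Longrightarrow>
      comparison n' (induced (ZB_rel \<B> X n') f x) =
      induced (cyc_rel T S (Suc n')) (\<lambda>ts. gen (q ts)) (comparison n x)"
proof -
  let ?k = "\<lambda>ts. proj (cyc_rel T S (Suc n')) (gen ts)"
  have F: "flin f u \<in> ZF n'" if "u \<in> ZF n" for u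
    using that f unfolding ZF_def mem_Collect_eq by - (rule keys_lin, blast)
  have eq: "qlin ?k (flin (Phi n') (flin f u)) = qlin ?k (flin (\<lambda>ts. gen (q ts)) (flin (Phi n) u))"
    if u: "u \<in> ZF n" for u
  proof -
    have "qlin (\<lambda>z. qlin (ev (Phi_form n' ?k)) (f z)) u = qlin (ev (Phi_form n (\<lambda>ts. ?k (q ts)))) u"
      using u by (intro lin_cong key Cbal_proj) (auto simp: ZF_def)
    then show ?thesis by (simp add: qlin_flin qlin_Phi qlin_gen)
  qed
  have kill: "flin f u \<in> ZB_rel \<B> X n'" if "u \<in> ZB_rel \<B> X n" for u
  proof -
    have u: "u \<in> ZF n" using that ZB_rel_subset by blast
    have "flin (\<lambda>ts. gen (q ts)) (flin (Phi n) u) \<in> cyc_rel T S (Suc n')"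
      by (rule cyc_rel_list_op[OF q]) (use that u Phi_mem_iff in auto)
    then have "flin (Phi n') (flin f u) \<in> cyc_rel T S (Suc n')"
      by (simp add: cyc_rel_iff eq[OF u])
    then show ?thesis using Phi_mem_iff[OF F[OF u]] by simp
  qed
  show "kmod_hom (deg (Z_B \<B> X) n) (deg (Z_B \<B> X) n') (induced (ZB_rel \<B> X n') f)"
    unfolding Z_B_sel by (rule kmod_hom_induced) (use kill F in auto)
  assume "x \<in> carr (deg (Z_B \<B> X) n)"
  then obtain u where u: "u \<in> ZF n" "x = u +o ZB_rel \<B> X n" unfolding Z_B_sel quot_sel by blast
  have "induced (ZB_rel \<B> X n') f x = flin f u +o ZB_rel \<B> X n'"
    unfolding u by (rule induced_coset) (use kill in auto)
  moreover have "induced (cyc_rel T S (Suc n')) (\<lambda>ts. gen (q ts)) (comparison n x) =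
     flin (\<lambda>ts. gen (q ts)) (flin (Phi n) u) +o cyc_rel T S (Suc n')"
    unfolding u comparison_coset by (rule induced_coset) (use cyc_rel_list_op[OF q] in auto)
  moreover have "flin (Phi n') (flin f u) +o cyc_rel T S (Suc n') =
      flin (\<lambda>ts. gen (q ts)) (flin (Phi n) u) +o cyc_rel T S (Suc n')"
    using eq[OF u(1)] by (intro coset_eqI[OF cyc_rel_sub]) (simp add: cyc_rel_iff qlin_diff)
  ultimately show "comparison n' (induced (ZB_rel \<B> X n') f x) =
      induced (cyc_rel T S (Suc n')) (\<lambda>ts. gen (q ts)) (comparison n x)"
    by (simp add: comparison_coset)
qed

lemma ZF_gen: "\<beta> \<in> carr (Bpow \<B> (Suc n)) \<Longrightarrow> x \<in> carr X \<Longrightarrow> gen (\<beta>, x) \<in> ZF n"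
  unfolding ZF_def by (rule gen_in_keys) simp

lemma induced_in_Bpow:
  assumes "\<beta> \<in> carr (Bpow \<B> l)" "\<And>bs. length bs = l \<Longrightarrow> g bs \<in> tuples l'"
  shows "induced (Bpow_rel \<B> l') g \<beta> \<in> carr (Bpow \<B> l')"
proof -
  have "flin g (rep \<beta>) \<in> tuples l'"
    using rep_tuples[OF assms(1)] assms(2) unfolding mem_Collect_eq by - (rule keys_lin, blast)
  then show ?thesis unfolding induced_def by (rule coset_in_Bpow)
qed

text \<open>Faces and degeneracies leave the \<open>T_S\<close>-factor alone, so their compatibility
  can be tested on lists of elements of \<B>.\<close>

lemma ev_gen_induced:
  assumes k: "Cbal (Suc n') k" and \<beta>: "\<beta> \<in> carr (Bpow \<B> (Suc n))"
    and g: "\<And>bs t. length bs = Suc n \<Longrightarrow> qlin (\<lambda>bs. Phi_form n' k bs t) (g bs) = Phi_form n k' bs t"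
  shows "ev (Phi_form n' k) (induced (Bpow_rel \<B> (Suc n')) g \<beta>, x) = ev (Phi_form n k') (\<beta>, x)"
proof -
  have B: "Bbal (Suc n') (\<lambda>bs. Phi_form n' k bs t)" for t
    using ZBbal_Phi_form[OF k] by (simp add: ZBbal_def)
  have "ev (Phi_form n' k) (induced (Bpow_rel \<B> (Suc n')) g \<beta>, x) =
      qlin (\<lambda>bs. qlin (\<lambda>bs. Phi_form n' k bs (rep x)) (g bs)) (rep \<beta>)"
    by (simp add: ev_def qlin_rep_induced Bbal_zero[OF B])
  also have "\<dots> = qlin (\<lambda>bs. Phi_form n k' bs (rep x)) (rep \<beta>)"
    using rep_tuples[OF \<beta>] by (intro lin_cong g) auto
  finally show ?thesis by (simp add: ev_def)
qed

lemma face_transport: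
  assumes k: "i \<le> Suc n"
  shows "kmod_hom (deg (Z_B \<B> X) (Suc n)) (deg (Z_B \<B> X) n) (face (Z_B \<B> X) (Suc n) i)"
    and "x \<in> carr (deg (Z_B \<B> X) (Suc n)) \<Longrightarrow>
      comparison n (face (Z_B \<B> X) (Suc n) i x) = face (Z_T T S) (Suc n) i (comparison (Suc n) x)"
proof -
  let ?f = "\<lambda>(\<beta>, x). gen (induced (Bpow_rel \<B> (Suc n)) (\<lambda>bs. gen (eps_at \<B> (Suc n) i bs)) \<beta>, x)"
  have q: "Cbal (Suc (Suc n)) (\<lambda>ts. k (mult_at (Suc n) i ts))"
    if "Cbal (Suc n) k" for k :: "'t list \<Rightarrow> ('t list, 'k) quo"
    by (rule Cbal_mult_at[OF that k]) simp
  have len: "gen (eps_at \<B> (Suc n) i bs) \<in> tuples (Suc n)" if "length bs = Suc (Suc n)" for bs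
    by (rule gen_in_keys) (use that k in \<open>auto simp: eps_at_def\<close>)
  have f: "?f z \<in> ZF n" if "z \<in> carr (Bpow \<B> (Suc (Suc n))) \<times> carr X" for z
    using that len by (auto intro!: ZF_gen induced_in_Bpow simp del: mem_Collect_eq)
  have key: "qlin (ev (Phi_form n k)) (?f z) = ev (Phi_form (Suc n) (\<lambda>ts. k (mult_at (Suc n) i ts))) z"
    if z: "z \<in> carr (Bpow \<B> (Suc (Suc n))) \<times> carr X" and k': "Cbal (Suc n) k"
    for z and k :: "'t list \<Rightarrow> ('t list, 'k) quo"
  proof -
    obtain \<beta> x where z': "z = (\<beta>, x)" "\<beta> \<in> carr (Bpow \<B> (Suc (Suc n)))" using z by auto
    have "qlin (\<lambda>bs. Phi_form n k bs t) (gen (eps_at \<B> (Suc n) i bs)) =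
        Phi_form (Suc n) (\<lambda>ts. k (mult_at (Suc n) i ts)) bs t" if bs: "length bs = Suc (Suc n)" for bs t
    proof -
      have "Chain (\<lambda>ts. k (wrap n ts)) (eps_at \<B> (Suc n) i bs) t =
          Chain (\<lambda>ts. k (wrap n (mult_at (Suc (Suc n)) i ts))) bs t"
        by (rule Chain_eps[OF bs _ k Sbal_wrap[OF k']]) simp
      \<comment> \<open>With \<open>wrap\<close> as the last face, this is the simplicial identity
        \<open>d_(n+1) d_i = d_i d_(n+2)\<close>.\<close>
      also have "\<dots> = Chain (\<lambda>ts. k (mult_at (Suc n) i (wrap (Suc n) ts))) bs t"
      proof (rule Chain_cong)
        fix ts :: "'t list" assume "length ts = Suc (length bs)"
        then show "k (wrap n (mult_at (Suc (Suc n)) i ts)) = k (mult_at (Suc n) i (wrap (Suc n) ts))"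
          using mult_at_mult_at[of ts n "Suc (Suc n)" i] \<open>i \<le> Suc n\<close> bs by simp
      qed
      finally show ?thesis by (simp add: Phi_form_def qlin_gen)
    qed
    from ev_gen_induced[OF k' z'(2) this] show ?thesis by (simp add: z'(1) qlin_gen)
  qed
  show "kmod_hom (deg (Z_B \<B> X) (Suc n)) (deg (Z_B \<B> X) n) (face (Z_B \<B> X) (Suc n) i)"
    unfolding Z_B_sel(2) by (rule list_op_transport(1)[OF q f key])
  show "x \<in> carr (deg (Z_B \<B> X) (Suc n)) \<Longrightarrow>
      comparison n (face (Z_B \<B> X) (Suc n) i x) = face (Z_T T S) (Suc n) i (comparison (Suc n) x)"
    unfolding Z_B_sel(2) Z_T_sel(2) by (rule list_op_transport(2)[OF q f key])
qed

lemma degen_transport: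
  assumes k: "i \<le> n"
  shows "kmod_hom (deg (Z_B \<B> X) n) (deg (Z_B \<B> X) (Suc n)) (degen (Z_B \<B> X) n i)"
    and "x \<in> carr (deg (Z_B \<B> X) n) \<Longrightarrow>
      comparison (Suc n) (degen (Z_B \<B> X) n i x) = degen (Z_T T S) n i (comparison n x)"
proof -
  let ?f = "\<lambda>(\<beta>, x). gen (induced (Bpow_rel \<B> (Suc (Suc n))) (cop_at \<B> i) \<beta>, x)"
  have q: "Cbal (Suc n) (\<lambda>ts. k (insert_one i ts))"
    if "Cbal (Suc (Suc n)) k" for k :: "'t list \<Rightarrow> ('t list, 'k) quo"
    by (rule Cbal_insert_one[OF that k])
  have len: "cop_at \<B> i bs \<in> tuples (Suc (Suc n))" if "length bs = Suc n" for bs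
    unfolding cop_at_def mem_Collect_eq
    by (rule keys_lin) (use that k in \<open>auto intro!: order_trans[OF keys_gen]\<close>)
  have f: "?f z \<in> ZF (Suc n)" if "z \<in> carr (Bpow \<B> (Suc n)) \<times> carr X" for z
    using that len by (auto intro!: ZF_gen induced_in_Bpow simp del: mem_Collect_eq)
  have key: "qlin (ev (Phi_form (Suc n) k)) (?f z) = ev (Phi_form n (\<lambda>ts. k (insert_one i ts))) z"
    if z: "z \<in> carr (Bpow \<B> (Suc n)) \<times> carr X" and k': "Cbal (Suc (Suc n)) k"
    for z and k :: "'t list \<Rightarrow> ('t list, 'k) quo"
  proof -
    obtain \<beta> x where z': "z = (\<beta>, x)" "\<beta> \<in> carr (Bpow \<B> (Suc n))" using z by auto
    have "qlin (\<lambda>bs. Phi_form (Suc n) k bs t) (cop_at \<B> i bs) = Phi_form n (\<lambda>ts. k (insert_one i ts)) bs t"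
      if bs: "length bs = Suc n" for bs t
    proof -
      have "qlin (\<lambda>bs. Phi_form (Suc n) k bs t) (cop_at \<B> i bs) =
          D (\<lambda>b1 b2. Chain (\<lambda>ts. k (wrap (Suc n) ts)) (take i bs @ b1 # b2 # drop (Suc i) bs) t) (bs ! i)"
        by (simp add: cop_at_def D_def Phi_form_def qlin_flin qlin_gen case_prod_unfold)
      also have "\<dots> = Chain (\<lambda>ts. k (wrap (Suc n) (insert_one i ts))) bs t"
        using Sbal_wrap[OF k'] bs k by (intro Chain_cop) auto
      \<comment> \<open>Here the identity is \<open>d_(n+2) s_i = s_i d_(n+1)\<close>.\<close>
      also have "\<dots> = Chain (\<lambda>ts. k (insert_one i (wrap n ts))) bs t"
      proof (rule Chain_cong)
        fix ts :: "'t list" assume "length ts = Suc (length bs)"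
        then show "k (wrap (Suc n) (insert_one i ts)) = k (insert_one i (wrap n ts))"
          using mult_at_insert_one(3)[of ts "Suc n" i "Suc (Suc n)"] \<open>i \<le> n\<close> bs by simp
      qed
      finally show ?thesis by (simp add: Phi_form_def)
    qed
    from ev_gen_induced[OF k' z'(2) this] show ?thesis by (simp add: z'(1) qlin_gen)
  qed
  show "kmod_hom (deg (Z_B \<B> X) n) (deg (Z_B \<B> X) (Suc n)) (degen (Z_B \<B> X) n i)"
    unfolding Z_B_sel(3) by (rule list_op_transport(1)[OF q f key])
  show "x \<in> carr (deg (Z_B \<B> X) n) \<Longrightarrow>
      comparison (Suc n) (degen (Z_B \<B> X) n i x) = degen (Z_T T S) n i (comparison n x)"
    unfolding Z_B_sel(3) Z_T_sel(3) by (rule list_op_transport(2)[OF q f key])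
qed

text \<open>The right \<open>R\<close>-action on \<open>T_S\<close> goes through a representative;
  it is independent of it because \<open>j r\<close> commutes with \<open>S\<close>.\<close>

lemma ract_rep_X:
  assumes f: "Tlinear f" and s: "\<And>s t. s \<in> S \<Longrightarrow> f (s * t) = f (t * s)"
  shows "f (rep (pT T S (ract T (rep (pT T S t)) r))) = f (t * j r)"
proof -
  have "f (rep (pT T S (ract T (rep (pT T S t)) r))) = f (rep (pT T S t) * j r)"
    by (simp add: rep_pT[OF f s] ract_eq)
  also have "\<dots> = f (t * j r)"
  proof (rule rep_pT[OF klinear_mult_right[OF f]])
    fix s' t' assume s': "s' \<in> S"
    show "f (s' * t' * j r) = f (t' * s' * j r)"
      using s[OF s', of "t' * j r"] j_S_commute[OF s', of r] by (simp add: mult.assoc)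
  qed
  finally show ?thesis .
qed

text \<open>The coaction on \<open>T_S\<close> is a coset over classes modulo commutators. The trace
  property of \<open>g\<close> removes the choice of representatives of these classes,
  \<open>TBbal\<close> the choice in the coset.\<close>

lemma qlin_bcoact:
  assumes add: "\<And>b. Tlinear (\<lambda>t. g t b)" and s: "\<And>s t b. s \<in> S \<Longrightarrow> g (s * t) b = g (t * s) b"
    and g: "TBbal g"
  shows "qlin (\<lambda>(x0, b). g (rep x0) b) (rep (bcoact X x)) = Rho g (rep x)"
proof -
  have bal: "balanced qscale (TS_mod T S) (whole (smB \<B>)) UNIV (\<lambda>x r. pT T S (ract T (rep x) r)) (lR \<B>)
      (\<lambda>x b. g (rep x) b)"
  proof -
    have r: "g (rep (pT T S t)) b = g t b" for t b by (rule rep_pT[OF add s])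
    have r': "g (ract T (rep (pT T S t)) r) b = g (t * j r) b" for t r b
      unfolding r[of "ract T (rep (pT T S t)) r", symmetric] by (rule ract_rep_X[OF add s])
    have X: "carr (TS_mod T S) = {pT T S t | t. True}" "sm (TS_mod T S) c (pT T S t) = pT T S (smT T c t)" for c t
      using X_sel(1,2) by (simp_all add: T_S_def)
    show ?thesis
      unfolding balanced_def X(1)
      using g add by (auto simp: X(2) pT_add r r' TBbal_def bilinear_def lR_def)
  qed
  have "qlin (\<lambda>(x0, b). g (rep x0) b) (rep (bcoact X x)) =
      qlin (\<lambda>(x0, b). g (rep x0) b) (flin (\<lambda>(t0, b). gen (pT T S t0, b)) (rep (coact T (rep x))))"
    unfolding X_sel(4)
    by (rule qlin_rep_coset) (auto simp: TSB_rel_def intro: lin_bal_rel[OF scaling_qscale bal])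
  also have "\<dots> = Rho g (rep x)"
    by (simp add: qlin_flin qlin_gen case_prod_unfold Rho_def rep_pT[OF add s])
  finally show ?thesis .
qed

lemma cyc_transport:
  shows "kmod_hom (deg (Z_B \<B> X) n) (deg (Z_B \<B> X) n) (cyc (Z_B \<B> X) n)"
    and "x \<in> carr (deg (Z_B \<B> X) n) \<Longrightarrow> comparison n (cyc (Z_B \<B> X) n x) = cyc (Z_T T S) n (comparison n x)"
proof -
  let ?c = "\<lambda>bs b. gen ((last bs * b) # butlast bs) +o Bpow_rel \<B> (Suc n)"
  let ?f = "\<lambda>(\<beta>, x). flin (\<lambda>bs. flin (\<lambda>(x0, b). gen (?c bs b, x0)) (rep (bcoact X x))) (rep \<beta>)"
  have q: "Cbal (Suc n) (\<lambda>ts. k (rot ts))" if "Cbal (Suc n) k" for k :: "'t list \<Rightarrow> ('t list, 'k) quo"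
    by (rule Cbal_rot[OF that])
  have len: "gen ((last bs * b) # butlast bs) \<in> tuples (Suc n)" if "length bs = Suc n" for bs and b :: 'b
    by (rule gen_in_keys) (use that in simp)
  \<comment> \<open>The rotation builds new generators from a chosen representative of the coaction;
    its first legs must lie in \<open>carr X\<close> for these to belong to
    \<open>ZF n\<close>.\<close>
  have bco: "Poly_Mapping.keys (rep (bcoact X x)) \<subseteq> carr X \<times> UNIV" for x
  proof -
    have sub: "TSB_rel \<B> T S \<subseteq> {u. Poly_Mapping.keys u \<subseteq> carr X \<times> UNIV}"
      using bal_rel_subset[of "TS_mod T S" "whole (smB \<B>)" UNIV "\<lambda>x r. pT T S (ract T (rep x) r)" "lR \<B>"]
        X_closed(1,2) pT_in
      unfolding TSB_rel_def by (simp add: T_S_def)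
    let ?u = "flin (\<lambda>(t0, b). gen (pT T S t0, b)) (rep (coact T (rep x)))"
    have u: "?u \<in> {u. Poly_Mapping.keys u \<subseteq> carr X \<times> UNIV}"
      unfolding mem_Collect_eq by (rule keys_lin) (auto intro!: order_trans[OF keys_gen])
    have sub': "ksubmodule fscale (TSB_rel \<B> T S)" by (simp add: TSB_rel_def)
    have "rep (bcoact X x) \<in> {u. Poly_Mapping.keys u \<subseteq> carr X \<times> UNIV}"
      using ksubmoduleD(2)[OF ksubmodule_keys u subsetD[OF sub rep_diff[OF sub', of ?u]]]
      by (simp add: X_sel(4))
    then show ?thesis by simp
  qed
  have f: "?f z \<in> ZF n" if z: "z \<in> carr (Bpow \<B> (Suc n)) \<times> carr X" for z
  proof -
    obtain \<beta> x where z': "z = (\<beta>, x)" "\<beta> \<in> carr (Bpow \<B> (Suc n))" using z by auto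
    have "gen (?c bs b, x0) \<in> ZF n" if "length bs = Suc n" "(x0, b) \<in> Poly_Mapping.keys (rep (bcoact X x))" for bs x0 b
      using that bco by (intro ZF_gen coset_in_Bpow len) auto
    then have "Poly_Mapping.keys (flin (\<lambda>(x0, b). gen (?c bs b, x0)) (rep (bcoact X x))) \<subseteq>
        carr (Bpow \<B> (Suc n)) \<times> carr X" if "length bs = Suc n" for bs
      using that unfolding ZF_def mem_Collect_eq by - (rule keys_lin, simp only: split_paired_all prod.case)
    then show ?thesis
      using rep_tuples[OF z'(2)] unfolding z'(1) ZF_def mem_Collect_eq prod.case by - (rule keys_lin, blast)
  qed
  have key: "qlin (ev (Phi_form n k)) (?f z) = ev (Phi_form n (\<lambda>ts. k (rot ts))) z"
    if z: "z \<in> carr (Bpow \<B> (Suc n)) \<times> carr X" and k: "Cbal (Suc n) k"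
    for z and k :: "'t list \<Rightarrow> ('t list, 'k) quo"
  proof -
    obtain \<beta> x where z': "z = (\<beta>, x)" "\<beta> \<in> carr (Bpow \<B> (Suc n))" using z by auto
    note H = ZBbal_Phi_form[OF k]
    have eq: "qlin (\<lambda>(x0, b). ev (Phi_form n k) (?c bs b, x0)) (rep (bcoact X x)) = Phi_form n (\<lambda>ts. k (rot ts)) bs (rep x)"
      if bs: "length bs = Suc n" for bs
    proof -
      let ?g = "\<lambda>t b. Phi_form n k ((last bs * b) # butlast bs) t"
      have len': "length ((last bs * b) # butlast bs) = Suc n" for b using bs by simp
      have add: "Tlinear (\<lambda>t. ?g t b)" and comm: "\<And>s t. s \<in> S \<Longrightarrow> ?g (s * t) b = ?g (t * s) b" for b
        using H len'[of b] unfolding ZBbal_def by blast+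
      have B: "Bbal (Suc n) (\<lambda>bs. Phi_form n k bs t)" for t
        using H by (simp add: ZBbal_def)
      have "Blinear (?g t)" for t
        using klinear_multB_left[OF Bbal_head[OF B, of "butlast bs"]] bs by simp
      moreover have "?g (t * j r) b = ?g t (b * zeta \<B> r)" for t r b
      proof -
        have "Sbal (Suc (Suc (length (butlast bs)))) (\<lambda>ts. k (wrap n ts))"
          using Sbal_wrap[OF k] bs by simp
        from Chain_zeta[OF this] show ?thesis by (simp add: Phi_form_def flip: mult.assoc)
      qed
      ultimately have TB: "TBbal ?g" using add by (simp add: TBbal_iff)
      have "ev (Phi_form n k) (?c bs b, x0) = ?g (rep x0) b" for x0 b
        by (simp add: ev_def qlin_rep_coset Bbal_zero[OF B] qlin_gen)
      then have "qlin (\<lambda>(x0, b). ev (Phi_form n k) (?c bs b, x0)) (rep (bcoact X x)) = Rho ?g (rep x)"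
        using qlin_bcoact[OF add comm TB] by simp
      also have "\<dots> = Chain (\<lambda>ts. k (rot (wrap n ts))) (butlast bs @ [last bs]) (rep x)"
        unfolding Phi_form_def by (rule Chain_rho[OF Sbal_wrap[OF k]]) (simp add: bs)
      also have "butlast bs @ [last bs] = bs"
        using bs by (intro append_butlast_last_id) auto
      finally show ?thesis by (simp only: Phi_form_def[of n "\<lambda>ts. k (rot ts)"])
    qed
    have "qlin (ev (Phi_form n k)) (?f z) =
        qlin (\<lambda>bs. qlin (\<lambda>(x0, b). ev (Phi_form n k) (?c bs b, x0)) (rep (bcoact X x))) (rep \<beta>)"
      by (simp add: z'(1) qlin_flin qlin_gen case_prod_unfold)
    also have "\<dots> = qlin (\<lambda>bs. Phi_form n (\<lambda>ts. k (rot ts)) bs (rep x)) (rep \<beta>)"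
      using rep_tuples[OF z'(2)] by (intro lin_cong eq) auto
    finally show ?thesis by (simp add: ev_def z'(1))
  qed
  show "kmod_hom (deg (Z_B \<B> X) n) (deg (Z_B \<B> X) n) (cyc (Z_B \<B> X) n)"
    unfolding Z_B_sel(4) by (rule list_op_transport(1)[OF q f key])
  show "x \<in> carr (deg (Z_B \<B> X) n) \<Longrightarrow> comparison n (cyc (Z_B \<B> X) n x) = cyc (Z_T T S) n (comparison n x)"
    unfolding Z_B_sel(4) Z_T_sel(4) by (rule list_op_transport(2)[OF q f key])
qed

lemma cyclic_iso_comparison: "cyclic_iso (Z_B \<B> X) (Z_T T S) comparison"
  by (simp add: cyclic_iso_def kmod_iso_comparison face_transport degen_transport cyc_transport)

lemma cyclic_module_Z_B: "cyclic_module (Z_B \<B> X)"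
proof (rule cyclic_module_transport[OF cyclic_module_Z_T _ _ _ _ cyclic_iso_comparison])
  show "kmodule (deg (Z_B \<B> X) n)" for n
    unfolding Z_B_sel by (rule kmodule_quot) (simp_all add: ZF_sub)
qed (rule face_transport degen_transport cyc_transport; assumption?)+

end

theorem theorem2p26:
  fixes \<B> :: "('k::{comm_ring,comm_monoid_mult}, 'r::{ring,monoid_mult}, 'b::{ring,monoid_mult}) bialgebroid"
    and T :: "('k, 'r, 'b, 't::{ring,monoid_mult}) comodule_data"
    and S :: "'t set"
  assumes "right_times_Hopf \<B>"
    and "Galois_extension \<B> T S"
  shows "cyclic_module (Z_B \<B> (T_S \<B> T S)) \<and> cyclic_module (Z_T T S) \<and>
    (\<exists>\<phi>. cyclic_iso (Z_B \<B> (T_S \<B> T S)) (Z_T T S) \<phi>)"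
proof -
  interpret hopf_galois \<B> T S using assms by unfold_locales
  show ?thesis using cyclic_module_Z_B cyclic_module_Z_T cyclic_iso_comparison by blast
qed

end
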